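(* Let $A\in C^1(\mathbb{R}^* )\cap L^2(\mathbb{R}^*,dx)$ be a real-valued function whose support is the whole of $\mathbb{R}^*$, and put $A^\pm=A\chi_{\mathbb{R}_\pm}$. Assume that the kernel $$L(x,y)=\frac{A^+(x)A^-(y)+A^-(x)A^+(y)}{x-y},\qquad x,y\in\mathbb{R}^*,$$ defines a bounded operator $L$ on $L^2(\mathbb{R}^*,dx)$, and let $\mu_L$ be the determinantal point process on $\mathbb{R}^*$ with correlation kernel $K_L=L(1+L)^{-1}$. Let $n\ge1$. Then for $\rho_{2n}$-almost every $2n$-tuple of distinct points $\mathfrak{p}=(p_1^+,\dots,p_n^+;p_1^-,\dots,p_n^-)\in\mathbb{R}_+^n\times\mathbb{R}_-^n$, where $\rho_{2n}$ is the $2n$-th correlation measure of $\mu_L$, the reduced Palm measure $\mu_L^{\mathfrak{p}}$ is again an $L$-process, given by $$\mu_L^{\mathfrak{p}}=\mu_{f_{\mathfrak{p}}Lf_{\mathfrak{p}}},\qquad f_{\mathfrak{p}}(x)=\prod_{i=1}^n\Big(\frac{x/p_i^+-1}{x/p_i^--1}\chi_{\mathbb{R}_+}(x)+\frac{x/p_i^--1}{x/p_i^+-1}\chi_{\mathbb{R}_-}(x)\Big).$$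
   Context: $\mathbb{R}^*=\mathbb{R}\setminus\{0\}=\mathbb{R}_+\sqcup\mathbb{R}_-$ (open positive and negative semi-axes). Bounded functions are identified with multiplication operators, so $fLf$ has kernel $f(x)L(x,y)f(y)$. Every operator $L$ considered is bounded and anti-self-adjoint of the block form $\begin{bmatrix}0&V\\-V^*&0\end{bmatrix}$ with respect to $L^2(\mathbb{R}_+)\oplus L^2(\mathbb{R}_-)$, so $1+L$ is invertible; $K_L:=L(1+L)^{-1}$ is the correlation kernel of a determinantal point process on $\mathbb{R}^*$, denoted $\mu_L$; such processes are called $L$-processes. $\mathrm{Conf}(\mathbb{R}^* )$ is the set of locally finite subsets of $\mathbb{R}^*$ (finite intersection with every compact subset of $\mathbb{R}^*$) with its usual Borel structure generated by counting maps. A probability measure on it is determinantal with correlation kernel $K$ if for all $k\ge1$ its $k$-th correlation measure is $\rho_k(dx_1\cdots dx_k)=\det(K(x_i,x_j))_{1\le i,j\le k}\,dx_1\cdots dx_k$, where $\rho_k$ is characterized by $\mathbb{E}\prod_{i=1}^k\#(X\cap D_i)=\rho_k(D_1\times\cdots\times D_k)$ for disjoint relatively compact Borel $D_i\subset\mathbb{R}^*$. Reduced Palm measures. For a point process $\mathbb{P}$ with correlation measures $\rho_k$, the reduced Palm measures $\mathbb{P}^{\mathfrak{q}}$, defined for $\rho_k$-almost every $k$-tuple $\mathfrak{q}=(q_1,\dots,q_k)$ of distinct points, are point processes determined by $$\int\sum^{*}_{q_1,\dots,q_k\in X}u(X;\mathfrak{q})\,\mathbb{P}(dX)=\int\rho_k(d\mathfrak{q})\int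 u(X\cup\{q_1,\dots,q_k\};\mathfrak{q})\,\mathbb{P}^{\mathfrak{q}}(dX)$$ for all non-negative Borel $u$, where $\sum^*$ is over $k$-tuples of distinct points of $X$. *)

theory Defs
  imports "HOL-Probability.Probability" "Jordan_Normal_Form.Determinant"
begin

text \<open>
  Elements of the complex Hilbert space of square integrable functions on the punctured line are
  represented by Borel functions, equality being equality almost everywhere, and operators by maps
  on representatives.
\<close>

definition Rstar :: "real set" where
  "Rstar = UNIV - {0}"

definition leb_Rstar :: "real measure" where
  "leb_Rstar = restrict_space lborel Rstar"

definition L2 :: "(real \<Rightarrow> complex) set" where
  "L2 = {f \<in> borel_measurable leb_Rstar. integrable leb_Rstar (\<lambda>x. (cmod (f x))\<^sup>2)}"

definition L2_norm :: "(real \<Rightarrow> complex) \<Rightarrow> real" where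
  "L2_norm f = sqrt (LINT x|leb_Rstar. (cmod (f x))\<^sup>2)"

definition L2_inner :: "(real \<Rightarrow> complex) \<Rightarrow> (real \<Rightarrow> complex) \<Rightarrow> complex" where
  "L2_inner f g = (LINT x|leb_Rstar. f x * cnj (g x))"

definition eq_ae :: "(real \<Rightarrow> complex) \<Rightarrow> (real \<Rightarrow> complex) \<Rightarrow> bool" where
  "eq_ae f g \<longleftrightarrow> (AE x in leb_Rstar. f x = g x)"

type_synonym oper = "(real \<Rightarrow> complex) \<Rightarrow> (real \<Rightarrow> complex)"

text \<open>Compatibility with almost everywhere equality is a consequence of linearity and the norm bound.\<close>

definition bounded_oper :: "oper \<Rightarrow> bool" where
  "bounded_oper T \<longleftrightarrow>
     (\<forall>f\<in>L2. T f \<in> L2) \<and>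
     (\<forall>f\<in>L2. \<forall>g\<in>L2. \<forall>c. eq_ae (T (\<lambda>x. c * f x + g x)) (\<lambda>x. c * T f x + T g x)) \<and>
     (\<exists>C. \<forall>f\<in>L2. L2_norm (T f) \<le> C * L2_norm f)"

text \<open>
  The block form with rows \<open>(0, V)\<close> and \<open>(-V\<^sup>*, 0)\<close>: the operator is anti-self-adjoint and
  exchanges the functions living on the two half-lines.
\<close>

definition block_anti_self_adjoint :: "oper \<Rightarrow> bool" where
  "block_anti_self_adjoint T \<longleftrightarrow>
     (\<forall>f\<in>L2. \<forall>g\<in>L2. L2_inner (T f) g = - L2_inner f (T g)) \<and>
     (\<forall>f\<in>L2. (AE x in leb_Rstar. x < 0 \<longrightarrow> f x = 0) \<longrightarrow> (AE x in leb_Rstar. x > 0 \<longrightarrow> T f x = 0)) \<and>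
     (\<forall>f\<in>L2. (AE x in leb_Rstar. x > 0 \<longrightarrow> f x = 0) \<longrightarrow> (AE x in leb_Rstar. x < 0 \<longrightarrow> T f x = 0))"

definition integral_oper :: "(real \<Rightarrow> real \<Rightarrow> complex) \<Rightarrow> oper" where
  "integral_oper k f = (\<lambda>x. LINT y|leb_Rstar. k x y * f y)"

definition defines_bounded_oper :: "(real \<Rightarrow> real \<Rightarrow> complex) \<Rightarrow> bool" where
  "defines_bounded_oper k \<longleftrightarrow>
     (\<lambda>(x, y). k x y) \<in> borel_measurable (leb_Rstar \<Otimes>\<^sub>M leb_Rstar) \<and>
     (\<forall>f\<in>L2. AE x in leb_Rstar. integrable leb_Rstar (\<lambda>y. k x y * f y)) \<and>
     bounded_oper (integral_oper k)"

definition mult_oper :: "(real \<Rightarrow> real) \<Rightarrow> oper" where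
  "mult_oper h f = (\<lambda>x. complex_of_real (h x) * f x)"

definition inverse_of_one_plus :: "oper \<Rightarrow> oper \<Rightarrow> bool" where
  "inverse_of_one_plus T S \<longleftrightarrow>
     bounded_oper S \<and>
     (\<forall>f\<in>L2. eq_ae (S (\<lambda>x. f x + T f x)) f \<and> eq_ae (\<lambda>x. S f x + T (S f) x) f)"

text \<open>
  \<open>K\<close> is the kernel of \<open>T (1 + T)\<^sup>-\<^sup>1\<close>.  An operator determines its kernel only up to null sets,
  whereas the determinants below involve the diagonal; the kernel is therefore taken to be the
  continuous one, which is unique.
\<close>

definition L_correlation_kernel :: "oper \<Rightarrow> (real \<Rightarrow> real \<Rightarrow> complex) \<Rightarrow> bool" where
  "L_correlation_kernel T K \<longleftrightarrow>
     continuous_on (Rstar \<times> Rstar) (\<lambda>(x, y). K x y) \<and>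
     defines_bounded_oper K \<and>
     (\<exists>S. inverse_of_one_plus T S \<and> (\<forall>f\<in>L2. eq_ae (integral_oper K f) (T (S f))))"

definition Conf :: "real set set" where
  "Conf = {X. X \<subseteq> Rstar \<and> (\<forall>C. compact C \<and> C \<subseteq> Rstar \<longrightarrow> finite (X \<inter> C))}"

definition rel_compact_borel :: "real set \<Rightarrow> bool" where
  "rel_compact_borel D \<longleftrightarrow> D \<in> sets borel \<and> (\<exists>C. compact C \<and> C \<subseteq> Rstar \<and> D \<subseteq> C)"

definition conf_space :: "real set measure" where
  "conf_space = sigma Conf {{X \<in> Conf. card (X \<inter> D) = m} | D m. rel_compact_borel D}"

definition point_process :: "real set measure \<Rightarrow> bool" where
  "point_process P \<longleftrightarrow> prob_space P \<and> sets P = sets conf_space"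

text \<open>A \<open>k\<close>-tuple is an extensional function on \<open>{..<k}\<close>.\<close>

definition leb_tuples :: "nat \<Rightarrow> (nat \<Rightarrow> real) measure" where
  "leb_tuples k = PiM {..<k} (\<lambda>_. leb_Rstar)"

text \<open>
  Products of disjoint sets do not see tuples with repeated entries; correlation measures do not
  charge them.
\<close>

definition correlation_measure :: "real set measure \<Rightarrow> nat \<Rightarrow> (nat \<Rightarrow> real) measure \<Rightarrow> bool" where
  "correlation_measure P k \<rho> \<longleftrightarrow>
     sets \<rho> = sets (leb_tuples k) \<and>
     emeasure \<rho> {q \<in> space \<rho>. \<not> inj_on q {..<k}} = 0 \<and>
     (\<forall>D. (\<forall>i<k. rel_compact_borel (D i)) \<and> disjoint_family_on D {..<k} \<longrightarrow>
        (\<integral>\<^sup>+X. (\<Prod>i<k. of_nat (card (X \<inter> D i))) \<partial>P) = emeasure \<rho> (Pi\<^sub>E {..<k} D))"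

definition kernel_det :: "(real \<Rightarrow> real \<Rightarrow> complex) \<Rightarrow> nat \<Rightarrow> (nat \<Rightarrow> real) \<Rightarrow> complex" where
  "kernel_det K k q = Determinant.det (mat k k (\<lambda>(i, j). K (q i) (q j)))"

definition determinantal :: "real set measure \<Rightarrow> (real \<Rightarrow> real \<Rightarrow> complex) \<Rightarrow> bool" where
  "determinantal P K \<longleftrightarrow>
     point_process P \<and>
     (\<forall>k\<ge>1. (AE q in leb_tuples k. kernel_det K k q \<in> \<real>\<^sub>\<ge>\<^sub>0) \<and>
        correlation_measure P k (density (leb_tuples k) (\<lambda>q. ennreal (Re (kernel_det K k q)))))"

definition L_process :: "oper \<Rightarrow> real set measure \<Rightarrow> bool" where
  "L_process T P \<longleftrightarrow>
     bounded_oper T \<and> block_anti_self_adjoint T \<and>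
     (\<exists>K. L_correlation_kernel T K \<and> determinantal P K)"

text \<open>
  A version of the family of reduced Palm measures of \<open>P\<close>, where \<open>\<rho>\<close> is the \<open>k\<close>-th correlation
  measure of \<open>P\<close>.  Since configurations are sets, the disintegration formula alone does not
  distinguish \<open>X\<close> from \<open>X \<union> {q\<^sub>1}\<close>; that the measures are reduced means that they are carried by
  configurations avoiding the points of \<open>q\<close>.
\<close>

definition reduced_Palm ::
    "real set measure \<Rightarrow> nat \<Rightarrow> (nat \<Rightarrow> real) measure \<Rightarrow> ((nat \<Rightarrow> real) \<Rightarrow> real set measure) \<Rightarrow> bool" where
  "reduced_Palm P k \<rho> Q \<longleftrightarrow>
     Q \<in> \<rho> \<rightarrow>\<^sub>M prob_algebra conf_space \<and>
     (AE q in \<rho>. AE X in Q q. q ` {..<k} \<inter> X = {}) \<and>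
     (\<forall>u :: real set \<times> (nat \<Rightarrow> real) \<Rightarrow> ennreal.
        u \<in> borel_measurable (conf_space \<Otimes>\<^sub>M leb_tuples k) \<longrightarrow>
        (\<integral>\<^sup>+X. (\<integral>\<^sup>+q. u (X, q) \<partial>count_space {q \<in> {..<k} \<rightarrow>\<^sub>E X. inj_on q {..<k}}) \<partial>P) =
        (\<integral>\<^sup>+q. (\<integral>\<^sup>+X. u (X \<union> q ` {..<k}, q) \<partial>Q q) \<partial>\<rho>))"

definition A_plus :: "(real \<Rightarrow> real) \<Rightarrow> real \<Rightarrow> real" where
  "A_plus A x = A x * indicator {0<..} x"

definition A_minus :: "(real \<Rightarrow> real) \<Rightarrow> real \<Rightarrow> real" where
  "A_minus A x = A x * indicator {..<0} x"

definition L_kernel :: "(real \<Rightarrow> real) \<Rightarrow> real \<Rightarrow> real \<Rightarrow> complex" where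
  "L_kernel A x y = complex_of_real ((A_plus A x * A_minus A y + A_minus A x * A_plus A y) / (x - y))"

text \<open>
  In the \<open>2n\<close>-tuple \<open>p\<close> the entry \<open>p i\<close>, \<open>i < n\<close>, stands for the positive point with index
  \<open>i + 1\<close>, and \<open>p (n + i)\<close> for the negative one.
\<close>

definition f_Palm :: "nat \<Rightarrow> (nat \<Rightarrow> real) \<Rightarrow> real \<Rightarrow> real" where
  "f_Palm n p x = (\<Prod>i<n.
      (x / p i - 1) / (x / p (n + i) - 1) * indicator {0<..} x +
      (x / p (n + i) - 1) / (x / p i - 1) * indicator {..<0} x)"

end

theory Submission
  imports Defs
begin

text \<open>
  For a process on a finite set which gives weight proportional to \<open>det L\<^sub>X\<close> to a configuration \<open>X\<close>, the
  theorem is linear algebra. Conditioning on the points of \<open>p\<close> and removing them replaces \<open>L\<close> by its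
  Schur complement \<open>L\<^sup>p\<close> with respect to the block of \<open>p\<close>, because \<open>det L\<close> of \<open>X \<union> p\<close> is \<open>det L\<close> of \<open>p\<close>
  times \<open>det L\<^sup>p\<close> of \<open>X\<close>; the correlation kernel \<open>K = L (1 + L)\<^sup>-\<^sup>1\<close> is likewise replaced by its own Schur
  complement \<open>K\<^sup>p\<close>, and \<open>K\<^sup>p = L\<^sup>p (1 + L\<^sup>p)\<^sup>-\<^sup>1\<close>. The kernel considered here is of Cauchy type, and for such
  a kernel the Schur complement is \<open>f\<^sub>p L f\<^sub>p\<close>, by a decomposition into partial fractions. On the punctured
  line the weights make no sense, but \<open>K\<^sup>p\<close>, \<open>f\<^sub>p L f\<^sub>p\<close> and the relation between them do.

  The operator side. The rows of \<open>K\<close> are square integrable and solve the resolvent equation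
  \<open>K + K L = L\<close> at every point of the punctured line, not only almost everywhere (\<open>K_kappa\<close>, \<open>K_eq\<close>). This
  allows evaluation at the points of \<open>p\<close>, which form a null set. The rows of \<open>f\<^sub>p L f\<^sub>p\<close> differ from those
  of \<open>L\<close> by combinations of the rows of \<open>L\<close> at the points of \<open>p\<close> (\<open>f_Palm_partial_fractions\<close>), and both
  Schur complements vanish at \<open>p\<close>; subtracting the rows at \<open>p\<close> from the resolvent equation of \<open>K\<close> yields
  the one of \<open>K\<^sup>p\<close> and \<open>f\<^sub>p L f\<^sub>p\<close> (\<open>K'_resolvent\<close>). Hence \<open>1 - K\<^sup>p\<close> is a left inverse of
  \<open>1 + f\<^sub>p L f\<^sub>p\<close>. It is also a right inverse, since changing the signs on a half-line transposes all the
  kernels.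

  The probabilistic side. The Schur complement formula (\<open>kernel_det_join\<close>) gives
  \<open>det K\<close> of \<open>(p, q)\<close> as \<open>det K\<close> of \<open>p\<close> times \<open>det K\<^sup>p\<close> of \<open>q\<close>. The left side is the density of the joint
  correlation measure, which the defining formula of the Palm measures disintegrates over \<open>p\<close>
  (\<open>Palm_disintegration\<close>); so \<open>det K\<^sup>p\<close> has to be the density of the correlation measure of the Palm
  measure at \<open>p\<close>. The exceptional null set of \<open>p\<close> must not depend on the test sets. Countably many test
  sets suffice, because a measure on tuples of distinct points is determined by products of disjoint
  rational intervals (\<open>tuple_measure_determined\<close>).
\<close>

section \<open>Square integrable functions on the punctured line\<close>

text \<open>
  A bilinear pairing instead of the inner product, because kernels are transposed and not adjoined
  throughout; then \<open>integral_oper k f x\<close> is the pairing of the row \<open>k x\<close> with \<open>f\<close>.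
\<close>
definition pairing :: "(real \<Rightarrow> complex) \<Rightarrow> (real \<Rightarrow> complex) \<Rightarrow> complex" where
  "pairing u v = (LINT x|leb_Rstar. u x * v x)"

text \<open>The unitary involution which conjugates \<open>L\<close> to \<open>-L\<close>, hence to the transpose of \<open>L\<close>.\<close>
definition sign_flip :: "(real \<Rightarrow> complex) \<Rightarrow> real \<Rightarrow> complex" where
  "sign_flip u = (\<lambda>x. complex_of_real (sgn x) * u x)"

lemma space_leb_Rstar [simp]: "space leb_Rstar = Rstar"
  by (simp add: leb_Rstar_def space_restrict_space)

lemma Rstar_borel [measurable, simp]: "Rstar \<in> sets borel"
  by (simp add: Rstar_def)

lemma sets_leb_Rstar: "sets leb_Rstar = sets (restrict_space borel Rstar)"
  unfolding leb_Rstar_def by (intro sets_restrict_space_cong) simp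

lemma borel_measurable_leb_Rstar:
  "f \<in> borel_measurable borel \<Longrightarrow> f \<in> borel_measurable leb_Rstar"
  unfolding leb_Rstar_def by (intro measurable_restrict_space1) simp

lemma continuous_on_Rstar_measurable:
  fixes f :: "real \<Rightarrow> 'a :: topological_space"
  assumes "continuous_on Rstar f"
  shows "f \<in> borel_measurable leb_Rstar"
  using borel_measurable_continuous_on_restrict[OF assms]
  by (simp add: measurable_cong_sets[OF sets_leb_Rstar refl])

lemma L2_measurable: "u \<in> L2 \<Longrightarrow> u \<in> borel_measurable leb_Rstar"
  by (simp add: L2_def)

lemma L2_integrable: "u \<in> L2 \<Longrightarrow> integrable leb_Rstar (\<lambda>x. (cmod (u x))\<^sup>2)"
  by (simp add: L2_def)

lemma L2_I_dominated:
  assumes "u \<in> borel_measurable leb_Rstar" "integrable leb_Rstar g"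
    "\<And>x. x \<in> Rstar \<Longrightarrow> (cmod (u x))\<^sup>2 \<le> g x"
  shows "u \<in> L2"
proof -
  have "integrable leb_Rstar (\<lambda>x. (cmod (u x))\<^sup>2)"
    by (rule Bochner_Integration.integrable_bound[OF assms(2)])
      (use assms in \<open>auto intro!: AE_I2 order_trans[OF assms(3)]\<close>)
  with assms(1) show ?thesis by (simp add: L2_def)
qed

lemma cmod_add_power2_le: "(cmod (a + b))\<^sup>2 \<le> 2 * (cmod a)\<^sup>2 + 2 * (cmod b)\<^sup>2"
proof -
  have "(cmod (a + b))\<^sup>2 \<le> (cmod a + cmod b)\<^sup>2"
    by (intro power_mono norm_triangle_ineq) auto
  also have "\<dots> \<le> 2 * (cmod a)\<^sup>2 + 2 * (cmod b)\<^sup>2"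
    using zero_le_power2[of "cmod a - cmod b"] by (simp add: power2_eq_square algebra_simps)
  finally show ?thesis .
qed

lemma L2_add:
  assumes "u \<in> L2" "v \<in> L2" shows "(\<lambda>x. u x + v x) \<in> L2"
proof (rule L2_I_dominated[where g = "\<lambda>x. 2 * (cmod (u x))\<^sup>2 + 2 * (cmod (v x))\<^sup>2"])
qed (use cmod_add_power2_le L2_measurable[OF assms(1)] L2_measurable[OF assms(2)] L2_integrable[OF assms(1)]
      L2_integrable[OF assms(2)] in auto)

lemma L2_mult_bounded:
  assumes "u \<in> L2" "g \<in> borel_measurable leb_Rstar" "\<And>x. x \<in> Rstar \<Longrightarrow> cmod (g x) \<le> C"
  shows "(\<lambda>x. g x * u x) \<in> L2"
proof (rule L2_I_dominated[where g = "\<lambda>x. C\<^sup>2 * (cmod (u x))\<^sup>2"])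
  show "(cmod (g x * u x))\<^sup>2 \<le> C\<^sup>2 * (cmod (u x))\<^sup>2" if "x \<in> Rstar" for x
    using assms(3)[OF that] by (auto simp: norm_mult power_mult_distrib intro!: mult_right_mono power_mono)
qed (use L2_measurable[OF assms(1)] assms(2) L2_integrable[OF assms(1)] in auto)

lemma L2_scale: "u \<in> L2 \<Longrightarrow> (\<lambda>x. c * u x) \<in> L2"
  by (rule L2_mult_bounded[where C = "cmod c"]) auto

lemma L2_diff: "u \<in> L2 \<Longrightarrow> v \<in> L2 \<Longrightarrow> (\<lambda>x. u x - v x) \<in> L2"
  using L2_add[of u "\<lambda>x. (-1) * v x"] L2_scale[of v "-1"] by simp

lemma L2_zero: "(\<lambda>x. 0) \<in> L2"
  by (simp add: L2_def)

lemma L2_sum: "finite I \<Longrightarrow> (\<And>i. i \<in> I \<Longrightarrow> u i \<in> L2) \<Longrightarrow> (\<lambda>x. \<Sum>i\<in>I. u i x) \<in> L2"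
  by (induction I rule: finite_induct) (auto intro: L2_add L2_zero)

lemma L2_cnj: "u \<in> L2 \<Longrightarrow> (\<lambda>x. cnj (u x)) \<in> L2"
  using measurable_compose[OF L2_measurable borel_measurable_continuous_onI[OF continuous_on_cnj[OF continuous_on_id]]]
  by (auto simp: L2_def)

lemma L2_sign_flip: "u \<in> L2 \<Longrightarrow> sign_flip u \<in> L2"
  unfolding sign_flip_def
  by (rule L2_mult_bounded[where C = 1]) (auto simp: sgn_if intro!: borel_measurable_leb_Rstar)

lemma sign_flip_sign_flip: "x \<in> Rstar \<Longrightarrow> sign_flip (sign_flip u) x = u x"
  by (auto simp: sign_flip_def sgn_if Rstar_def)

lemma L2_cong_ae:
  assumes "u \<in> L2" "v \<in> borel_measurable leb_Rstar" "eq_ae u v"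
  shows "v \<in> L2"
proof -
  have "integrable leb_Rstar (\<lambda>x. (cmod (v x))\<^sup>2)"
    by (rule integrable_cong_AE_imp[OF L2_integrable[OF assms(1)]])
      (use assms in \<open>auto simp: eq_ae_def\<close>)
  with assms(2) show ?thesis by (simp add: L2_def)
qed

lemma L2_mult_integrable:
  assumes "u \<in> L2" "v \<in> L2" shows "integrable leb_Rstar (\<lambda>x. u x * v x)"
proof (rule Bochner_Integration.integrable_bound)
  show "integrable leb_Rstar (\<lambda>x. (cmod (u x))\<^sup>2 + (cmod (v x))\<^sup>2)"
    using L2_integrable[OF assms(1)] L2_integrable[OF assms(2)] by auto
  have "cmod (u x) * cmod (v x) \<le> (cmod (u x))\<^sup>2 + (cmod (v x))\<^sup>2" for x
    using sum_squares_bound[of "cmod (u x)" "cmod (v x)"] mult_nonneg_nonneg[OF norm_ge_zero norm_ge_zero, of "u x" "v x"]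
    by linarith
  then show "AE x in leb_Rstar. norm (u x * v x) \<le> norm ((cmod (u x))\<^sup>2 + (cmod (v x))\<^sup>2)"
    by (auto simp: norm_mult)
qed (use L2_measurable[OF assms(1)] L2_measurable[OF assms(2)] in auto)

lemma L2_norm_nonneg: "0 \<le> L2_norm u"
  by (simp add: L2_norm_def)

lemma L2_norm_power2: "(L2_norm u)\<^sup>2 = (LINT x|leb_Rstar. (cmod (u x))\<^sup>2)"
  unfolding L2_norm_def by (intro real_sqrt_pow2) auto

lemma pairing_commute: "pairing u v = pairing v u"
  by (simp add: pairing_def mult.commute)

lemma pairing_add:
  "u \<in> L2 \<Longrightarrow> v \<in> L2 \<Longrightarrow> w \<in> L2 \<Longrightarrow> pairing u (\<lambda>x. v x + w x) = pairing u v + pairing u w"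
  unfolding pairing_def
  by (subst Bochner_Integration.integral_add[symmetric]) (auto intro: L2_mult_integrable simp: algebra_simps)

lemma pairing_diff:
  "u \<in> L2 \<Longrightarrow> v \<in> L2 \<Longrightarrow> w \<in> L2 \<Longrightarrow> pairing u (\<lambda>x. v x - w x) = pairing u v - pairing u w"
  unfolding pairing_def
  by (subst Bochner_Integration.integral_diff[symmetric]) (auto intro: L2_mult_integrable simp: algebra_simps)

lemma pairing_scale: "pairing u (\<lambda>x. c * v x) = c * pairing u v"
  unfolding pairing_def by (simp add: mult.left_commute)

lemma pairing_sum:
  assumes "u \<in> L2" "finite I" "\<And>i. i \<in> I \<Longrightarrow> v i \<in> L2"
  shows "pairing u (\<lambda>x. \<Sum>i\<in>I. v i x) = (\<Sum>i\<in>I. pairing u (v i))"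
  using assms(2,3)
proof (induction I rule: finite_induct)
  case empty
  then show ?case by (simp add: pairing_def)
next
  case (insert i I)
  then show ?case using assms(1) by (simp add: pairing_add L2_sum)
qed

lemma pairing_cong:
  assumes "\<And>x. x \<in> Rstar \<Longrightarrow> u x = u' x" "\<And>x. x \<in> Rstar \<Longrightarrow> v x = v' x"
  shows "pairing u v = pairing u' v'"
  unfolding pairing_def using assms by (intro Bochner_Integration.integral_cong) auto

lemma pairing_cong_ae:
  assumes "u \<in> L2" "v \<in> L2" "u' \<in> L2" "v' \<in> L2" "eq_ae u u'" "eq_ae v v'"
  shows "pairing u v = pairing u' v'"
  unfolding pairing_def
proof (rule integral_cong_AE)
  show "AE x in leb_Rstar. u x * v x = u' x * v' x"
    using assms(5,6) unfolding eq_ae_def by eventually_elim simp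
qed (use assms L2_measurable in auto)

lemma pairing_sign_flip: "pairing (sign_flip u) v = pairing u (sign_flip v)"
  unfolding pairing_def sign_flip_def by (simp add: mult_ac)

lemma eq_ae_I: "(\<And>x. x \<in> Rstar \<Longrightarrow> u x = v x) \<Longrightarrow> eq_ae u v"
  by (auto simp: eq_ae_def intro: AE_I2)

lemma eq_ae_sym: "eq_ae u v \<Longrightarrow> eq_ae v u"
  by (auto simp: eq_ae_def)

text \<open>Testing against the complex conjugate gives the square of the norm.\<close>
lemma eq_ae_zero_if_pairing_zero:
  assumes "u \<in> L2" "\<And>v. v \<in> L2 \<Longrightarrow> pairing u v = 0"
  shows "eq_ae u (\<lambda>x. 0)"
proof -
  have "complex_of_real (LINT x|leb_Rstar. (cmod (u x))\<^sup>2) = pairing u (\<lambda>x. cnj (u x))"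
    unfolding pairing_def by (subst integral_complex_of_real[symmetric]) (simp add: complex_norm_square del: of_real_power)
  also have "\<dots> = 0" using assms L2_cnj by blast
  finally have "(LINT x|leb_Rstar. (cmod (u x))\<^sup>2) = 0" by simp
  then have "AE x in leb_Rstar. (cmod (u x))\<^sup>2 = 0"
    using integral_nonneg_eq_0_iff_AE[OF L2_integrable[OF assms(1)]] by auto
  then show ?thesis by (auto simp: eq_ae_def)
qed

text \<open>The Cauchy-Schwarz inequality.\<close>
lemma pairing_bounded:
  assumes "u \<in> L2" "v \<in> L2"
  shows "cmod (pairing u v) \<le> L2_norm u * L2_norm v"
proof -
  define I where "I = (LINT x|leb_Rstar. cmod (u x * v x))"
  note [measurable] = L2_measurable[OF assms(1)] L2_measurable[OF assms(2)]
  have I0: "0 \<le> I" unfolding I_def by simp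
  have norm2: "(\<integral>\<^sup>+x. (ennreal (cmod (w x)))\<^sup>2 \<partial>leb_Rstar) = ennreal ((L2_norm w)\<^sup>2)" if "w \<in> L2" for w
    unfolding L2_norm_power2 by (subst nn_integral_eq_integral[OF L2_integrable[OF that], symmetric])
      (auto simp: ennreal_power)
  have "ennreal I = (\<integral>\<^sup>+x. ennreal (cmod (u x)) * ennreal (cmod (v x)) \<partial>leb_Rstar)"
    unfolding I_def using integrable_norm[OF L2_mult_integrable[OF assms]]
    by (subst nn_integral_eq_integral[symmetric]) (auto simp: norm_mult ennreal_mult)
  then have "(ennreal I)\<^sup>2 \<le> ennreal ((L2_norm u)\<^sup>2) * ennreal ((L2_norm v)\<^sup>2)"
    using Cauchy_Schwarz_nn_integral[of "\<lambda>x. ennreal (cmod (u x))" leb_Rstar "\<lambda>x. ennreal (cmod (v x))"]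
    by (simp add: norm2[OF assms(1)] norm2[OF assms(2)])
  then have "I\<^sup>2 \<le> (L2_norm u * L2_norm v)\<^sup>2"
    using I0 by (simp add: ennreal_power ennreal_mult[symmetric] power_mult_distrib)
  then have "I \<le> L2_norm u * L2_norm v"
    by (rule power2_le_imp_le) (simp add: L2_norm_nonneg)
  moreover have "cmod (pairing u v) \<le> I" unfolding pairing_def I_def by (rule integral_norm_bound)
  ultimately show ?thesis by (rule order_trans[rotated])
qed

section \<open>Bounded operators\<close>

lemma eq_ae_norm: "eq_ae u v \<Longrightarrow> u \<in> borel_measurable leb_Rstar \<Longrightarrow> v \<in> borel_measurable leb_Rstar \<Longrightarrow> L2_norm u = L2_norm v"
  unfolding L2_norm_def eq_ae_def
  by (intro arg_cong[where f = sqrt] integral_cong_AE) auto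

lemma bounded_oper_L2: "bounded_oper T \<Longrightarrow> f \<in> L2 \<Longrightarrow> T f \<in> L2"
  by (simp add: bounded_oper_def)

lemma bounded_oper_linear:
  "bounded_oper T \<Longrightarrow> f \<in> L2 \<Longrightarrow> g \<in> L2 \<Longrightarrow> eq_ae (T (\<lambda>x. c * f x + g x)) (\<lambda>x. c * T f x + T g x)"
  by (simp add: bounded_oper_def)

text \<open>Linearity with the coefficient 1 at the zero function shows that zero is mapped to zero.\<close>
lemma bounded_oper_scale:
  assumes "bounded_oper T" "f \<in> L2" shows "eq_ae (T (\<lambda>x. c * f x)) (\<lambda>x. c * T f x)"
proof -
  have "eq_ae (T (\<lambda>x. 1 * (0::complex) + 0)) (\<lambda>x. 1 * T (\<lambda>x. 0) x + T (\<lambda>x. 0) x)"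
    using bounded_oper_linear[OF assms(1) L2_zero L2_zero] by blast
  then have "eq_ae (T (\<lambda>x. 0)) (\<lambda>x. 0)"
    by (auto simp: eq_ae_def)
  moreover have "eq_ae (T (\<lambda>x. c * f x + 0)) (\<lambda>x. c * T f x + T (\<lambda>x. 0) x)"
    using bounded_oper_linear[OF assms(1,2) L2_zero] by blast
  ultimately show ?thesis
    unfolding eq_ae_def by eventually_elim simp
qed

lemma L2_norm_diff_le:
  assumes "u \<in> L2" "v \<in> L2"
  shows "L2_norm (\<lambda>x. u x - v x) \<le> 2 * L2_norm u + 2 * L2_norm v"
proof -
  have "(L2_norm (\<lambda>x. u x - v x))\<^sup>2 \<le> (LINT x|leb_Rstar. 2 * (cmod (u x))\<^sup>2 + 2 * (cmod (v x))\<^sup>2)"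
    unfolding L2_norm_power2
  proof (rule integral_mono)
    show "integrable leb_Rstar (\<lambda>x. (cmod (u x - v x))\<^sup>2)"
      using L2_integrable[OF L2_diff[OF assms]] .
    show "integrable leb_Rstar (\<lambda>x. 2 * (cmod (u x))\<^sup>2 + 2 * (cmod (v x))\<^sup>2)"
      using L2_integrable[OF assms(1)] L2_integrable[OF assms(2)] by auto
    show "(cmod (u x - v x))\<^sup>2 \<le> 2 * (cmod (u x))\<^sup>2 + 2 * (cmod (v x))\<^sup>2" for x
      using cmod_add_power2_le[of "u x" "- v x"] by simp
  qed
  also have "\<dots> = 2 * (L2_norm u)\<^sup>2 + 2 * (L2_norm v)\<^sup>2"
    unfolding L2_norm_power2 using L2_integrable[OF assms(1)] L2_integrable[OF assms(2)] by simp
  also have "\<dots> \<le> (2 * L2_norm u + 2 * L2_norm v)\<^sup>2"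
    using L2_norm_nonneg[of u] L2_norm_nonneg[of v] by (simp add: power2_eq_square algebra_simps)
  finally show ?thesis
    using L2_norm_nonneg[of u] L2_norm_nonneg[of v] by (elim power2_le_imp_le) auto
qed

lemma L2_norm_mult_bounded:
  assumes "u \<in> L2" "g \<in> borel_measurable leb_Rstar" "\<And>x. x \<in> Rstar \<Longrightarrow> cmod (g x) \<le> C" "0 \<le> C"
  shows "L2_norm (\<lambda>x. g x * u x) \<le> C * L2_norm u"
proof -
  have "(L2_norm (\<lambda>x. g x * u x))\<^sup>2 \<le> (LINT x|leb_Rstar. C\<^sup>2 * (cmod (u x))\<^sup>2)"
    unfolding L2_norm_power2
  proof (rule integral_mono)
    show "integrable leb_Rstar (\<lambda>x. (cmod (g x * u x))\<^sup>2)"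
      using L2_integrable[OF L2_mult_bounded[OF assms(1-3)]] .
    show "integrable leb_Rstar (\<lambda>x. C\<^sup>2 * (cmod (u x))\<^sup>2)"
      using L2_integrable[OF assms(1)] by auto
    show "(cmod (g x * u x))\<^sup>2 \<le> C\<^sup>2 * (cmod (u x))\<^sup>2" if "x \<in> space leb_Rstar" for x
      using assms(3)[of x] that by (auto simp: norm_mult power_mult_distrib intro!: mult_right_mono power_mono)
  qed
  also have "\<dots> = (C * L2_norm u)\<^sup>2"
    by (simp add: power_mult_distrib L2_norm_power2)
  finally show ?thesis
    using L2_norm_nonneg[of u] assms(4) by (elim power2_le_imp_le) auto
qed

lemma L2_norm_scale: "L2_norm (\<lambda>x. c * u x) = cmod c * L2_norm u"
  unfolding L2_norm_def by (simp add: norm_mult power_mult_distrib real_sqrt_mult)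

lemma bounded_oper_diff:
  assumes "bounded_oper T" "bounded_oper U"
  shows "bounded_oper (\<lambda>f x. T f x - U f x)"
proof -
  obtain C where C: "\<forall>f\<in>L2. L2_norm (T f) \<le> C * L2_norm f"
    using assms(1) by (auto simp: bounded_oper_def)
  obtain D where D: "\<forall>f\<in>L2. L2_norm (U f) \<le> D * L2_norm f"
    using assms(2) by (auto simp: bounded_oper_def)
  have "L2_norm (\<lambda>x. T f x - U f x) \<le> (2 * C + 2 * D) * L2_norm f" if "f \<in> L2" for f
  proof -
    have "L2_norm (\<lambda>x. T f x - U f x) \<le> 2 * L2_norm (T f) + 2 * L2_norm (U f)"
      using L2_norm_diff_le[OF bounded_oper_L2[OF assms(1) that] bounded_oper_L2[OF assms(2) that]] .
    also have "\<dots> \<le> 2 * (C * L2_norm f) + 2 * (D * L2_norm f)"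
      using C D that by (intro add_mono mult_left_mono) auto
    finally show ?thesis by (simp add: algebra_simps)
  qed
  moreover have "eq_ae (\<lambda>x. T (\<lambda>x. c * f x + g x) x - U (\<lambda>x. c * f x + g x) x)
          (\<lambda>x. c * (T f x - U f x) + (T g x - U g x))" if "f \<in> L2" "g \<in> L2" for f g c
    using bounded_oper_linear[OF assms(1) that, of c] bounded_oper_linear[OF assms(2) that, of c]
    unfolding eq_ae_def by eventually_elim (simp add: algebra_simps)
  ultimately show ?thesis
    unfolding bounded_oper_def
    using L2_diff[OF bounded_oper_L2[OF assms(1)] bounded_oper_L2[OF assms(2)]] by blast
qed

lemma bounded_oper_id: "bounded_oper (\<lambda>f. f)"
  unfolding bounded_oper_def by (auto intro!: eq_ae_I exI[of _ 1])

lemma bounded_oper_rank_one: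
  assumes "e \<in> L2" "k \<in> L2"
  shows "bounded_oper (\<lambda>f x. e x * pairing k f)"
proof -
  have "L2_norm (\<lambda>x. e x * pairing k f) \<le> (L2_norm e * L2_norm k) * L2_norm f" if "f \<in> L2" for f
  proof -
    have "L2_norm (\<lambda>x. e x * pairing k f) = cmod (pairing k f) * L2_norm e"
      using L2_norm_scale[of "pairing k f" e] by (simp add: mult.commute)
    also have "\<dots> \<le> (L2_norm k * L2_norm f) * L2_norm e"
      by (intro mult_right_mono pairing_bounded assms that L2_norm_nonneg)
    finally show ?thesis by (simp add: mult_ac)
  qed
  moreover have "(\<lambda>x. e x * pairing k f) \<in> L2" for f
    using L2_scale[OF assms(1), of "pairing k f"] by (simp add: mult.commute)
  moreover have lin: "pairing k (\<lambda>x. c * f x + g x) = c * pairing k f + pairing k g" if "f \<in> L2" "g \<in> L2" for f g c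
    using pairing_add[OF assms(2) L2_scale[OF that(1)] that(2)] by (simp add: pairing_scale)
  moreover have "eq_ae (\<lambda>x. e x * pairing k (\<lambda>x. c * f x + g x)) (\<lambda>x. c * (e x * pairing k f) + e x * pairing k g)"
    if "f \<in> L2" "g \<in> L2" for f g c
    by (rule eq_ae_I) (unfold lin[OF that], simp add: algebra_simps)
  ultimately show ?thesis
    unfolding bounded_oper_def by blast
qed

text \<open>Perturbations of finite rank occur because a Schur complement removes finitely many rows.\<close>
lemma bounded_oper_diff_sum:
  assumes "bounded_oper T" "finite I" "\<And>i. i \<in> I \<Longrightarrow> e i \<in> L2" "\<And>i. i \<in> I \<Longrightarrow> k i \<in> L2"
  shows "bounded_oper (\<lambda>f x. T f x - (\<Sum>i\<in>I. e i x * pairing (k i) f))"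
  using assms(2-4)
proof (induction I rule: finite_induct)
  case empty
  then show ?case using assms(1) by simp
next
  case (insert i I)
  then have "bounded_oper (\<lambda>f x. T f x - (\<Sum>i\<in>I. e i x * pairing (k i) f) - e i x * pairing (k i) f)"
    by (intro bounded_oper_diff[where U = "\<lambda>f x. e i x * pairing (k i) f"] bounded_oper_rank_one) auto
  then show ?case using insert.hyps by (simp add: algebra_simps)
qed

lemma bounded_oper_cong:
  assumes "bounded_oper T" "\<And>f x. f \<in> L2 \<Longrightarrow> x \<in> Rstar \<Longrightarrow> T f x = U f x"
    "\<And>f. f \<in> L2 \<Longrightarrow> U f \<in> borel_measurable leb_Rstar"
  shows "bounded_oper U"
proof -
  have ae: "eq_ae (T f) (U f)" if "f \<in> L2" for f
    using assms(2)[OF that] by (rule eq_ae_I)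
  have L2: "U f \<in> L2" if "f \<in> L2" for f
    by (rule L2_cong_ae[OF bounded_oper_L2[OF assms(1) that] assms(3)[OF that] ae[OF that]])
  obtain C where C: "\<forall>f\<in>L2. L2_norm (T f) \<le> C * L2_norm f"
    using assms(1) by (auto simp: bounded_oper_def)
  have norm: "L2_norm (U f) = L2_norm (T f)" if "f \<in> L2" for f
    by (rule eq_ae_norm[OF eq_ae_sym[OF ae[OF that]] assms(3)[OF that] L2_measurable[OF bounded_oper_L2[OF assms(1) that]]])
  have "eq_ae (U (\<lambda>x. c * f x + g x)) (\<lambda>x. c * U f x + U g x)" if "f \<in> L2" "g \<in> L2" for f g c
    using bounded_oper_linear[OF assms(1) that, of c] ae[OF that(1)] ae[OF that(2)] ae[OF L2_add[OF L2_scale[OF that(1), of c] that(2)]]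
    unfolding eq_ae_def by eventually_elim simp
  with L2 C norm show ?thesis unfolding bounded_oper_def by metis
qed

lemma bounded_oper_mult_conj:
  assumes T: "bounded_oper T" and h: "h \<in> borel_measurable leb_Rstar"
    and C: "\<And>x. x \<in> Rstar \<Longrightarrow> \<bar>h x\<bar> \<le> C"
  shows "bounded_oper (\<lambda>g. mult_oper h (T (mult_oper h g)))"
proof -
  define M where "M = max C 0"
  have M: "cmod (complex_of_real (h x)) \<le> M" if "x \<in> Rstar" for x
    using C[OF that] by (auto simp: M_def)
  have M0: "0 \<le> M" by (simp add: M_def)
  have hm: "(\<lambda>x. complex_of_real (h x)) \<in> borel_measurable leb_Rstar" using h by simp
  have mL2: "mult_oper h f \<in> L2" if "f \<in> L2" for f
    unfolding mult_oper_def by (rule L2_mult_bounded[OF that hm M])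
  have mn: "L2_norm (mult_oper h f) \<le> M * L2_norm f" if "f \<in> L2" for f
    unfolding mult_oper_def by (rule L2_norm_mult_bounded[OF that hm M M0])
  obtain D where D: "\<forall>f\<in>L2. L2_norm (T f) \<le> D * L2_norm f"
    using T by (auto simp: bounded_oper_def)
  have "L2_norm (mult_oper h (T (mult_oper h f))) \<le> (M * (max D 0 * M)) * L2_norm f" if "f \<in> L2" for f
  proof -
    have "L2_norm (mult_oper h (T (mult_oper h f))) \<le> M * L2_norm (T (mult_oper h f))"
      by (rule mn[OF bounded_oper_L2[OF T mL2[OF that]]])
    also have "\<dots> \<le> M * (D * L2_norm (mult_oper h f))"
      using D mL2[OF that] M0 by (intro mult_left_mono) auto
    also have "\<dots> \<le> M * (max D 0 * L2_norm (mult_oper h f))"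
      using M0 L2_norm_nonneg by (intro mult_left_mono mult_right_mono) auto
    also have "\<dots> \<le> M * (max D 0 * (M * L2_norm f))"
      using M0 mn[OF that] by (intro mult_left_mono) auto
    finally show ?thesis by (simp add: mult_ac)
  qed
  moreover have "eq_ae (mult_oper h (T (mult_oper h (\<lambda>x. c * f x + g x))))
      (\<lambda>x. c * mult_oper h (T (mult_oper h f)) x + mult_oper h (T (mult_oper h g)) x)"
    if "f \<in> L2" "g \<in> L2" for f g c
  proof -
    have "mult_oper h (\<lambda>x. c * f x + g x) = (\<lambda>x. c * mult_oper h f x + mult_oper h g x)"
      by (auto simp: mult_oper_def algebra_simps)
    then have "eq_ae (T (mult_oper h (\<lambda>x. c * f x + g x))) (\<lambda>x. c * T (mult_oper h f) x + T (mult_oper h g) x)"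
      using bounded_oper_linear[OF T mL2[OF that(1)] mL2[OF that(2)]] by simp
    then show ?thesis unfolding eq_ae_def
      by eventually_elim (simp add: mult_oper_def algebra_simps)
  qed
  ultimately show ?thesis
    unfolding bounded_oper_def using mL2[OF bounded_oper_L2[OF T mL2]] by blast
qed

section \<open>The kernel L\<close>

lemma integral_oper_pairing: "integral_oper k f x = pairing (k x) f"
  by (simp add: integral_oper_def pairing_def)

lemma L_kernel_antisym: "L_kernel A x y = - L_kernel A y x"
proof -
  have "(A_plus A x * A_minus A y + A_minus A x * A_plus A y) / (x - y) =
      - ((A_plus A y * A_minus A x + A_minus A y * A_plus A x) / (y - x))"
    by (subst minus_diff_eq[of x y, symmetric], subst minus_divide_right[symmetric]) (simp add: mult.commute add.commute)
  then show ?thesis unfolding L_kernel_def by (simp only: of_real_minus)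
qed

definition real_kernel :: "(real \<Rightarrow> real) \<Rightarrow> real \<Rightarrow> real \<Rightarrow> real" where
  "real_kernel A x y = (A_plus A x * A_minus A y + A_minus A x * A_plus A y) / (x - y)"

lemma real_kernel_same_sign: "0 \<le> x * y \<Longrightarrow> real_kernel A x y = 0"
  by (auto simp: real_kernel_def A_plus_def A_minus_def indicator_def zero_le_mult_iff)

lemma real_kernel_opposite_sign: "x * y < 0 \<Longrightarrow> real_kernel A x y = A x * A y / (x - y)"
  by (auto simp: real_kernel_def A_plus_def A_minus_def mult_less_0_iff)

lemma L_kernel_real_kernel: "L_kernel A x y = complex_of_real (real_kernel A x y)"
  by (simp add: L_kernel_def real_kernel_def)

lemma cnj_L_kernel: "cnj (L_kernel A x y) = L_kernel A x y"
  by (simp add: L_kernel_def)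

text \<open>The kernel vanishes unless its arguments lie on different half-lines.\<close>
lemma sgn_L_kernel:
  assumes "x \<in> Rstar" "y \<in> Rstar"
  shows "complex_of_real (sgn y) * L_kernel A x y = - (complex_of_real (sgn x) * L_kernel A x y)"
proof (cases "x * y < 0")
  case True
  then have "sgn y = - sgn x" by (auto simp: mult_less_0_iff)
  then show ?thesis by simp
qed (simp add: L_kernel_real_kernel real_kernel_same_sign)

lemma integral_oper_L_kernel_sign_flip:
  assumes "x \<in> Rstar"
  shows "integral_oper (L_kernel A) (sign_flip u) x = - sign_flip (integral_oper (L_kernel A) u) x"
proof -
  have "pairing (L_kernel A x) (sign_flip u) = (LINT y|leb_Rstar. (- complex_of_real (sgn x)) * (L_kernel A x y * u y))"
    unfolding pairing_def sign_flip_def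
  proof (rule Bochner_Integration.integral_cong[OF refl])
    fix y assume "y \<in> space leb_Rstar"
    then have "complex_of_real (sgn y) * L_kernel A x y = - (complex_of_real (sgn x) * L_kernel A x y)"
      using sgn_L_kernel[OF assms] by simp
    then have "(complex_of_real (sgn y) * L_kernel A x y) * u y = - (complex_of_real (sgn x) * L_kernel A x y) * u y"
      by simp
    then show "L_kernel A x y * (complex_of_real (sgn y) * u y) = (- complex_of_real (sgn x)) * (L_kernel A x y * u y)"
      by (simp add: mult_ac)
  qed
  also have "\<dots> = (- complex_of_real (sgn x)) * (LINT y|leb_Rstar. L_kernel A x y * u y)"
    by (rule integral_mult_right_zero)
  finally show ?thesis
    by (simp add: integral_oper_pairing sign_flip_def pairing_def)
qed

lemma cmod_L_kernel_le:
  assumes "x \<in> Rstar"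
  shows "cmod (L_kernel A x y) \<le> \<bar>A x\<bar> / \<bar>x\<bar> * \<bar>A y\<bar>"
proof (cases "x * y < 0")
  case True
  then have "\<bar>x\<bar> \<le> \<bar>x - y\<bar>" "\<bar>x\<bar> > 0" by (auto simp: mult_less_0_iff)
  then have "\<bar>A x\<bar> * \<bar>A y\<bar> / \<bar>x - y\<bar> \<le> \<bar>A x\<bar> * \<bar>A y\<bar> / \<bar>x\<bar>"
    by (intro divide_left_mono mult_pos_pos) auto
  then show ?thesis
    unfolding L_kernel_real_kernel real_kernel_opposite_sign[OF True] norm_of_real by (simp add: abs_mult)
qed (simp add: L_kernel_real_kernel real_kernel_same_sign)

text \<open>
  On the punctured line the denominator of the kernel may be replaced by one which has no zeros, which
  is why the kernel is continuous across the diagonal.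
\<close>
lemma continuous_on_L_kernel:
  assumes A: "continuous_on Rstar A"
  shows "continuous_on (Rstar \<times> Rstar) (\<lambda>(x, y). L_kernel A x y)"
proof -
  \<comment> \<open>off the origin the indicators of the half-lines are \<open>(1 + sgn x) / 2\<close> and \<open>(1 - sgn x) / 2\<close>\<close>
  have ind: "continuous_on Rstar (\<lambda>x. indicator {0<..} x :: real)" "continuous_on Rstar (\<lambda>x. indicator {..<0} x :: real)"
  proof -
    have "continuous_on Rstar (\<lambda>x. (1 + sgn x) / 2 :: real)" "continuous_on Rstar (\<lambda>x. (1 - sgn x) / 2 :: real)"
      by (auto intro!: continuous_intros simp: Rstar_def)
    then show "continuous_on Rstar (\<lambda>x. indicator {0<..} x :: real)" "continuous_on Rstar (\<lambda>x. indicator {..<0} x :: real)"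
      by - (elim continuous_on_eq, auto simp: Rstar_def indicator_def sgn_if)+
  qed
  have p: "continuous_on Rstar (A_plus A)" "continuous_on Rstar (A_minus A)"
    unfolding A_plus_def[abs_def] A_minus_def[abs_def] by (intro continuous_intros A ind)+
  have s: "continuous_on Rstar (\<lambda>x. sgn x :: real)"
    by (auto intro!: continuous_intros simp: Rstar_def)
  \<comment> \<open>where the numerator is nonzero, \<open>x - y = sgn x * (\<bar>x\<bar> + \<bar>y\<bar>)\<close>\<close>
  define g where "g = (\<lambda>z. complex_of_real (sgn (fst z) * (A_plus A (fst z) * A_minus A (snd z) + A_minus A (fst z) * A_plus A (snd z)) / (\<bar>fst z\<bar> + \<bar>snd z\<bar>)))"
  have "continuous_on (Rstar \<times> Rstar) g"
    unfolding g_def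
    by (intro continuous_intros continuous_on_compose2[OF p(1)] continuous_on_compose2[OF p(2)]
         continuous_on_compose2[OF s]) (auto simp: Rstar_def)
  moreover have "g z = (\<lambda>(x, y). L_kernel A x y) z" if zR: "z \<in> Rstar \<times> Rstar" for z
  proof -
    obtain x y where z: "z = (x, y)" "x \<noteq> 0" "y \<noteq> 0" using zR by (auto simp: Rstar_def)
    consider "x > 0" "y > 0" | "x > 0" "y < 0" | "x < 0" "y > 0" | "x < 0" "y < 0"
      using z by linarith
    then show ?thesis
      by cases (auto simp: g_def z(1) L_kernel_def A_plus_def A_minus_def, metis add.commute minus_diff_eq minus_divide_right uminus_add_conv_diff)
  qed
  ultimately show ?thesis by (rule continuous_on_eq)
qed

lemma L_kernel_row_continuous:
  assumes "continuous_on Rstar A" "x \<in> Rstar"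
  shows "continuous_on Rstar (L_kernel A x)"
  using continuous_on_compose2[OF continuous_on_L_kernel[OF assms(1)], of Rstar "\<lambda>y. (x, y)"] assms(2)
  by (simp add: image_subset_iff continuous_on_Pair[OF continuous_on_const continuous_on_id])

lemma L_kernel_column_continuous:
  assumes "continuous_on Rstar A" "y \<in> Rstar"
  shows "continuous_on Rstar (\<lambda>x. L_kernel A x y)"
  using continuous_on_compose2[OF continuous_on_L_kernel[OF assms(1)], of Rstar "\<lambda>x. (x, y)"] assms(2)
  by (simp add: image_subset_iff continuous_on_Pair[OF continuous_on_id continuous_on_const])

lemma L_kernel_row_L2:
  assumes "(\<lambda>x. complex_of_real (A x)) \<in> L2" "x \<in> Rstar"
  shows "L_kernel A x \<in> L2"
proof -
  have [measurable]: "A \<in> borel_measurable leb_Rstar"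
    using measurable_compose[OF L2_measurable[OF assms(1)] borel_measurable_Re] by simp
  have [measurable]: "(\<lambda>x. x) \<in> borel_measurable leb_Rstar"
    "(\<lambda>x. indicator {0<..} x :: real) \<in> borel_measurable leb_Rstar" "(\<lambda>x. indicator {..<0} x :: real) \<in> borel_measurable leb_Rstar"
    by (auto intro!: borel_measurable_leb_Rstar)
  show ?thesis
  proof (rule L2_I_dominated[where g = "\<lambda>y. (\<bar>A x\<bar> / \<bar>x\<bar>)\<^sup>2 * (cmod (complex_of_real (A y)))\<^sup>2"])
    show "L_kernel A x \<in> borel_measurable leb_Rstar"
      unfolding L_kernel_def[abs_def] A_plus_def A_minus_def by measurable
    show "(cmod (L_kernel A x y))\<^sup>2 \<le> (\<bar>A x\<bar> / \<bar>x\<bar>)\<^sup>2 * (cmod (complex_of_real (A y)))\<^sup>2" for y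
      using power_mono[OF cmod_L_kernel_le[OF assms(2), of A y], of 2] by (simp add: power_mult_distrib power_divide)
  qed (use L2_integrable[OF assms(1)] in auto)
qed

text \<open>
  Since \<open>\<bar>x - y\<bar> \<ge> \<bar>x\<bar>\<close> where the kernel does not vanish, \<open>A\<close> times the function dominates locally
  uniformly in \<open>x\<close>. An equation between images under \<open>L\<close> which holds almost everywhere thus holds
  at every point, in particular at the points of conditioning.
\<close>
lemma continuous_on_integral_oper_L_kernel:
  assumes A: "continuous_on Rstar A" "(\<lambda>x. complex_of_real (A x)) \<in> L2" and u: "u \<in> L2"
  shows "continuous_on Rstar (integral_oper (L_kernel A) u)"
proof (rule continuous_on_sequentiallyI)
  fix X a assume X: "\<forall>n. X n \<in> Rstar" "a \<in> Rstar" "X \<longlonglongrightarrow> a"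
  have "continuous_on Rstar (\<lambda>x. \<bar>A x\<bar> / \<bar>x\<bar>)"
    by (intro continuous_intros A) (auto simp: Rstar_def)
  then have "(\<lambda>n. \<bar>A (X n)\<bar> / \<bar>X n\<bar>) \<longlonglongrightarrow> \<bar>A a\<bar> / \<bar>a\<bar>"
    by (rule continuous_on_tendsto_compose) (use X in auto)
  then obtain C where C: "norm (\<bar>A (X n)\<bar> / \<bar>X n\<bar>) \<le> C" for n
    using convergentI[THEN convergent_imp_Bseq, THEN BseqE] by blast
  show "(\<lambda>n. integral_oper (L_kernel A) u (X n)) \<longlonglongrightarrow> integral_oper (L_kernel A) u a"
    unfolding integral_oper_pairing pairing_def
  proof (rule integral_dominated_convergence)
    show "(\<lambda>y. L_kernel A a y * u y) \<in> borel_measurable leb_Rstar"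
      using L2_measurable[OF L_kernel_row_L2[OF A(2) X(2)]] L2_measurable[OF u] by auto
    show "(\<lambda>y. L_kernel A (X n) y * u y) \<in> borel_measurable leb_Rstar" for n
      using L2_measurable[OF L_kernel_row_L2[OF A(2)]] X(1) L2_measurable[OF u] by auto
    show "integrable leb_Rstar (\<lambda>y. C * cmod (complex_of_real (A y) * u y))"
      using L2_mult_integrable[OF A(2) u] by auto
    show "AE y in leb_Rstar. (\<lambda>n. L_kernel A (X n) y * u y) \<longlonglongrightarrow> L_kernel A a y * u y"
    proof (rule AE_I2)
      fix y assume "y \<in> space leb_Rstar"
      then have "continuous_on Rstar (\<lambda>x. L_kernel A x y)"
        using L_kernel_column_continuous[OF A(1)] by simp
      then have "(\<lambda>n. L_kernel A (X n) y) \<longlonglongrightarrow> L_kernel A a y"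
        by (rule continuous_on_tendsto_compose) (use X in auto)
      then show "(\<lambda>n. L_kernel A (X n) y * u y) \<longlonglongrightarrow> L_kernel A a y * u y"
        by (intro tendsto_intros)
    qed
    show "AE y in leb_Rstar. norm (L_kernel A (X n) y * u y) \<le> C * cmod (complex_of_real (A y) * u y)" for n
    proof (rule AE_I2)
      fix y
      have "cmod (L_kernel A (X n) y) \<le> \<bar>A (X n)\<bar> / \<bar>X n\<bar> * \<bar>A y\<bar>"
        using X(1) by (intro cmod_L_kernel_le) auto
      also have "\<dots> \<le> C * \<bar>A y\<bar>" using C[of n] by (intro mult_right_mono) auto
      finally have "cmod (L_kernel A (X n) y) * cmod (u y) \<le> C * \<bar>A y\<bar> * cmod (u y)"
        by (intro mult_right_mono) auto
      then show "norm (L_kernel A (X n) y * u y) \<le> C * cmod (complex_of_real (A y) * u y)"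
        by (simp add: norm_mult mult_ac)
    qed
  qed
qed

lemma integral_oper_cong_ae:
  assumes "u \<in> L2" "v \<in> L2" "eq_ae u v" "k x \<in> L2"
  shows "integral_oper k u x = integral_oper k v x"
  unfolding integral_oper_pairing
  by (rule pairing_cong_ae) (use assms in \<open>auto intro: eq_ae_I\<close>)

lemma eq_ae_continuous_imp_eq:
  assumes "continuous_on Rstar u" "continuous_on Rstar v" "eq_ae u v" "x \<in> Rstar"
  shows "u x = v x"
proof (rule ccontr)
  assume neq: "u x \<noteq> v x"
  define U where "U = Rstar \<inter> (\<lambda>x. u x - v x) -` (- {0})"
  have "open Rstar" by (auto simp: Rstar_def)
  then have "open U"
    unfolding U_def using assms(1,2)
    by (intro continuous_open_preimage continuous_intros) auto
  moreover have "x \<in> U" using neq assms(4) by (auto simp: U_def)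
  moreover have "negligible U"
  proof -
    have "AE x in lborel. x \<in> Rstar \<longrightarrow> u x = v x"
      using assms(3) unfolding eq_ae_def leb_Rstar_def by (subst (asm) AE_restrict_space_iff) auto
    then have "AE x in lebesgue. x \<in> Rstar \<longrightarrow> u x = v x"
      by (rule AE_completion)
    then obtain N where N: "N \<in> null_sets lebesgue" "{x. \<not> (x \<in> Rstar \<longrightarrow> u x = v x)} \<subseteq> N"
      unfolding eventually_ae_filter by auto
    have "U \<subseteq> N" using N(2) by (auto simp: U_def)
    then show ?thesis using N(1) negligible_iff_null_sets negligible_subset by blast
  qed
  ultimately show False using open_not_negligible by blast
qed

text \<open>
  Two functions which are continuous on the punctured line and have the same integrals over all
  compact intervals with rational end points coincide: this reduces an equality of kernels to
  countably many test functions.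
\<close>
definition rational_intervals :: "real set set" where
  "rational_intervals = {{a..b} | a b. a \<in> \<rat> \<and> b \<in> \<rat> \<and> a < b \<and> {a..b} \<subseteq> Rstar}"

lemma countable_rational_intervals: "countable rational_intervals"
proof -
  have "rational_intervals \<subseteq> (\<lambda>(a, b). {a..b}) ` (\<rat> \<times> \<rat>)"
    by (auto simp: rational_intervals_def)
  then show ?thesis by (rule countable_subset) (auto intro!: countable_rat)
qed

lemma leb_Rstar_set_integral:
  assumes "a < b" "{a..b} \<subseteq> Rstar" "continuous_on Rstar u"
  shows "integrable leb_Rstar (\<lambda>x. u x * indicator {a..b} x :: complex)"
    and "(LINT x|leb_Rstar. u x * indicator {a..b} x) = (LINT x:{a..b}|lborel. u x)"
proof -
  have c: "continuous_on {a..b} u" using assms continuous_on_subset by blast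
  have i: "set_integrable lborel {a..b} u" by (rule borel_integrable_atLeastAtMost'[OF c])
  have eq: "indicator Rstar x *\<^sub>R (u x * indicator {a..b} x) = indicator {a..b} x *\<^sub>R u x" for x
    using assms(2) by (auto simp: indicator_def)
  show "integrable leb_Rstar (\<lambda>x. u x * indicator {a..b} x :: complex)"
    unfolding leb_Rstar_def using i
    by (subst integrable_restrict_space) (auto simp: set_integrable_def eq)
  show "(LINT x|leb_Rstar. u x * indicator {a..b} x) = (LINT x:{a..b}|lborel. u x)"
    unfolding leb_Rstar_def
    by (subst integral_restrict_space) (auto simp: set_lebesgue_integral_def eq)
qed

lemma indicator_L2:
  assumes "a < b" "{a..b} \<subseteq> Rstar"
  shows "(\<lambda>x. indicator {a..b} x :: complex) \<in> L2"
proof (rule L2_I_dominated[where g = "\<lambda>x. cmod (1 * indicator {a..b} x :: complex)"])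
  show "integrable leb_Rstar (\<lambda>x. cmod (1 * indicator {a..b} x))"
    by (rule integrable_norm[OF leb_Rstar_set_integral(1)]) (use assms in auto)
qed (auto simp: indicator_def intro!: borel_measurable_leb_Rstar)

lemma continuous_eq_if_rational_integrals_eq:
  fixes u v :: "real \<Rightarrow> complex"
  assumes c: "continuous_on Rstar u" "continuous_on Rstar v"
    and eq: "\<And>I. I \<in> rational_intervals \<Longrightarrow>
       (LINT x|leb_Rstar. u x * indicator I x) = (LINT x|leb_Rstar. v x * indicator I x)"
    and x: "x \<in> Rstar"
  shows "u x = v x"
proof (rule ccontr)
  assume neq: "u x \<noteq> v x"
  \<comment> \<open>rotate the difference so that its real part is positive near \<open>x\<close>\<close>
  define c where "c = cnj (u x - v x)"
  define g where "g = (\<lambda>y. Re (c * (u y - v y)))"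
  have gc: "continuous_on Rstar g" unfolding g_def by (intro continuous_intros c(1) assms(2))
  have "c * (u x - v x) = complex_of_real ((cmod (u x - v x))\<^sup>2)"
    unfolding c_def by (metis complex_norm_square mult.commute)
  then have gx: "g x > 0" unfolding g_def using neq by simp
  have "open Rstar" by (auto simp: Rstar_def)
  then have "open (Rstar \<inter> g -` {g x / 2<..})" using gc by (intro continuous_open_preimage) auto
  moreover have "x \<in> Rstar \<inter> g -` {g x / 2<..}" using x gx by auto
  ultimately obtain e where e: "e > 0" "ball x e \<subseteq> Rstar \<inter> g -` {g x / 2<..}"
    using open_contains_ball by metis
  obtain a where a: "a \<in> \<rat>" "x - e < a" "a < x" using Rats_dense_in_real[of "x - e" x] e by auto
  obtain b where b: "b \<in> \<rat>" "x < b" "b < x + e" using Rats_dense_in_real[of x "x + e"] e by auto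
  have ab: "{a..b} \<subseteq> ball x e" using a b by (auto simp: dist_real_def)
  have R: "{a..b} \<in> rational_intervals" "a < b" "{a..b} \<subseteq> Rstar"
    using a b ab e by (auto simp: rational_intervals_def)
  note iu = leb_Rstar_set_integral[OF R(2,3) c(1)]
  note iv = leb_Rstar_set_integral[OF R(2,3) assms(2)]
  have cu: "set_integrable lborel {a..b} u" "set_integrable lborel {a..b} v" "set_integrable lborel {a..b} g"
    by (intro borel_integrable_atLeastAtMost' continuous_on_subset[OF _ R(3)] c(1) assms(2) gc)+
  have "(LINT y:{a..b}|lborel. u y) = (LINT y:{a..b}|lborel. v y)"
    using eq[OF R(1)] iu(2) iv(2) by simp
  then have "(LINT y:{a..b}|lborel. c * (u y - v y)) = 0"
    using cu by (simp add: set_integral_diff)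
  moreover have "(LINT y:{a..b}|lborel. g y) = Re (LINT y:{a..b}|lborel. c * (u y - v y))"
  proof -
    have "set_integrable lborel {a..b} (\<lambda>y. c * (u y - v y))"
      by (intro borel_integrable_atLeastAtMost' continuous_intros continuous_on_subset[OF _ R(3)] c(1) assms(2))
    then have i: "integrable lborel (\<lambda>y. indicator {a..b} y *\<^sub>R (c * (u y - v y)))" by (simp add: set_integrable_def)
    show ?thesis unfolding set_lebesgue_integral_def integral_Re[OF i, symmetric]
      by (intro Bochner_Integration.integral_cong) (auto simp: g_def)
  qed
  ultimately have "(LINT y:{a..b}|lborel. g y) = 0" by (metis zero_complex.sel(1))
  moreover have "(LINT y:{a..b}|lborel. g x / 2) \<le> (LINT y:{a..b}|lborel. g y)"
  proof (rule set_integral_mono)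
    show "set_integrable lborel {a..b} (\<lambda>y. g x / 2)" by (intro borel_integrable_atLeastAtMost' continuous_on_const)
    show "g x / 2 \<le> g y" if "y \<in> {a..b}" for y using that ab e(2) by force
  qed (rule cu)
  moreover have "(LINT y:{a..b}|lborel. g x / 2) = (b - a) * (g x / 2)"
    using R(2) by (simp add: set_lebesgue_integral_def)
  ultimately show False using gx R(2) by (simp add: mult_le_0_iff)
qed

section \<open>The correlation kernel of an L-operator\<close>

locale L_operator =
  fixes A :: "real \<Rightarrow> real"
  assumes A_cont: "continuous_on Rstar A"
    and A_L2: "(\<lambda>x. complex_of_real (A x)) \<in> L2"
    and bounded: "bounded_oper (integral_oper (L_kernel A))"
    and block: "block_anti_self_adjoint (integral_oper (L_kernel A))"
begin

abbreviation "lk \<equiv> L_kernel A"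
abbreviation "L \<equiv> integral_oper (L_kernel A)"

lemma row_L2: "x \<in> Rstar \<Longrightarrow> lk x \<in> L2"
  by (rule L_kernel_row_L2[OF A_L2])

lemma L_L2: "u \<in> L2 \<Longrightarrow> L u \<in> L2"
  by (rule bounded_oper_L2[OF bounded])

lemma L_cont: "u \<in> L2 \<Longrightarrow> continuous_on Rstar (L u)"
  by (rule continuous_on_integral_oper_L_kernel[OF A_cont A_L2])

lemma row_cont: "x \<in> Rstar \<Longrightarrow> continuous_on Rstar (lk x)"
  by (rule L_kernel_row_continuous[OF A_cont])

lemma L_cnj: "L (\<lambda>y. cnj (u y)) x = cnj (L u x)"
  unfolding integral_oper_def by (subst Bochner_Integration.integral_cnj[symmetric]) (simp add: cnj_L_kernel)

text \<open>The kernel is real, so that anti-self-adjointness becomes skew symmetry of the bilinear pairing.\<close>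
lemma L_skew:
  assumes "u \<in> L2" "v \<in> L2"
  shows "pairing (L u) v = - pairing u (L v)"
proof -
  have "pairing (L u) v = L2_inner (L u) (\<lambda>y. cnj (v y))"
    by (simp add: pairing_def L2_inner_def)
  also have "\<dots> = - L2_inner u (L (\<lambda>y. cnj (v y)))"
    using block assms(1) L2_cnj[OF assms(2)] unfolding block_anti_self_adjoint_def by blast
  also have "L (\<lambda>y. cnj (v y)) = (\<lambda>x. cnj (L v x))" by (rule ext) (rule L_cnj)
  finally show ?thesis by (simp add: pairing_def L2_inner_def)
qed

lemma L_sign_flip: "x \<in> Rstar \<Longrightarrow> L (sign_flip u) x = - sign_flip (L u) x"
  by (rule integral_oper_L_kernel_sign_flip)

lemma sign_flip_row: "x \<in> Rstar \<Longrightarrow> y \<in> Rstar \<Longrightarrow> sign_flip (lk x) y = - (complex_of_real (sgn x) * lk x y)"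
  using sgn_L_kernel[of x y A] by (simp add: sign_flip_def)

lemma L_cong_ae: "u \<in> L2 \<Longrightarrow> v \<in> L2 \<Longrightarrow> eq_ae u v \<Longrightarrow> x \<in> Rstar \<Longrightarrow> L u x = L v x"
  by (rule integral_oper_cong_ae) (auto intro: row_L2)

lemma L_diff: "u \<in> L2 \<Longrightarrow> v \<in> L2 \<Longrightarrow> x \<in> Rstar \<Longrightarrow> L (\<lambda>y. u y - v y) x = L u x - L v x"
  unfolding integral_oper_pairing by (rule pairing_diff[OF row_L2])

lemma L_scale: "L (\<lambda>y. c * u y) x = c * L u x"
  unfolding integral_oper_pairing by (rule pairing_scale)

lemma L_sum:
  "finite I \<Longrightarrow> (\<And>i. i \<in> I \<Longrightarrow> u i \<in> L2) \<Longrightarrow> x \<in> Rstar \<Longrightarrow> L (\<lambda>y. \<Sum>i\<in>I. u i y) x = (\<Sum>i\<in>I. L (u i) x)"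
  unfolding integral_oper_pairing by (rule pairing_sum[OF row_L2])

end

locale L_resolvent = L_operator +
  fixes S :: oper
  assumes S: "inverse_of_one_plus L S"
begin

lemma S_bounded: "bounded_oper S"
  using S by (simp add: inverse_of_one_plus_def)

lemma S_L2: "u \<in> L2 \<Longrightarrow> S u \<in> L2"
  by (rule bounded_oper_L2[OF S_bounded])

lemma S_right: "u \<in> L2 \<Longrightarrow> eq_ae (\<lambda>x. S u x + L (S u) x) u"
  using S by (simp add: inverse_of_one_plus_def)

text \<open>
  The sign change conjugates \<open>L\<close> to its transpose \<open>-L\<close>, hence the inverse of \<open>1 + L\<close> to the
  inverse of \<open>1 - L\<close>, which is the transposed inverse.
\<close>
lemma S_transpose:
  assumes u: "u \<in> L2" and v: "v \<in> L2"
  shows "pairing (S u) v = pairing u (sign_flip (S (sign_flip v)))"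
proof -
  define a where "a = S u"
  define b where "b = S (sign_flip v)"
  have a: "a \<in> L2" and b: "b \<in> L2" using u v by (auto simp: a_def b_def intro: S_L2 L2_sign_flip)
  note L2s = a b L_L2[OF a] L_L2[OF b] L2_sign_flip[OF b] L2_sign_flip[OF L_L2[OF b]] L_L2[OF L2_sign_flip[OF b]]
  have bv: "eq_ae v (\<lambda>x. sign_flip b x + sign_flip (L b) x)"
  proof -
    have "eq_ae (\<lambda>x. b x + L b x) (sign_flip v)" unfolding b_def by (rule S_right[OF L2_sign_flip[OF v]])
    then have "AE x in leb_Rstar. b x + L b x = sign_flip v x \<and> x \<in> Rstar"
      unfolding eq_ae_def by (auto intro: AE_I2)
    then show ?thesis unfolding eq_ae_def
    proof eventually_elim
      case (elim x)
      have "v x = sign_flip (sign_flip v) x" using elim by (simp add: sign_flip_sign_flip)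
      also have "\<dots> = complex_of_real (sgn x) * (b x + L b x)" using elim by (simp add: sign_flip_def)
      finally show ?case by (simp add: sign_flip_def algebra_simps)
    qed
  qed
  have "pairing a v = pairing a (\<lambda>x. sign_flip b x + sign_flip (L b) x)"
    by (rule pairing_cong_ae) (use L2s v bv in \<open>auto intro: L2_add eq_ae_I\<close>)
  also have "\<dots> = pairing a (sign_flip b) + pairing a (sign_flip (L b))"
    using L2s by (intro pairing_add)
  also have "pairing a (sign_flip (L b)) = pairing (L a) (sign_flip b)"
  proof -
    have "pairing a (sign_flip (L b)) = pairing a (\<lambda>x. (-1) * L (sign_flip b) x)"
      by (rule pairing_cong) (simp_all add: L_sign_flip)
    also have "\<dots> = - pairing a (L (sign_flip b))" unfolding pairing_scale by simp
    also have "\<dots> = pairing (L a) (sign_flip b)" using L_skew L2s by simp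
    finally show ?thesis .
  qed
  also have "pairing a (sign_flip b) + pairing (L a) (sign_flip b) = pairing (sign_flip b) (\<lambda>x. a x + L a x)"
    using L2s by (simp add: pairing_add pairing_commute)
  also have "\<dots> = pairing (sign_flip b) u"
    by (rule pairing_cong_ae) (use L2s u S_right[OF u] in \<open>auto intro: L2_add eq_ae_I simp: a_def\<close>)
  finally show ?thesis by (simp add: a_def b_def pairing_commute)
qed

text \<open>
  The solution \<open>h\<close> of \<open>(1 - L) h = l\<close> with \<open>l\<close> the row of \<open>L\<close> at \<open>x\<close>, which is to become the row of \<open>K\<close>;
  conjugating \<open>S\<close> with the sign change inverts \<open>1 - L\<close>.
\<close>
definition hrow :: "real \<Rightarrow> real \<Rightarrow> complex" where
  "hrow x = sign_flip (S (sign_flip (lk x)))"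

lemma hrow_L2: "x \<in> Rstar \<Longrightarrow> hrow x \<in> L2"
  unfolding hrow_def by (intro L2_sign_flip S_L2 row_L2)

lemma hrow_eq:
  assumes x: "x \<in> Rstar"
  shows "eq_ae (hrow x) (\<lambda>y. lk x y + L (hrow x) y)"
proof -
  define b where "b = S (sign_flip (lk x))"
  have b: "b \<in> L2" unfolding b_def by (intro L2_sign_flip S_L2 row_L2 x)
  have "eq_ae (\<lambda>y. b y + L b y) (sign_flip (lk x))" unfolding b_def by (rule S_right[OF L2_sign_flip[OF row_L2[OF x]]])
  then have "AE y in leb_Rstar. b y + L b y = sign_flip (lk x) y \<and> y \<in> Rstar"
    unfolding eq_ae_def by (auto intro: AE_I2)
  then show ?thesis unfolding eq_ae_def hrow_def b_def[symmetric]
  proof eventually_elim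
    case (elim y)
    have "lk x y = sign_flip (sign_flip (lk x)) y" using elim by (simp add: sign_flip_sign_flip)
    also have "\<dots> = complex_of_real (sgn y) * (b y + L b y)" using elim by (simp add: sign_flip_def)
    finally have "lk x y = sign_flip b y + sign_flip (L b) y" by (simp add: sign_flip_def algebra_simps)
    moreover have "L (sign_flip b) y = - sign_flip (L b) y" using elim by (intro L_sign_flip) auto
    ultimately show ?case by simp
  qed
qed

text \<open>Transposing \<open>1 - L\<close> from the row \<open>h\<close> to the function \<open>S f\<close> turns it into \<open>1 + L\<close>, which \<open>S\<close> inverts.\<close>
lemma LS_pairing:
  assumes x: "x \<in> Rstar" and f: "f \<in> L2"
  shows "L (S f) x = pairing (hrow x) f"
proof -
  note h = hrow_L2[OF x] note L2s = h L_L2[OF h] S_L2[OF f] L_L2[OF S_L2[OF f]]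
  have "L (S f) x = pairing (S f) (lk x)" by (simp add: integral_oper_pairing pairing_commute)
  also have "\<dots> = pairing (S f) (\<lambda>y. hrow x y - L (hrow x) y)"
  proof (rule pairing_cong_ae)
    show "eq_ae (lk x) (\<lambda>y. hrow x y - L (hrow x) y)"
      using hrow_eq[OF x] unfolding eq_ae_def by eventually_elim simp
  qed (use L2s row_L2[OF x] in \<open>auto intro: L2_diff eq_ae_I\<close>)
  also have "\<dots> = pairing (S f) (hrow x) - pairing (S f) (L (hrow x))"
    using L2s by (intro pairing_diff)
  also have "\<dots> = pairing (S f) (hrow x) + pairing (L (S f)) (hrow x)"
    using L_skew[OF S_L2[OF f] h] by simp
  also have "\<dots> = pairing (hrow x) (\<lambda>y. S f y + L (S f) y)"
    using L2s by (simp add: pairing_add pairing_commute)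
  also have "\<dots> = pairing (hrow x) f"
    by (rule pairing_cong_ae) (use L2s f S_right[OF f] in \<open>auto intro: L2_add eq_ae_I\<close>)
  finally show ?thesis .
qed

text \<open>The continuous representative of \<open>hrow x\<close>, obtained by substituting the function into its own equation.\<close>
definition kappa :: "real \<Rightarrow> real \<Rightarrow> complex" where
  "kappa x y = lk x y + L (hrow x) y"

lemma kappa_row_cont: "x \<in> Rstar \<Longrightarrow> continuous_on Rstar (kappa x)"
  unfolding kappa_def[abs_def] by (intro continuous_intros row_cont L_cont hrow_L2)

lemma kappa_ae: "x \<in> Rstar \<Longrightarrow> eq_ae (hrow x) (kappa x)"
  unfolding kappa_def[abs_def] by (rule hrow_eq)

lemma kappa_L2: "x \<in> Rstar \<Longrightarrow> kappa x \<in> L2"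
  unfolding kappa_def[abs_def] by (intro L2_add row_L2 L_L2 hrow_L2)

lemma kappa_eq: "x \<in> Rstar \<Longrightarrow> y \<in> Rstar \<Longrightarrow> kappa x y = lk x y + L (kappa x) y"
  using L_cong_ae[OF hrow_L2 kappa_L2 kappa_ae] by (simp add: kappa_def[of x y])

lemma kappa_pairing: "x \<in> Rstar \<Longrightarrow> f \<in> L2 \<Longrightarrow> L (S f) x = pairing (kappa x) f"
  unfolding LS_pairing
  by (rule pairing_cong_ae) (auto intro: hrow_L2 kappa_L2 kappa_ae eq_ae_I)

text \<open>
  Conjugation with the sign change transposes \<open>L\<close>, hence also \<open>L (1 + L)\<^sup>-\<^sup>1\<close>. Through this symmetry
  properties of the rows of the kernel become properties of its columns.
\<close>
lemma kappa_sym: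
  assumes x: "x \<in> Rstar" and y: "y \<in> Rstar"
  shows "kappa y x = complex_of_real (sgn x) * complex_of_real (sgn y) * kappa x y"
proof -
  have L: "L (hrow x) y = complex_of_real (sgn x) * complex_of_real (sgn y) * L (hrow y) x"
  proof -
    have fl: "pairing (sign_flip (lk z)) w = - complex_of_real (sgn z) * pairing (lk z) w" if "z \<in> Rstar" for z w
    proof -
      have "pairing (sign_flip (lk z)) w = pairing (\<lambda>y. (- complex_of_real (sgn z)) * lk z y) w"
        using sign_flip_row[OF that] by (intro pairing_cong) auto
      then show ?thesis by (simp only: pairing_commute[of _ w] pairing_scale)
    qed
    have "L (hrow x) y = pairing (sign_flip (lk y)) (S (sign_flip (lk x)))"
      by (simp add: integral_oper_pairing hrow_def pairing_sign_flip)
    also have "\<dots> = - complex_of_real (sgn y) * pairing (S (sign_flip (lk x))) (lk y)"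
      unfolding fl[OF y] pairing_commute[of "lk y"] ..
    also have "pairing (S (sign_flip (lk x))) (lk y) = pairing (sign_flip (lk x)) (hrow y)"
      unfolding hrow_def by (intro S_transpose L2_sign_flip row_L2 x y)
    also have "\<dots> = - complex_of_real (sgn x) * L (hrow y) x"
      using fl[OF x] by (simp add: integral_oper_pairing)
    finally show ?thesis by simp
  qed
  have s: "sgn x * sgn x = 1" "sgn y * sgn y = 1"
    using x y by (auto simp: Rstar_def sgn_if)
  have s': "complex_of_real (sgn x) * (complex_of_real (sgn x) * w) = w"
     "complex_of_real (sgn y) * (complex_of_real (sgn y) * w) = w" for w
    using s by (metis mult.assoc mult_1 of_real_1 of_real_mult)+
  have l: "lk y x = complex_of_real (sgn x) * complex_of_real (sgn y) * lk x y"
  proof -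
    have "complex_of_real (sgn x) * (complex_of_real (sgn y) * lk x y) = - lk x y"
      using sgn_L_kernel[OF x y, of A] s' by simp
    then show ?thesis using L_kernel_antisym[of A x y] by (simp add: mult.assoc)
  qed
  have "complex_of_real (sgn x) * complex_of_real (sgn y) * (complex_of_real (sgn x) * complex_of_real (sgn y) * w) = w" for w
    using s' by (metis mult.assoc mult.commute)
  then show ?thesis unfolding kappa_def l L distrib_left by simp
qed

end

locale L_correlation = L_resolvent +
  fixes K :: "real \<Rightarrow> real \<Rightarrow> complex"
  assumes K_cont: "continuous_on (Rstar \<times> Rstar) (\<lambda>(x, y). K x y)"
    and K_bounded: "defines_bounded_oper K"
    and K_S: "\<forall>f\<in>L2. eq_ae (integral_oper K f) (L (S f))"
begin

lemma K_row_cont: "x \<in> Rstar \<Longrightarrow> continuous_on Rstar (K x)"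
  using continuous_on_compose2[OF K_cont, of Rstar "\<lambda>y. (x, y)"]
  by (simp add: image_subset_iff continuous_on_Pair[OF continuous_on_const continuous_on_id])

lemma K_column_cont: "y \<in> Rstar \<Longrightarrow> continuous_on Rstar (\<lambda>x. K x y)"
  using continuous_on_compose2[OF K_cont, of Rstar "\<lambda>x. (x, y)"]
  by (simp add: image_subset_iff continuous_on_Pair[OF continuous_on_id continuous_on_const])

text \<open>
  Testing against countably many intervals identifies the rows at almost every \<open>x\<close>. Both kernels are
  continuous in \<open>x\<close>, \<open>kappa\<close> by its symmetry, so that the exceptional points disappear.
\<close>
lemma K_kappa:
  assumes x: "x \<in> Rstar" and y: "y \<in> Rstar"
  shows "K x y = kappa x y"
proof -
  have "AE x in leb_Rstar. \<forall>I\<in>rational_intervals.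
      (LINT y|leb_Rstar. K x y * indicator I y) = pairing (kappa x) (indicator I)"
  proof (subst AE_ball_countable[OF countable_rational_intervals], intro ballI)
    fix I assume "I \<in> rational_intervals"
    then have I: "(\<lambda>x. indicator I x :: complex) \<in> L2"
      by (auto simp: rational_intervals_def intro: indicator_L2)
    have "eq_ae (integral_oper K (\<lambda>x. indicator I x)) (L (S (\<lambda>x. indicator I x)))" using K_S I by blast
    then have "AE x in leb_Rstar. integral_oper K (\<lambda>x. indicator I x) x = L (S (\<lambda>x. indicator I x)) x \<and> x \<in> Rstar"
      unfolding eq_ae_def by (auto intro: AE_I2)
    then show "AE x in leb_Rstar. (LINT y|leb_Rstar. K x y * indicator I y) = pairing (kappa x) (indicator I)"
      by eventually_elim (use kappa_pairing[OF _ I] in \<open>simp add: integral_oper_def\<close>)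
  qed
  then have "AE x in leb_Rstar. K x y = kappa x y"
  proof (elim AE_mp, intro AE_I2 impI)
    fix x assume x: "x \<in> space leb_Rstar" and eq: "\<forall>I\<in>rational_intervals.
      (LINT y|leb_Rstar. K x y * indicator I y) = pairing (kappa x) (indicator I)"
    show "K x y = kappa x y"
      by (rule continuous_eq_if_rational_integrals_eq[OF K_row_cont kappa_row_cont])
        (use x y eq in \<open>auto simp: pairing_def\<close>)
  qed
  then have "eq_ae (\<lambda>x. K x y) (\<lambda>x. kappa x y)" by (simp add: eq_ae_def)
  moreover have "continuous_on Rstar (\<lambda>x. kappa x y)"
  proof -
    have "continuous_on Rstar (\<lambda>x. complex_of_real (sgn y) * complex_of_real (sgn x) * kappa y x)"
      using y by (intro continuous_intros kappa_row_cont) (auto simp: Rstar_def)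
    then show ?thesis by (rule continuous_on_eq) (use y in \<open>simp add: kappa_sym[OF y, symmetric]\<close>)
  qed
  ultimately show ?thesis
    using eq_ae_continuous_imp_eq[OF K_column_cont[OF y] _ _ x] by blast
qed

lemma K_row_L2:
  assumes x: "x \<in> Rstar" shows "K x \<in> L2"
  by (rule L2_cong_ae[OF kappa_L2[OF x] continuous_on_Rstar_measurable[OF K_row_cont[OF x]]])
    (rule eq_ae_I, simp add: K_kappa x)

lemma K_eq: "x \<in> Rstar \<Longrightarrow> y \<in> Rstar \<Longrightarrow> K x y = lk x y + L (K x) y"
  using kappa_eq[of x y] L_cong_ae[OF K_row_L2 kappa_L2 eq_ae_I[OF K_kappa], of x] by (simp add: K_kappa)

lemma K_sym: "x \<in> Rstar \<Longrightarrow> y \<in> Rstar \<Longrightarrow> K y x = complex_of_real (sgn x) * complex_of_real (sgn y) * K x y"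
  using kappa_sym[of x y] by (simp add: K_kappa)

lemma K_column_L2:
  assumes "y \<in> Rstar" shows "(\<lambda>x. K x y) \<in> L2"
proof (rule L2_cong_ae[OF _ continuous_on_Rstar_measurable[OF K_column_cont[OF assms]]])
  show "(\<lambda>x. complex_of_real (sgn y) * sign_flip (K y) x) \<in> L2"
    by (intro L2_scale L2_sign_flip K_row_L2 assms)
  show "eq_ae (\<lambda>x. complex_of_real (sgn y) * sign_flip (K y) x) (\<lambda>x. K x y)"
    by (rule eq_ae_I) (use K_sym[OF assms] in \<open>simp add: sign_flip_def mult.assoc\<close>)
qed

lemma K_bounded_oper: "bounded_oper (integral_oper K)"
  using K_bounded by (simp add: defines_bounded_oper_def)

text \<open>
  The row of \<open>L\<close> at a zero of \<open>A\<close> vanishes, and with it the row of \<open>K\<close>. So \<open>A\<close> does not vanish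
  at the entries of a tuple at which the determinant of \<open>K\<close> does not vanish.
\<close>
lemma K_zero:
  assumes "A x = 0" "x \<in> Rstar" "y \<in> Rstar" shows "K x y = 0"
proof -
  have lk0: "lk x = (\<lambda>y. 0)"
    using assms(1) by (auto simp: L_kernel_def A_plus_def A_minus_def fun_eq_iff)
  have "eq_ae (S (sign_flip (lk x))) (\<lambda>y. 0)"
    using bounded_oper_scale[OF S_bounded L2_zero, of 0] by (simp add: lk0 sign_flip_def)
  then have "eq_ae (hrow x) (\<lambda>y. 0)"
    unfolding hrow_def eq_ae_def by eventually_elim (simp add: sign_flip_def)
  then have "L (hrow x) y = L (\<lambda>y. 0) y"
    using L_cong_ae[OF hrow_L2 L2_zero] assms by simp
  also have "\<dots> = 0" by (simp add: integral_oper_def)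
  finally show ?thesis using assms by (simp add: K_kappa kappa_def lk0)
qed

text \<open>On operators, the symmetry of the kernel: \<open>K = 1 - S\<close> inherits it from \<open>S\<close>.\<close>
lemma K_transpose:
  assumes u: "u \<in> L2" and v: "v \<in> L2"
  shows "pairing (integral_oper K u) v = pairing u (sign_flip (integral_oper K (sign_flip v)))"
proof -
  have K: "eq_ae (integral_oper K w) (\<lambda>x. w x - S w x)" if "w \<in> L2" for w
    using bspec[OF K_S that] S_right[OF that] unfolding eq_ae_def
    by eventually_elim (simp add: eq_diff_eq add.commute)
  note L2s = bounded_oper_L2[OF K_bounded_oper] S_L2 L2_sign_flip L2_diff
  have "pairing (integral_oper K u) v = pairing (\<lambda>x. u x - S u x) v"
    by (rule pairing_cong_ae) (use u v K in \<open>auto intro: L2s(2-4) L2s(1)[OF u] eq_ae_I\<close>)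
  also have "\<dots> = pairing u v - pairing (S u) v"
    using u v pairing_diff[OF v u S_L2[OF u]] by (simp add: pairing_commute)
  also have "\<dots> = pairing u v - pairing u (sign_flip (S (sign_flip v)))"
    by (simp add: S_transpose u v)
  also have "\<dots> = pairing u (\<lambda>x. v x - sign_flip (S (sign_flip v)) x)"
    using u v by (intro pairing_diff[symmetric] L2s(2-4))
  also have "\<dots> = pairing u (sign_flip (\<lambda>x. sign_flip v x - S (sign_flip v) x))"
    by (rule pairing_cong) (auto simp: sign_flip_def algebra_simps Rstar_def sgn_if)
  also have "\<dots> = pairing u (sign_flip (integral_oper K (sign_flip v)))"
  proof (rule pairing_cong_ae)
    show "eq_ae (sign_flip (\<lambda>x. sign_flip v x - S (sign_flip v) x)) (sign_flip (integral_oper K (sign_flip v)))"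
      using K[OF L2_sign_flip[OF v]] unfolding eq_ae_def by eventually_elim (simp add: sign_flip_def)
  qed (use u v in \<open>auto intro: L2s(2-4) L2_sign_flip[OF L2s(1)[OF L2_sign_flip[OF v]]] eq_ae_I\<close>)
  finally show ?thesis .
qed

end

section \<open>Conditioning on finitely many points\<close>

text \<open>
  Conditioning on the points \<open>p\<close>. The function \<open>h\<close> stands for the factor \<open>f\<^sub>p\<close>; besides
  being bounded, it makes \<open>h L h\<close> arise from \<open>L\<close> by subtracting multiples of the rows at the points of \<open>p\<close>, and
  vanish there. A Schur complement is characterized by these two properties, so the multiples need
  not be known explicitly. The matrix \<open>N\<close> is inverse to the block of \<open>K\<close> at \<open>p\<close>.
\<close>
locale Palm_kernel = L_correlation +
  fixes m :: nat and p :: "nat \<Rightarrow> real" and N :: "nat \<Rightarrow> nat \<Rightarrow> complex" and h :: "real \<Rightarrow> real" and C :: real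
  assumes p_Rstar: "i < m \<Longrightarrow> p i \<in> Rstar"
    and N_left: "i < m \<Longrightarrow> j < m \<Longrightarrow> (\<Sum>a<m. N i a * K (p a) (p j)) = (if i = j then 1 else 0)"
    and h_measurable: "h \<in> borel_measurable leb_Rstar"
    and h_bounded: "x \<in> Rstar \<Longrightarrow> \<bar>h x\<bar> \<le> C"
    and h_zero: "i < m \<Longrightarrow> h (p i) = 0"
    and partial_fractions: "x \<in> Rstar \<Longrightarrow> \<exists>c. \<forall>y\<in>Rstar.
          complex_of_real (h x) * L_kernel A x y * complex_of_real (h y) = L_kernel A x y - (\<Sum>j<m. c j * L_kernel A (p j) y)"
begin

definition e :: "nat \<Rightarrow> real \<Rightarrow> complex" where
  "e a x = (\<Sum>i<m. K x (p i) * N i a)"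

text \<open>The Schur complement of \<open>K\<close> with respect to the block at \<open>p\<close>.\<close>
definition K' :: "real \<Rightarrow> real \<Rightarrow> complex" where
  "K' x y = K x y - (\<Sum>a<m. e a x * K (p a) y)"

definition L' :: oper where
  "L' g = mult_oper h (L (mult_oper h g))"

definition lk' :: "real \<Rightarrow> real \<Rightarrow> complex" where
  "lk' x y = complex_of_real (h x) * lk x y * complex_of_real (h y)"

lemma lk'_antisym: "lk' x y = - lk' y x"
  using L_kernel_antisym[of A x y] by (simp add: lk'_def)

lemma lk'_zero: "i < m \<Longrightarrow> lk' (p i) y = 0"
  by (simp add: lk'_def h_zero)

lemma L'_pairing: "L' u x = pairing (lk' x) u"
  unfolding L'_def mult_oper_def integral_oper_def pairing_def lk'_def
  by (subst integral_mult_right_zero[symmetric]) (simp add: mult_ac)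

lemma mult_h_L2: "u \<in> L2 \<Longrightarrow> mult_oper h u \<in> L2"
  unfolding mult_oper_def
  by (rule L2_mult_bounded[where C = C]) (use h_measurable h_bounded in auto)

lemma row'_L2: "x \<in> Rstar \<Longrightarrow> lk' x \<in> L2"
  using L2_scale[OF mult_h_L2[OF row_L2], of x "complex_of_real (h x)"]
  by (simp add: lk'_def[abs_def] mult_oper_def mult_ac)

lemma L'_bounded: "bounded_oper L'"
  unfolding L'_def[abs_def] by (rule bounded_oper_mult_conj[OF bounded h_measurable h_bounded])

lemma L'_L2: "u \<in> L2 \<Longrightarrow> L' u \<in> L2"
  by (rule bounded_oper_L2[OF L'_bounded])

lemma L'_skew:
  assumes "u \<in> L2" "v \<in> L2"
  shows "pairing (L' u) v = - pairing u (L' v)"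
proof -
  have "pairing (mult_oper h w) z = pairing w (mult_oper h z)" for w z
    by (simp add: pairing_def mult_oper_def mult_ac)
  then show ?thesis
    unfolding L'_def using L_skew[OF mult_h_L2[OF assms(1)] mult_h_L2[OF assms(2)]] by metis
qed

lemma L'_block: "block_anti_self_adjoint L'"
  unfolding block_anti_self_adjoint_def
proof (intro conjI ballI impI)
  fix f g assume fg: "f \<in> L2" "g \<in> L2"
  have sym: "L2_inner (mult_oper h u) v = L2_inner u (mult_oper h v)" for u v
    by (simp add: L2_inner_def mult_oper_def mult_ac)
  have "L2_inner (L (mult_oper h f)) (mult_oper h g) = - L2_inner (mult_oper h f) (L (mult_oper h g))"
    using block mult_h_L2 fg unfolding block_anti_self_adjoint_def by blast
  then show "L2_inner (L' f) g = - L2_inner f (L' g)"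
    by (simp add: L'_def sym)
next
  fix f assume f: "f \<in> L2" "AE x in leb_Rstar. x < 0 \<longrightarrow> f x = 0"
  have "AE x in leb_Rstar. x < 0 \<longrightarrow> mult_oper h f x = 0"
    using f(2) by eventually_elim (simp add: mult_oper_def)
  then have "AE x in leb_Rstar. x > 0 \<longrightarrow> L (mult_oper h f) x = 0"
    using block mult_h_L2[OF f(1)] unfolding block_anti_self_adjoint_def by blast
  then show "AE x in leb_Rstar. x > 0 \<longrightarrow> L' f x = 0"
    by eventually_elim (simp add: L'_def mult_oper_def)
next
  fix f assume f: "f \<in> L2" "AE x in leb_Rstar. x > 0 \<longrightarrow> f x = 0"
  have "AE x in leb_Rstar. x > 0 \<longrightarrow> mult_oper h f x = 0"
    using f(2) by eventually_elim (simp add: mult_oper_def)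
  then have "AE x in leb_Rstar. x < 0 \<longrightarrow> L (mult_oper h f) x = 0"
    using block mult_h_L2[OF f(1)] unfolding block_anti_self_adjoint_def by blast
  then show "AE x in leb_Rstar. x < 0 \<longrightarrow> L' f x = 0"
    by eventually_elim (simp add: L'_def mult_oper_def)
qed

lemma e_L2: "e a \<in> L2"
proof -
  have "(\<lambda>x. \<Sum>i<m. N i a * K x (p i)) \<in> L2"
    by (intro L2_sum L2_scale K_column_L2 p_Rstar) auto
  then show ?thesis by (simp add: e_def[abs_def] mult.commute)
qed

lemma K'_row_L2: "x \<in> Rstar \<Longrightarrow> K' x \<in> L2"
  unfolding K'_def[abs_def] by (intro L2_diff L2_sum L2_scale K_row_L2 p_Rstar) auto

lemma K'_zero:
  assumes "j < m" shows "K' x (p j) = 0"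
proof -
  have "(\<Sum>a<m. e a x * K (p a) (p j)) = (\<Sum>a<m. \<Sum>i<m. K x (p i) * (N i a * K (p a) (p j)))"
    by (simp add: e_def sum_distrib_right mult.assoc)
  also have "\<dots> = (\<Sum>i<m. \<Sum>a<m. K x (p i) * (N i a * K (p a) (p j)))"
    by (rule sum.swap)
  also have "\<dots> = (\<Sum>i<m. K x (p i) * (if i = j then 1 else 0))"
    using assms by (simp add: sum_distrib_left[symmetric] N_left)
  also have "\<dots> = K x (p j)" using assms by (simp add: if_distrib cong: if_cong)
  finally show ?thesis by (simp add: K'_def)
qed

text \<open>
  The resolvent equation of the conditioned kernels. Subtracting from a function the combination of
  its values at \<open>p\<close> with the coefficients \<open>c\<close> turns \<open>L u\<close> into \<open>L' u\<close> and rows of \<open>L\<close> into rows of \<open>L'\<close>. Applied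
  to the equation which \<open>L (K' x)\<close> satisfies by the resolvent equation of \<open>K\<close>, it leaves \<open>K' x\<close> unchanged
  and removes the rows at \<open>p\<close>, because \<open>K'\<close> and \<open>L'\<close> vanish at \<open>p\<close>.
\<close>
lemma K'_resolvent:
  assumes x: "x \<in> Rstar" and y: "y \<in> Rstar"
  shows "L' (K' x) y = K' x y - lk' x y"
proof -
  obtain c where c: "lk' y z = lk y z - (\<Sum>j<m. c j * lk (p j) z)" if "z \<in> Rstar" for z
    using partial_fractions[OF y] unfolding lk'_def by blast
  have cz: "lk z y - (\<Sum>j<m. c j * lk z (p j)) = lk' z y" if "z \<in> Rstar" for z
  proof -
    have "(\<Sum>j<m. c j * lk z (p j)) = - (\<Sum>j<m. c j * lk (p j) z)"
      using L_kernel_antisym[of A z] by (simp add: sum_negf[symmetric])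
    then show ?thesis using c[OF that] lk'_antisym[of z y] L_kernel_antisym[of A z y] by simp
  qed
  have L'c: "L' u y = L u y - (\<Sum>j<m. c j * L u (p j))" if u: "u \<in> L2" for u
  proof -
    have "L' u y = pairing u (\<lambda>z. lk y z - (\<Sum>j<m. c j * lk (p j) z))"
      unfolding L'_pairing pairing_commute[of _ u] by (rule pairing_cong) (auto simp: c)
    also have "\<dots> = pairing u (lk y) - pairing u (\<lambda>z. \<Sum>j<m. c j * lk (p j) z)"
      by (intro pairing_diff u L2_sum L2_scale row_L2 y p_Rstar) auto
    also have "pairing u (\<lambda>z. \<Sum>j<m. c j * lk (p j) z) = (\<Sum>j<m. pairing u (\<lambda>z. c j * lk (p j) z))"
      by (intro pairing_sum u L2_scale row_L2 p_Rstar) auto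
    finally show ?thesis by (simp add: integral_oper_pairing pairing_commute pairing_scale)
  qed
  have LK': "L (K' x) z = K' x z - lk x z + (\<Sum>a<m. e a x * lk (p a) z)" if z: "z \<in> Rstar" for z
  proof -
    have "L (K' x) z = L (K x) z - L (\<lambda>y. \<Sum>a<m. e a x * K (p a) y) z"
      unfolding K'_def[abs_def] by (intro L_diff z L2_sum L2_scale K_row_L2 x p_Rstar) auto
    also have "L (\<lambda>y. \<Sum>a<m. e a x * K (p a) y) z = (\<Sum>a<m. L (\<lambda>y. e a x * K (p a) y) z)"
      by (intro L_sum z L2_scale K_row_L2 p_Rstar) auto
    also have "\<dots> = (\<Sum>a<m. e a x * (K (p a) z - lk (p a) z))"
      using K_eq[OF p_Rstar z] by (intro sum.cong) (auto simp: L_scale)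
    also have "L (K x) z = K x z - lk x z" using K_eq[OF x z] by simp
    finally show ?thesis unfolding K'_def[of x z] by (simp add: sum_subtractf algebra_simps)
  qed
  have "L' (K' x) y = L (K' x) y - (\<Sum>j<m. c j * L (K' x) (p j))"
    by (rule L'c[OF K'_row_L2[OF x]])
  also have "(\<Sum>j<m. c j * L (K' x) (p j)) = (\<Sum>j<m. c j * (- lk x (p j) + (\<Sum>a<m. e a x * lk (p a) (p j))))"
    by (intro sum.cong) (auto simp: LK' p_Rstar K'_zero)
  also have "\<dots> = - (\<Sum>j<m. c j * lk x (p j)) + (\<Sum>j<m. \<Sum>a<m. e a x * (c j * lk (p a) (p j)))"
    by (simp add: distrib_left right_diff_distrib sum.distrib sum_subtractf sum_negf sum_distrib_left mult_ac)
  also have "(\<Sum>j<m. \<Sum>a<m. e a x * (c j * lk (p a) (p j))) = (\<Sum>a<m. e a x * (\<Sum>j<m. c j * lk (p a) (p j)))"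
    by (subst sum.swap) (simp add: sum_distrib_left)
  also have "L (K' x) y - (- (\<Sum>j<m. c j * lk x (p j)) + (\<Sum>a<m. e a x * (\<Sum>j<m. c j * lk (p a) (p j))))
     = K' x y - (lk x y - (\<Sum>j<m. c j * lk x (p j))) + (\<Sum>a<m. e a x * (lk (p a) y - (\<Sum>j<m. c j * lk (p a) (p j))))"
    unfolding LK'[OF y] by (simp add: right_diff_distrib sum_subtractf)
  also have "\<dots> = K' x y - lk' x y"
    using cz[OF x] cz[OF p_Rstar] by (simp add: lk'_zero)
  finally show ?thesis .
qed

text \<open>An inverse is unique, so it inherits the symmetry of the block of \<open>K\<close>.\<close>
lemma N_sym:
  assumes i: "i < m" and j: "j < m"
  shows "N j i = complex_of_real (sgn (p i)) * complex_of_real (sgn (p j)) * N i j"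
proof -
  define s where "s i = complex_of_real (sgn (p i))" for i
  have ss: "s i * s i = 1" "s i * (s i * w) = w" if "i < m" for i w
  proof -
    have "sgn (p i) * sgn (p i) = 1" using p_Rstar[OF that] by (auto simp: Rstar_def sgn_if)
    then show 1: "s i * s i = 1" unfolding s_def by (metis of_real_1 of_real_mult)
    show "s i * (s i * w) = w" using 1 by (simp add: mult.assoc[symmetric])
  qed
  define M where "M a i = s i * s a * N i a" for a i
  \<comment> \<open>transposing the equation of the left inverse makes \<open>M\<close> a right inverse\<close>
  have M: "(\<Sum>b<m. K (p a) (p b) * M b i) = (if i = a then 1 else 0)" if a: "a < m" for a
  proof -
    have "(\<Sum>b<m. K (p a) (p b) * M b i) = (\<Sum>b<m. s i * s a * (N i b * K (p b) (p a)))"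
    proof (rule sum.cong[OF refl])
      fix b assume b: "b \<in> {..<m}"
      have "K (p a) (p b) = s b * s a * K (p b) (p a)"
        using K_sym[of "p b" "p a"] b a by (simp add: s_def p_Rstar)
      then show "K (p a) (p b) * M b i = s i * s a * (N i b * K (p b) (p a))"
        using ss[of b] b by (simp add: M_def mult_ac)
    qed
    also have "\<dots> = s i * s a * (if i = a then 1 else 0)"
      unfolding sum_distrib_left[symmetric] N_left[OF i a] ..
    finally show ?thesis using ss a by auto
  qed
  have "N j i = (\<Sum>a<m. N j a * (\<Sum>b<m. K (p a) (p b) * M b i))"
    using i by (simp add: M if_distrib cong: if_cong)
  also have "\<dots> = (\<Sum>a<m. \<Sum>b<m. N j a * K (p a) (p b) * M b i)"
    by (simp add: sum_distrib_left mult.assoc)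
  also have "\<dots> = (\<Sum>b<m. \<Sum>a<m. N j a * K (p a) (p b) * M b i)"
    by (rule sum.swap)
  also have "\<dots> = (\<Sum>b<m. (if j = b then 1 else 0) * M b i)"
    using j by (simp add: sum_distrib_right[symmetric] N_left)
  also have "\<dots> = M j i" using j by (simp add: mult_delta_left)
  finally show ?thesis by (simp add: M_def s_def)
qed

lemma K'_oper:
  assumes f: "f \<in> L2" and x: "x \<in> Rstar"
  shows "integral_oper K' f x = integral_oper K f x - (\<Sum>a<m. e a x * pairing (K (p a)) f)"
proof -
  have "pairing f (K' x) = pairing f (K x) - pairing f (\<lambda>y. \<Sum>a<m. e a x * K (p a) y)"
    unfolding K'_def[abs_def] by (intro pairing_diff f L2_sum L2_scale K_row_L2 x p_Rstar) auto
  also have "pairing f (\<lambda>y. \<Sum>a<m. e a x * K (p a) y) = (\<Sum>a<m. pairing f (\<lambda>y. e a x * K (p a) y))"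
    by (intro pairing_sum f L2_scale K_row_L2 p_Rstar) auto
  finally show ?thesis by (simp add: integral_oper_pairing pairing_commute pairing_scale)
qed

lemma K'_measurable: "(\<lambda>(x, y). K' x y) \<in> borel_measurable (leb_Rstar \<Otimes>\<^sub>M leb_Rstar)"
proof -
  have K: "(\<lambda>(x, y). K x y) \<in> borel_measurable (leb_Rstar \<Otimes>\<^sub>M leb_Rstar)"
    using K_bounded by (simp add: defines_bounded_oper_def)
  have 1: "(\<lambda>z. K (p a) (snd z)) \<in> borel_measurable (leb_Rstar \<Otimes>\<^sub>M leb_Rstar)" if "a < m" for a
    using measurable_compose[OF measurable_snd L2_measurable[OF K_row_L2[OF p_Rstar[OF that]]]] .
  have 2: "(\<lambda>z. e a (fst z)) \<in> borel_measurable (leb_Rstar \<Otimes>\<^sub>M leb_Rstar)" for a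
    using measurable_compose[OF measurable_fst L2_measurable[OF e_L2]] .
  show ?thesis
    using K unfolding K'_def split_beta' by (intro borel_measurable_diff borel_measurable_sum borel_measurable_times 1 2) auto
qed

lemma K'_oper_L2: "f \<in> L2 \<Longrightarrow> integral_oper K' f \<in> L2"
  and K'_oper_bounded: "bounded_oper (integral_oper K')"
proof -
  show b: "bounded_oper (integral_oper K')"
  proof (rule bounded_oper_cong)
    show "bounded_oper (\<lambda>f x. integral_oper K f x - (\<Sum>a<m. e a x * pairing (K (p a)) f))"
      by (rule bounded_oper_diff_sum[OF K_bounded_oper]) (auto intro: e_L2 K_row_L2 p_Rstar)
    show "integral_oper K f x - (\<Sum>a<m. e a x * pairing (K (p a)) f) = integral_oper K' f x"
      if "f \<in> L2" "x \<in> Rstar" for f x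
      using K'_oper[OF that] by simp
    show "integral_oper K' f \<in> borel_measurable leb_Rstar" if "f \<in> L2" for f
    proof (subst measurable_cong[OF K'_oper[OF that]])
      show "(\<lambda>x. integral_oper K f x - (\<Sum>a<m. e a x * pairing (K (p a)) f)) \<in> borel_measurable leb_Rstar"
        using L2_measurable[OF bounded_oper_L2[OF K_bounded_oper that]] L2_measurable[OF e_L2] by measurable
    qed simp
  qed
  show "f \<in> L2 \<Longrightarrow> integral_oper K' f \<in> L2" by (rule bounded_oper_L2[OF b])
qed

text \<open>
  The symmetry of the perturbation of finite rank: both sides reduce to double sums over pairs of
  points of \<open>p\<close>, which \<open>N_sym\<close> matches.
\<close>
lemma K'_transpose:
  assumes u: "u \<in> L2" and v: "v \<in> L2"
  shows "pairing (integral_oper K' u) v = pairing u (sign_flip (integral_oper K' (sign_flip v)))"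
proof -
  define s where "s i = complex_of_real (sgn (p i))" for i
  define B where "B i = pairing (sign_flip (K (p i))) v" for i
  define D where "D i = pairing (K (p i)) u" for i
  note fv = L2_sign_flip[OF v]
  have ev: "pairing v (e a) = (\<Sum>i<m. N i a * s i * B i)" for a
  proof -
    have "pairing v (e a) = pairing v (\<lambda>x. \<Sum>i<m. (N i a * s i) * sign_flip (K (p i)) x)"
    proof (rule pairing_cong[OF refl])
      fix x assume x: "x \<in> Rstar"
      show "e a x = (\<Sum>i<m. (N i a * s i) * sign_flip (K (p i)) x)"
        unfolding e_def by (intro sum.cong) (use K_sym[OF p_Rstar x] in \<open>auto simp: s_def sign_flip_def\<close>)
    qed
    also have "\<dots> = (\<Sum>i<m. pairing v (\<lambda>x. (N i a * s i) * sign_flip (K (p i)) x))"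
      by (intro pairing_sum v L2_scale L2_sign_flip K_row_L2 p_Rstar) auto
    finally show ?thesis by (simp add: pairing_scale B_def pairing_commute)
  qed
  have eu: "pairing u (sign_flip (e a)) = (\<Sum>i<m. N i a * s i * D i)" for a
  proof -
    have "pairing u (sign_flip (e a)) = pairing u (\<lambda>x. \<Sum>i<m. (N i a * s i) * K (p i) x)"
    proof (rule pairing_cong[OF refl])
      fix x assume x: "x \<in> Rstar"
      have sx: "complex_of_real (sgn x) * (complex_of_real (sgn x) * w) = w" for w
        using x by (auto simp: Rstar_def sgn_if)
      show "sign_flip (e a) x = (\<Sum>i<m. (N i a * s i) * K (p i) x)"
        unfolding e_def sign_flip_def sum_distrib_left
        by (intro sum.cong) (use K_sym[OF p_Rstar x] sx in \<open>auto simp: s_def mult_ac\<close>)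
    qed
    also have "\<dots> = (\<Sum>i<m. pairing u (\<lambda>x. (N i a * s i) * K (p i) x))"
      by (intro pairing_sum u L2_scale K_row_L2 p_Rstar) auto
    finally show ?thesis by (simp add: pairing_scale D_def pairing_commute)
  qed
  have "pairing (integral_oper K' u) v = pairing v (\<lambda>x. integral_oper K u x - (\<Sum>a<m. D a * e a x))"
    unfolding pairing_commute[of _ v] by (rule pairing_cong) (auto simp: K'_oper[OF u] D_def mult.commute)
  also have "\<dots> = pairing v (integral_oper K u) - pairing v (\<lambda>x. \<Sum>a<m. D a * e a x)"
    by (intro pairing_diff v L2_sum L2_scale e_L2 bounded_oper_L2[OF K_bounded_oper u]) auto
  also have "pairing v (\<lambda>x. \<Sum>a<m. D a * e a x) = (\<Sum>a<m. pairing v (\<lambda>x. D a * e a x))"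
    by (intro pairing_sum v L2_scale e_L2) auto
  also have "\<dots> = (\<Sum>a<m. \<Sum>i<m. N i a * s i * B i * D a)"
    by (simp add: pairing_scale ev sum_distrib_left mult_ac)
  finally have 1: "pairing (integral_oper K' u) v = pairing v (integral_oper K u) - (\<Sum>a<m. \<Sum>i<m. N i a * s i * B i * D a)" .
  have "pairing u (sign_flip (integral_oper K' (sign_flip v))) = pairing u (\<lambda>x. sign_flip (integral_oper K (sign_flip v)) x - (\<Sum>a<m. B a * sign_flip (e a) x))"
    by (rule pairing_cong)
       (auto simp: sign_flip_def[of "integral_oper K' _"] sign_flip_def[of "integral_oper K _"] sign_flip_def[of "e _"] K'_oper[OF fv] B_def pairing_sign_flip right_diff_distrib sum_distrib_left mult_ac)
  also have "\<dots> = pairing u (sign_flip (integral_oper K (sign_flip v))) - pairing u (\<lambda>x. \<Sum>a<m. B a * sign_flip (e a) x)"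
    by (intro pairing_diff u L2_sum L2_scale L2_sign_flip e_L2 bounded_oper_L2[OF K_bounded_oper fv]) auto
  also have "pairing u (\<lambda>x. \<Sum>a<m. B a * sign_flip (e a) x) = (\<Sum>a<m. pairing u (\<lambda>x. B a * sign_flip (e a) x))"
    by (intro pairing_sum u L2_scale L2_sign_flip e_L2) auto
  also have "\<dots> = (\<Sum>a<m. \<Sum>i<m. N i a * s i * D i * B a)"
    by (simp add: pairing_scale eu sum_distrib_left mult_ac)
  also have "\<dots> = (\<Sum>i<m. \<Sum>a<m. N i a * s i * D i * B a)" by (rule sum.swap)
  also have "\<dots> = (\<Sum>a<m. \<Sum>i<m. N i a * s i * B i * D a)"
  proof (intro sum.cong refl)
    fix i a assume ia: "i \<in> {..<m}" "a \<in> {..<m}"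
    have "s i * s i = 1" "s a * s a = 1"
      using p_Rstar[of i] p_Rstar[of a] ia by (auto simp: s_def Rstar_def sgn_if)
    then have "N i a * s i = N a i * s a"
      using N_sym[of i a] ia by (simp add: s_def[symmetric]) 
    then show "N i a * s i * D i * B a = N a i * s a * B a * D i" by simp
  qed
  finally show ?thesis using 1 K_transpose[OF u v] by (simp add: pairing_commute)
qed

text \<open>Pairing \<open>K'_resolvent\<close> with \<open>g\<close>, where skew symmetry moves \<open>L'\<close> from the row to the function.\<close>
lemma K'_left:
  assumes g: "g \<in> L2" and x: "x \<in> Rstar"
  shows "integral_oper K' g x + integral_oper K' (L' g) x = L' g x"
proof -
  note K' = K'_row_L2[OF x]
  have "integral_oper K' (L' g) x = pairing (L' g) (K' x)"
    by (simp add: integral_oper_pairing pairing_commute)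
  also have "\<dots> = - pairing g (L' (K' x))" by (rule L'_skew[OF g K'])
  also have "pairing g (L' (K' x)) = pairing g (\<lambda>y. K' x y - lk' x y)"
    by (rule pairing_cong) (auto simp: K'_resolvent x)
  also have "\<dots> = pairing g (K' x) - pairing g (lk' x)"
    by (intro pairing_diff g K' row'_L2 x)
  finally show ?thesis
    unfolding integral_oper_pairing[of K' g] L'_pairing[of g x] by (simp add: pairing_commute)
qed

lemma L'_sign_flip: "x \<in> Rstar \<Longrightarrow> L' (sign_flip u) x = - sign_flip (L' u) x"
proof -
  assume x: "x \<in> Rstar"
  have "mult_oper h (sign_flip u) = sign_flip (mult_oper h u)" by (auto simp: mult_oper_def sign_flip_def)
  then show ?thesis using L_sign_flip[OF x, of "mult_oper h u"] by (simp add: L'_def mult_oper_def sign_flip_def)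
qed

text \<open>
  A left inverse of a bounded operator need not be a right inverse. Here the transpose of \<open>K'_left\<close>,
  conjugated with the sign change, is the identity for the other order: the sign change transposes \<open>K'\<close>,
  and maps \<open>L'\<close> to \<open>-L'\<close>, which is its transpose.
\<close>
lemma K'_right:
  assumes f: "f \<in> L2"
  shows "eq_ae (\<lambda>x. integral_oper K' f x + L' (integral_oper K' f) x) (L' f)"
proof -
  let ?K = "integral_oper K'"
  note kf = K'_oper_L2[OF f]
  define w where "w = (\<lambda>x. (?K f x + L' (?K f) x) - L' f x)"
  have w: "w \<in> L2" unfolding w_def by (intro L2_diff L2_add kf L'_L2 f)
  have "pairing w v = 0" if v: "v \<in> L2" for v
  proof -
    note fv = L2_sign_flip[OF v]
    have "pairing v w = pairing v (\<lambda>x. ?K f x + L' (?K f) x) - pairing v (L' f)"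
      unfolding w_def by (intro pairing_diff v L2_add kf L'_L2 f)
    also have "pairing v (\<lambda>x. ?K f x + L' (?K f) x) = pairing v (?K f) + pairing v (L' (?K f))"
      by (intro pairing_add v kf L'_L2)
    also have "pairing v (?K f) = pairing f (sign_flip (?K (sign_flip v)))"
      using K'_transpose[OF f v] by (simp add: pairing_commute)
    also have "pairing v (L' (?K f)) = - pairing (?K f) (L' v)"
      using L'_skew[OF kf v] by (simp add: pairing_commute)
    also have "pairing (?K f) (L' v) = pairing f (sign_flip (?K (sign_flip (L' v))))"
      by (rule K'_transpose[OF f L'_L2[OF v]])
    also have "- pairing f (sign_flip (?K (sign_flip (L' v)))) = pairing f (sign_flip (?K (L' (sign_flip v))))"
    proof -
      have "sign_flip (?K (sign_flip (L' v))) x = - sign_flip (?K (L' (sign_flip v))) x" for x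
      proof -
        have "pairing (K' x) (sign_flip (L' v)) = pairing (K' x) (\<lambda>y. (-1) * L' (sign_flip v) y)"
          by (rule pairing_cong) (auto simp: L'_sign_flip)
        then show ?thesis unfolding sign_flip_def[of "?K _"] integral_oper_pairing by (simp only: pairing_scale) simp
      qed
      then have "pairing f (sign_flip (?K (sign_flip (L' v)))) = pairing f (\<lambda>x. (-1) * sign_flip (?K (L' (sign_flip v))) x)"
        by (intro pairing_cong) auto
      then show ?thesis by (simp only: pairing_scale) simp
    qed
    also have "pairing f (sign_flip (?K (sign_flip v))) + pairing f (sign_flip (?K (L' (sign_flip v))))
      = pairing f (\<lambda>x. sign_flip (?K (sign_flip v)) x + sign_flip (?K (L' (sign_flip v))) x)"
      by (intro pairing_add[symmetric] f L2_sign_flip K'_oper_L2 fv L'_L2)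
    also have "\<dots> = pairing f (sign_flip (L' (sign_flip v)))"
      by (rule pairing_cong) (use K'_left[OF fv] in \<open>auto simp: sign_flip_def distrib_left[symmetric]\<close>)
    also have "\<dots> = pairing f (\<lambda>x. (-1) * L' v x)"
      by (rule pairing_cong) (auto simp: sign_flip_def[of "L' _"] L'_sign_flip, auto simp: sign_flip_def Rstar_def sgn_if split: if_split_asm)
    also have "\<dots> = - pairing f (L' v)" by (simp only: pairing_scale) simp
    also have "\<dots> = pairing v (L' f)"
      using L'_skew[OF f v] by (simp add: pairing_commute)
    finally show ?thesis by (simp add: pairing_commute)
  qed
  then have "eq_ae w (\<lambda>x. 0)" by (rule eq_ae_zero_if_pairing_zero[OF w])
  then show ?thesis unfolding eq_ae_def w_def by eventually_elim simp
qed

lemma K'_cont: "continuous_on (Rstar \<times> Rstar) (\<lambda>(x, y). K' x y)"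
proof -
  have 1: "continuous_on (Rstar \<times> Rstar) (\<lambda>z. K (p a) (snd z))" "continuous_on (Rstar \<times> Rstar) (\<lambda>z. K (fst z) (p a))" if "a < m" for a
    by (rule continuous_on_compose2[OF K_row_cont[OF p_Rstar[OF that]]] continuous_on_compose2[OF K_column_cont[OF p_Rstar[OF that]]];
        auto intro!: continuous_intros)+
  show ?thesis
    using K_cont unfolding K'_def split_beta' e_def by (intro continuous_on_diff continuous_on_sum continuous_on_mult continuous_on_const 1) auto
qed

text \<open>The inverse of \<open>1 + L'\<close> is \<open>1 - K'\<close>.\<close>
lemma K'_correlation: "L_correlation_kernel L' K'"
  unfolding L_correlation_kernel_def
proof (intro conjI exI[of _ "\<lambda>f x. f x - integral_oper K' f x"] ballI)
  show "continuous_on (Rstar \<times> Rstar) (\<lambda>(x, y). K' x y)" by (rule K'_cont)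
  show "defines_bounded_oper K'"
    unfolding defines_bounded_oper_def
    using K'_measurable K'_oper_bounded L2_mult_integrable[OF K'_row_L2]
    by (auto intro!: AE_I2)
  let ?S = "\<lambda>f x. f x - integral_oper K' f x"
  have S: "bounded_oper ?S" by (rule bounded_oper_diff[OF bounded_oper_id K'_oper_bounded])
  have LS: "L' (?S f) x = L' f x - L' (integral_oper K' f) x" if "f \<in> L2" "x \<in> Rstar" for f x
    unfolding L'_pairing by (intro pairing_diff row'_L2 that K'_oper_L2)
  show "inverse_of_one_plus L' ?S"
    unfolding inverse_of_one_plus_def
  proof (intro conjI ballI S)
    fix f assume f: "f \<in> L2"
    show "eq_ae (\<lambda>x. f x + L' f x - integral_oper K' (\<lambda>x. f x + L' f x) x) f"
    proof (rule eq_ae_I)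
      fix x assume x: "x \<in> Rstar"
      have "integral_oper K' (\<lambda>x. f x + L' f x) x = integral_oper K' f x + integral_oper K' (L' f) x"
        unfolding integral_oper_pairing by (intro pairing_add K'_row_L2 x f L'_L2)
      then show "f x + L' f x - integral_oper K' (\<lambda>x. f x + L' f x) x = f x"
        using K'_left[OF f x] by simp
    qed
    have "AE x in leb_Rstar. integral_oper K' f x + L' (integral_oper K' f) x = L' f x \<and> x \<in> Rstar"
      using K'_right[OF f] unfolding eq_ae_def by (auto intro: AE_I2)
    then show "eq_ae (\<lambda>x. f x - integral_oper K' f x + L' (?S f) x) f"
      unfolding eq_ae_def by eventually_elim (auto simp: LS[OF f] eq_diff_eq algebra_simps)
  qed
  fix f assume f: "f \<in> L2"
  have "AE x in leb_Rstar. integral_oper K' f x + L' (integral_oper K' f) x = L' f x \<and> x \<in> Rstar"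
    using K'_right[OF f] unfolding eq_ae_def by (auto intro: AE_I2)
  then show "eq_ae (integral_oper K' f) (L' (?S f))"
    unfolding eq_ae_def by eventually_elim (auto simp: LS[OF f] eq_diff_eq algebra_simps)
qed

end

section \<open>Partial fractions of the conditioned Cauchy kernel\<close>

definition pair_factor :: "real \<Rightarrow> real \<Rightarrow> real \<Rightarrow> real" where
  "pair_factor a b x = (x / a - 1) / (x / b - 1) * indicator {0<..} x + (x / b - 1) / (x / a - 1) * indicator {..<0} x"

lemma f_Palm_pair_factor: "f_Palm n p x = (\<Prod>i<n. pair_factor (p i) (p (n + i)) x)"
  by (simp add: f_Palm_def pair_factor_def)

lemma pair_factor_pos: "x > 0 \<Longrightarrow> pair_factor a b x = (x / a - 1) / (x / b - 1)"
  by (simp add: pair_factor_def)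

lemma pair_factor_neg: "x < 0 \<Longrightarrow> pair_factor a b x = (x / b - 1) / (x / a - 1)"
  by (simp add: pair_factor_def)

lemma pair_factor_bounded:
  assumes "a > 0" "b < 0" "x \<in> Rstar"
  shows "\<bar>pair_factor a b x\<bar> \<le> 1 + \<bar>b\<bar> / a + a / \<bar>b\<bar>"
proof -
  have *: "\<bar>(x / a - 1) / (x / b - 1)\<bar> \<le> 1 + \<bar>b\<bar> / \<bar>a\<bar>" if "x * a > 0" "x * b < 0" for x a b :: real
  proof -
    have s: "x / a > 0" "x / b < 0" using that by (auto simp: zero_less_divide_iff divide_less_0_iff zero_less_mult_iff mult_less_0_iff)
    have "\<bar>x / a\<bar> = (\<bar>b\<bar> / \<bar>a\<bar>) * \<bar>x / b\<bar>" using that by (auto simp: abs_mult)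
    then have "x / a = (\<bar>b\<bar> / \<bar>a\<bar>) * (- (x / b))"
      unfolding abs_of_pos[OF s(1)] abs_of_neg[OF s(2)] .
    moreover have "(1 + q) * (1 - r) = 1 - r + q + q * (- r)" for q r :: real
      by (simp add: algebra_simps)
    note this[of "\<bar>b\<bar> / \<bar>a\<bar>" "x / b"]
    moreover have "\<bar>b\<bar> / \<bar>a\<bar> \<ge> 0" by simp
    ultimately have "\<bar>x / a - 1\<bar> \<le> (1 + \<bar>b\<bar> / \<bar>a\<bar>) * (1 - x / b)" using s by linarith
    moreover have "\<bar>x / b - 1\<bar> = 1 - x / b" "1 - x / b > 0" using s by auto
    ultimately show ?thesis by (simp add: pos_divide_le_eq)
  qed
  consider "x > 0" | "x < 0" using assms(3) by (auto simp: Rstar_def neq_iff)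
  then show ?thesis
  proof cases
    case 1
    have "\<bar>pair_factor a b x\<bar> \<le> 1 + \<bar>b\<bar> / \<bar>a\<bar>"
      unfolding pair_factor_pos[OF 1] using 1 assms by (intro *) (auto simp: mult_less_0_iff)
    then show ?thesis using assms by (smt (verit) divide_nonneg_pos)
  next
    case 2
    have "\<bar>pair_factor a b x\<bar> \<le> 1 + \<bar>a\<bar> / \<bar>b\<bar>"
      unfolding pair_factor_neg[OF 2] using 2 assms by (intro *) (auto simp: mult_less_0_iff zero_less_mult_iff)
    then show ?thesis using assms by (smt (verit) divide_nonneg_pos)
  qed
qed

lemma pair_factor_zero: "a > 0 \<Longrightarrow> b < 0 \<Longrightarrow> pair_factor a b a = 0 \<and> pair_factor a b b = 0"
  by (simp add: pair_factor_def)

lemma pair_factor_nonzero: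
  assumes "a > 0" "b < 0" "x \<in> Rstar" "x \<noteq> a" "x \<noteq> b"
  shows "pair_factor a b x \<noteq> 0"
proof -
  have "x / a \<noteq> 1" "x / b \<noteq> 1" using assms by auto
  then show ?thesis using assms(3) by (auto simp: pair_factor_def Rstar_def indicator_def)
qed

lemma pair_factor_measurable [measurable]: "pair_factor a b \<in> borel_measurable borel"
  unfolding pair_factor_def[abs_def] by measurable

text \<open>
  As rational functions, the factors of a pair at \<open>x\<close> and at \<open>y\<close> multiply to 1 when \<open>y\<close> is continued to \<open>x\<close>, so
  the product keeps the residue of the kernel at \<open>y = x\<close>. Its only other pole in \<open>y\<close> is the point of the
  pair which has the sign of \<open>x\<close>, and a multiple of the row at this point accounts for it. The function
  \<open>F\<close> collects the factors of other pairs.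
\<close>
lemma pair_factor_partial_fraction:
  assumes a: "a > 0" and b: "b < 0" and x: "x \<in> Rstar"
    and Fa: "F a \<noteq> 0" "A a \<noteq> 0" and Fb: "F b \<noteq> 0" "A b \<noteq> 0"
  shows "\<exists>c z. z \<in> {a, b} \<and> (\<forall>y\<in>Rstar.
     (F x * pair_factor a b x) * real_kernel A x y * (F y * pair_factor a b y) =
     F x * real_kernel A x y * F y - c * (F z * real_kernel A z y * F y))"
proof -
  have core: "((x - a) / (x - b)) * ((y - b) / (y - a)) / (x - y) = 1 / (x - y) - ((a - b) / (x - b)) / (a - y)"
    if "x \<noteq> b" "y \<noteq> a" "x \<noteq> y" for x y a b :: real
  proof -
    have nz: "x - b \<noteq> 0" "y - a \<noteq> 0" "x - y \<noteq> 0" "a - y \<noteq> 0" using that by auto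
    have "(x - a) * (y - b) = (y - a) * (x - b) + (a - b) * (x - y)" by (simp add: algebra_simps)
    then have "((x - a) * (y - b)) / ((x - b) * (y - a) * (x - y))
        = (y - a) * (x - b) / ((x - b) * (y - a) * (x - y)) + (a - b) * (x - y) / ((x - b) * (y - a) * (x - y))"
      by (simp add: add_divide_distrib)
    also have "\<dots> = 1 / (x - y) + (a - b) / ((x - b) * (y - a))" using nz by simp
    also have "(a - b) / ((x - b) * (y - a)) = - (((a - b) / (x - b)) / (a - y))"
      by (metis divide_divide_eq_left minus_diff_eq minus_divide_right mult_minus_right)
    finally show ?thesis by (simp add: mult.assoc)
  qed
  \<comment> \<open>the normalizing constants of the two factors cancel\<close>
  have fac: "((x / a - 1) / (x / b - 1)) * ((y / b - 1) / (y / a - 1)) = ((x - a) / (x - b)) * ((y - b) / (y - a))"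
    if "a \<noteq> 0" "b \<noteq> 0" for x y a b :: real
  proof -
    have "x / a - 1 = (x - a) / a" "x / b - 1 = (x - b) / b" "y / a - 1 = (y - a) / a" "y / b - 1 = (y - b) / b"
      using that by (auto simp: diff_divide_distrib)
    then show ?thesis using that by simp
  qed
  have main: "(F x * s) * real_kernel A x y * (F y * t) = F x * real_kernel A x y * F y - (F x * A x * ((a - b) / (x - b)) / (F a * A a)) * (F a * real_kernel A a y * F y)"
    if st: "s * t = ((x - a) / (x - b)) * ((y - b) / (y - a))" and "x * y < 0" "a * y < 0" "x \<noteq> b" "y \<noteq> a" "x \<noteq> y" "F a \<noteq> 0" "A a \<noteq> 0"
    for x y a b s t :: real
  proof -
    have "(F x * s) * real_kernel A x y * (F y * t) = F x * F y * A x * A y * ((s * t) / (x - y))"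
      unfolding real_kernel_opposite_sign[OF \<open>x * y < 0\<close>] by (simp add: mult_ac)
    also have "(s * t) / (x - y) = 1 / (x - y) - ((a - b) / (x - b)) / (a - y)" unfolding st using core that by simp
    also have "F x * F y * A x * A y * \<dots> = F x * (A x * A y / (x - y)) * F y - (F x * A x * ((a - b) / (x - b)) / (F a * A a)) * (F a * (A a * A y / (a - y)) * F y)"
    proof -
      have "f * f' * c * c' * (1 / d - w / d') = f * (c * c' / d) * f' - (f * c * w / (g * g')) * (g * (g' * c' / d') * f')"
        if "g \<noteq> 0" "g' \<noteq> 0" for f f' c c' d d' w g g' :: real
        using that by (simp add: right_diff_distrib mult_ac)
      then show ?thesis using that by blast
    qed
    finally show ?thesis using that by (simp add: real_kernel_opposite_sign)
  qed
  consider "x > 0" | "x < 0" using x by (auto simp: Rstar_def neq_iff)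
  then show ?thesis
  proof cases
    case 1
    show ?thesis
    proof (rule exI[of _ "F x * A x * ((a - b) / (x - b)) / (F a * A a)"], rule exI[of _ a], intro conjI ballI)
      fix y assume "y \<in> Rstar"
      show "(F x * pair_factor a b x) * real_kernel A x y * (F y * pair_factor a b y) =
        F x * real_kernel A x y * F y - (F x * A x * ((a - b) / (x - b)) / (F a * A a)) * (F a * real_kernel A a y * F y)"
      proof (cases "y < 0")
        case True
        have "pair_factor a b x * pair_factor a b y = ((x - a) / (x - b)) * ((y - b) / (y - a))"
          unfolding pair_factor_pos[OF 1] pair_factor_neg[OF True] by (rule fac) (use a b in auto)
        then show ?thesis
          by (rule main) (use True 1 a b Fa in \<open>auto simp: mult_less_0_iff\<close>)
      next
        case False
        then show ?thesis using 1 a by (simp add: real_kernel_same_sign)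
      qed
    qed auto
  next
    case 2
    show ?thesis
    proof (rule exI[of _ "F x * A x * ((b - a) / (x - a)) / (F b * A b)"], rule exI[of _ b], intro conjI ballI)
      fix y assume "y \<in> Rstar"
      show "(F x * pair_factor a b x) * real_kernel A x y * (F y * pair_factor a b y) =
        F x * real_kernel A x y * F y - (F x * A x * ((b - a) / (x - a)) / (F b * A b)) * (F b * real_kernel A b y * F y)"
      proof (cases "y > 0")
        case True
        have "pair_factor a b x * pair_factor a b y = ((x - b) / (x - a)) * ((y - a) / (y - b))"
          unfolding pair_factor_pos[OF True] pair_factor_neg[OF 2] by (rule fac) (use a b in auto)
        then show ?thesis
          by (rule main) (use True 2 a b Fb in \<open>auto simp: mult_less_0_iff\<close>)
      next
        case False
        then show ?thesis using 2 b by (simp add: real_kernel_same_sign mult_nonpos_nonpos)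
      qed
    qed auto
  qed
qed

definition row_combination :: "(real \<Rightarrow> real) \<Rightarrow> real set \<Rightarrow> (real \<Rightarrow> real) \<Rightarrow> bool" where
  "row_combination A P g \<longleftrightarrow> (\<exists>c. \<forall>y\<in>Rstar. g y = (\<Sum>z\<in>P. c z * real_kernel A z y))"

lemma row_combination_row:
  assumes "finite P" "z \<in> P" shows "row_combination A P (real_kernel A z)"
  unfolding row_combination_def
  by (rule exI[of _ "\<lambda>w. if w = z then 1 else 0"]) (use assms in \<open>simp add: if_distrib if_distribR cong: if_cong\<close>)

lemma row_combination_mono:
  assumes "row_combination A P g" "P \<subseteq> P'" "finite P'" shows "row_combination A P' g"
proof -
  obtain c where c: "g y = (\<Sum>z\<in>P. c z * real_kernel A z y)" if "y \<in> Rstar" for y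
    using assms(1) by (auto simp: row_combination_def)
  have "(\<Sum>z\<in>P'. (if z \<in> P then c z else 0) * real_kernel A z y) = (\<Sum>z\<in>P. c z * real_kernel A z y)" for y
    by (rule sum.mono_neutral_cong_right) (use assms in auto)
  then show ?thesis unfolding row_combination_def
    using c by (intro exI[of _ "\<lambda>z. if z \<in> P then c z else 0"]) auto
qed

lemma row_combination_lin:
  assumes "row_combination A P g" "row_combination A P g'"
  shows "row_combination A P (\<lambda>y. r * g y + s * g' y)"
proof -
  obtain c where c: "g y = (\<Sum>z\<in>P. c z * real_kernel A z y)" if "y \<in> Rstar" for y
    using assms(1) by (auto simp: row_combination_def)
  obtain c' where c': "g' y = (\<Sum>z\<in>P. c' z * real_kernel A z y)" if "y \<in> Rstar" for y
    using assms(2) by (auto simp: row_combination_def)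
  show ?thesis unfolding row_combination_def
    using c c' by (intro exI[of _ "\<lambda>z. r * c z + s * c' z"])
      (auto simp: sum_distrib_left distrib_right sum.distrib mult.assoc)
qed

lemma row_combination_cong:
  "row_combination A P g \<Longrightarrow> (\<And>y. y \<in> Rstar \<Longrightarrow> g y = g' y) \<Longrightarrow> row_combination A P g'"
  by (auto simp: row_combination_def)

text \<open>
  The pairs are included one after the other: \<open>F x L(x, y) F y\<close> is again a kernel of Cauchy type, with
  \<open>A\<close> multiplied by \<open>F\<close>, and \<open>F\<close> does not vanish at the points of the next pair. The new row that
  appears, of the multiplied kernel, is itself a combination of rows of \<open>L\<close> by the induction hypothesis.
\<close>
lemma partial_fraction_product:
  fixes n :: nat
  assumes ab: "\<forall>i<n. a i > 0" "\<forall>i<n. b i < 0" and inj: "inj_on a {..<n}" "inj_on b {..<n}"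
    and A: "\<forall>i<n. A (a i) \<noteq> 0" "\<forall>i<n. A (b i) \<noteq> 0" and x: "x \<in> Rstar"
  shows "row_combination A (a ` {..<n} \<union> b ` {..<n}) (\<lambda>y. real_kernel A x y -
     (\<Prod>i<n. pair_factor (a i) (b i) x) * real_kernel A x y * (\<Prod>i<n. pair_factor (a i) (b i) y))"
  using assms
proof (induction n arbitrary: x)
  case 0
  then show ?case by (simp add: row_combination_def)
next
  case (Suc n)
  define F where "F x = (\<Prod>i<n. pair_factor (a i) (b i) x)" for x
  define P where "P = a ` {..<n} \<union> b ` {..<n}"
  define P' where "P' = a ` {..<Suc n} \<union> b ` {..<Suc n}"
  have P: "P \<subseteq> P'" "finite P'" "a n \<in> P'" "b n \<in> P'" by (auto simp: P_def P'_def)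
  have IH: "row_combination A P' (\<lambda>y. real_kernel A x y - F x * real_kernel A x y * F y)" if "x \<in> Rstar" for x
  proof (rule row_combination_mono[OF _ P(1,2)])
    show "row_combination A P (\<lambda>y. real_kernel A x y - F x * real_kernel A x y * F y)"
      unfolding F_def P_def
      by (rule Suc.IH) (use Suc.prems that in \<open>auto intro: inj_on_subset\<close>)
  qed
  have abn: "a n > 0" "b n < 0" "A (a n) \<noteq> 0" "A (b n) \<noteq> 0" using Suc.prems by auto
  have F: "F (a n) \<noteq> 0" "F (b n) \<noteq> 0"
  proof -
    have "a n \<noteq> a i" "b n \<noteq> b i" if "i < n" for i
      using inj_onD[OF Suc.prems(3), of n i] inj_onD[OF Suc.prems(4), of n i] that by auto
    moreover have "a n \<noteq> b i" "b n \<noteq> a i" if "i < n" for i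
      using Suc.prems(1,2) that by (metis less_Suc_eq less_asym)+
    ultimately have "pair_factor (a i) (b i) (a n) \<noteq> 0" "pair_factor (a i) (b i) (b n) \<noteq> 0" if "i < n" for i
      using that abn Suc.prems(1,2) by (intro pair_factor_nonzero; force simp: Rstar_def)+
    then show "F (a n) \<noteq> 0" "F (b n) \<noteq> 0"
      unfolding F_def by auto
  qed
  obtain c z where cz: "z \<in> {a n, b n}"
    "\<And>y. y \<in> Rstar \<Longrightarrow> (F x * pair_factor (a n) (b n) x) * real_kernel A x y * (F y * pair_factor (a n) (b n) y) =
     F x * real_kernel A x y * F y - c * (F z * real_kernel A z y * F y)"
    using pair_factor_partial_fraction[OF abn(1,2) Suc.prems(7) F(1) abn(3) F(2) abn(4)] by blast
  have zR: "z \<in> Rstar" "z \<in> P'" using cz(1) abn P by (auto simp: Rstar_def)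
  have "row_combination A P' (\<lambda>y. 1 * (real_kernel A x y - F x * real_kernel A x y * F y) +
      1 * (c * real_kernel A z y + (- c) * (real_kernel A z y - F z * real_kernel A z y * F y)))"
    by (intro row_combination_lin IH Suc.prems zR row_combination_row P)
  then show ?case unfolding P'_def[symmetric]
  proof (rule row_combination_cong)
    fix y assume "y \<in> Rstar"
    from cz(2)[OF this]
    show "1 * (real_kernel A x y - F x * real_kernel A x y * F y) +
      1 * (c * real_kernel A z y + (- c) * (real_kernel A z y - F z * real_kernel A z y * F y)) =
      real_kernel A x y - (\<Prod>i<Suc n. pair_factor (a i) (b i) x) * real_kernel A x y * (\<Prod>i<Suc n. pair_factor (a i) (b i) y)"
      by (simp add: F_def algebra_simps)
  qed
qed

lemma f_Palm_partial_fractions: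
  assumes p: "\<And>i. i < n \<Longrightarrow> p i > 0 \<and> p (n + i) < 0" and inj: "inj_on p {..<2 * n}"
    and A: "\<And>i. i < 2 * n \<Longrightarrow> A (p i) \<noteq> 0" and x: "x \<in> Rstar"
  shows "\<exists>c. \<forall>y\<in>Rstar. complex_of_real (f_Palm n p x) * L_kernel A x y * complex_of_real (f_Palm n p y)
     = L_kernel A x y - (\<Sum>j<2 * n. c j * L_kernel A (p j) y)"
proof -
  have P: "p ` {..<n} \<union> (\<lambda>i. p (n + i)) ` {..<n} = p ` {..<2 * n}"
  proof -
    have "{..<2 * n} = {..<n} \<union> (+) n ` {..<n}"
      unfolding lessThan_atLeast0 image_add_atLeastLessThan by auto
    then show ?thesis by (simp add: image_Un image_image)
  qed
  have i: "inj_on p {..<n}" "inj_on (\<lambda>i. p (n + i)) {..<n}"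
    using inj by (auto intro!: inj_onI dest: inj_onD)
  have "row_combination A (p ` {..<2 * n}) (\<lambda>y. real_kernel A x y - f_Palm n p x * real_kernel A x y * f_Palm n p y)"
    using partial_fraction_product[of n p "\<lambda>i. p (n + i)" A x] p A x i
    by (simp add: f_Palm_pair_factor P)
  then obtain c where c: "real_kernel A x y - f_Palm n p x * real_kernel A x y * f_Palm n p y = (\<Sum>z\<in>p ` {..<2 * n}. c z * real_kernel A z y)"
    if "y \<in> Rstar" for y by (auto simp: row_combination_def)
  have "complex_of_real (f_Palm n p x) * L_kernel A x y * complex_of_real (f_Palm n p y)
     = L_kernel A x y - (\<Sum>j<2 * n. complex_of_real (c (p j)) * L_kernel A (p j) y)" if "y \<in> Rstar" for y
  proof -
    have "f_Palm n p x * real_kernel A x y * f_Palm n p y = real_kernel A x y - (\<Sum>j<2 * n. c (p j) * real_kernel A (p j) y)"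
      using c[OF that] by (simp add: sum.reindex[OF inj])
    from arg_cong[OF this, of complex_of_real] show ?thesis by (simp add: L_kernel_real_kernel)
  qed
  then show ?thesis by (intro exI[of _ "\<lambda>j. complex_of_real (c (p j))"]) auto
qed

lemma f_Palm_bounded:
  assumes p: "\<And>i. i < n \<Longrightarrow> p i > 0 \<and> p (n + i) < 0"
  shows "\<exists>C. \<forall>x\<in>Rstar. \<bar>f_Palm n p x\<bar> \<le> C"
proof (intro exI ballI)
  fix x assume x: "x \<in> Rstar"
  show "\<bar>f_Palm n p x\<bar> \<le> (\<Prod>i<n. 1 + \<bar>p (n + i)\<bar> / p i + p i / \<bar>p (n + i)\<bar>)"
    unfolding f_Palm_pair_factor abs_prod by (intro prod_mono conjI pair_factor_bounded x) (use p in auto)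
qed

lemma f_Palm_zero:
  assumes p: "\<And>i. i < n \<Longrightarrow> p i > 0 \<and> p (n + i) < 0" and i: "i < 2 * n"
  shows "f_Palm n p (p i) = 0"
proof (cases "i < n")
  case True
  then show ?thesis unfolding f_Palm_pair_factor
    using p[OF True] pair_factor_zero by (intro prod_zero) auto
next
  case False
  then have "i - n < n" "n + (i - n) = i" using i by auto
  then show ?thesis unfolding f_Palm_pair_factor
    using p[of "i - n"] pair_factor_zero by (intro prod_zero bexI[of _ "i - n"]) auto
qed

lemma f_Palm_measurable: "f_Palm n p \<in> borel_measurable leb_Rstar"
  unfolding f_Palm_pair_factor[abs_def] by (intro borel_measurable_leb_Rstar) measurable

section \<open>Determinants\<close>

lemma kernel_det_not_inj:
  assumes "\<not> inj_on q {..<k}"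
  shows "kernel_det K k q = 0"
proof -
  obtain i j where ij: "i < k" "j < k" "i \<noteq> j" "q i = q j"
    using assms by (auto simp: inj_on_def)
  show ?thesis unfolding kernel_det_def
    by (rule det_identical_rows[OF _ ij(3,1,2)]) (use ij in \<open>auto intro!: eq_vecI\<close>)
qed

lemma kernel_det_zero_row:
  assumes "i < k" "\<And>j. j < k \<Longrightarrow> K (q i) (q j) = 0"
  shows "kernel_det K k q = 0"
proof -
  have "(\<Prod>l = 0..<k. mat k k (\<lambda>(i, j). K (q i) (q j)) $$ (l, s l)) = 0" if "s permutes {0..<k}" for s
  proof (rule prod_zero)
    have "s i < k" using permutes_in_image[OF that, of i] assms(1) by simp
    then show "\<exists>l\<in>{0..<k}. mat k k (\<lambda>(i, j). K (q i) (q j)) $$ (l, s l) = 0"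
      using assms by (intro bexI[of _ i]) auto
  qed simp
  then show ?thesis
    unfolding kernel_det_def by (subst det_def'[where n = k]) (auto intro!: sum.neutral)
qed

lemma kernel_det_left_inverse:
  assumes "kernel_det K m p \<noteq> 0"
  shows "\<exists>N. \<forall>i<m. \<forall>j<m. (\<Sum>a<m. N i a * K (p a) (p j)) = (if i = j then 1 else 0)"
proof -
  define P where "P = mat m m (\<lambda>(i, j). K (p i) (p j))"
  have P: "P \<in> carrier_mat m m" by (simp add: P_def)
  have d: "det P \<noteq> 0" using assms by (simp add: P_def kernel_det_def)
  note adj = adj_mat[OF P]
  have "(\<Sum>a<m. adj_mat P $$ (i, a) / det P * K (p a) (p j)) = (if i = j then 1 else 0)" if "i < m" "j < m" for i j
  proof -
    have "(adj_mat P * P) $$ (i, j) = (\<Sum>a<m. adj_mat P $$ (i, a) * K (p a) (p j))"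
      using that adj(1) by (simp add: P_def scalar_prod_def atLeast0LessThan)
    moreover have "(adj_mat P * P) $$ (i, j) = det P * (if i = j then 1 else 0)"
      unfolding adj(3) using that by simp
    ultimately have "(\<Sum>a<m. adj_mat P $$ (i, a) * K (p a) (p j)) = det P * (if i = j then 1 else 0)" by (rule trans[OF sym])
    then show ?thesis using d by (simp add: sum_divide_distrib[symmetric])
  qed
  then show ?thesis by (intro exI[of _ "\<lambda>i a. adj_mat P $$ (i, a) / det P"]) blast
qed

definition join_tuples :: "nat \<Rightarrow> nat \<Rightarrow> (nat \<Rightarrow> real) \<Rightarrow> (nat \<Rightarrow> real) \<Rightarrow> nat \<Rightarrow> real" where
  "join_tuples m k p q = (\<lambda>i\<in>{..<m + k}. if i < m then p i else q (i - m))"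

text \<open>
  The Schur complement formula, from the factorization of the joint matrix into block triangular
  matrices. The coefficients \<open>e\<close> eliminate the entries of the lower left block.
\<close>
lemma kernel_det_join:
  assumes e: "\<And>i j. i < k \<Longrightarrow> j < m \<Longrightarrow> K (q i) (p j) = (\<Sum>a<m. e a (q i) * K (p a) (p j))"
    and K': "\<And>x y. K' x y = K x y - (\<Sum>a<m. e a x * K (p a) y)"
  shows "kernel_det K (m + k) (join_tuples m k p q) = kernel_det K m p * kernel_det K' k q"
proof -
  define P where "P = mat m m (\<lambda>(i, j). K (p i) (p j))"
  define B where "B = mat m k (\<lambda>(i, j). K (p i) (q j))"
  define D where "D = mat k k (\<lambda>(i, j). K' (q i) (q j))"
  define X where "X = mat k m (\<lambda>(i, a). e a (q i))"
  have c: "P \<in> carrier_mat m m" "B \<in> carrier_mat m k" "D \<in> carrier_mat k k" "X \<in> carrier_mat k m"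
    by (auto simp: P_def B_def D_def X_def)
  have 1: "1\<^sub>m m * P + 0\<^sub>m m k * 0\<^sub>m k m = P" "1\<^sub>m m * B + 0\<^sub>m m k * D = B"
    using c by auto
  have 2: "X * P + 1\<^sub>m k * 0\<^sub>m k m = mat k m (\<lambda>(i, j). K (q i) (p j))"
    using c by (intro eq_matI) (auto simp: P_def X_def scalar_prod_def atLeast0LessThan e)
  have 3: "X * B + 1\<^sub>m k * D = mat k k (\<lambda>(i, j). K (q i) (q j))"
    using c by (intro eq_matI) (auto simp: B_def D_def X_def K' scalar_prod_def atLeast0LessThan)
  have "mat (m + k) (m + k) (\<lambda>(i, j). K (join_tuples m k p q i) (join_tuples m k p q j))
     = four_block_mat P B (mat k m (\<lambda>(i, j). K (q i) (p j))) (mat k k (\<lambda>(i, j). K (q i) (q j)))"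
    by (intro eq_matI) (auto simp: P_def B_def join_tuples_def)
  also have "\<dots> = four_block_mat (1\<^sub>m m) (0\<^sub>m m k) X (1\<^sub>m k) * four_block_mat P B (0\<^sub>m k m) D"
    using mult_four_block_mat[of "1\<^sub>m m" m m "0\<^sub>m m k" k X k "1\<^sub>m k" P m B k "0\<^sub>m k m" D] c
    by (simp only: 1 2 3 one_carrier_mat zero_carrier_mat)
  finally have "kernel_det K (m + k) (join_tuples m k p q) =
     det (four_block_mat (1\<^sub>m m) (0\<^sub>m m k) X (1\<^sub>m k) * four_block_mat P B (0\<^sub>m k m) D)"
    by (simp add: kernel_det_def)
  also have "\<dots> = det (four_block_mat (1\<^sub>m m) (0\<^sub>m m k) X (1\<^sub>m k)) * det (four_block_mat P B (0\<^sub>m k m) D)"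
    by (rule det_mult) (use c in auto)
  also have "det (four_block_mat (1\<^sub>m m) (0\<^sub>m m k) X (1\<^sub>m k)) = 1"
    using c by (subst det_four_block_mat_upper_right_zero) auto
  also have "det (four_block_mat P B (0\<^sub>m k m) D) = det P * det D"
    using c by (intro det_four_block_mat_lower_left_zero) auto
  finally show ?thesis by (simp add: kernel_det_def P_def D_def)
qed

section \<open>Measures on tuples of distinct points\<close>

lemma space_leb_tuples: "space (leb_tuples k) = {..<k} \<rightarrow>\<^sub>E Rstar"
  by (simp add: leb_tuples_def space_PiM)

lemma sigma_finite_leb_Rstar: "sigma_finite_measure leb_Rstar"
  unfolding leb_Rstar_def
  by (rule sigma_finite_measure_restrict_space) (auto intro: lborel.sigma_finite_measure_axioms)

interpretation leb_Rstar: sigma_finite_measure leb_Rstar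
  by (rule sigma_finite_leb_Rstar)

interpretation leb_Rstar_product: product_sigma_finite "\<lambda>_::nat. leb_Rstar"
  by standard

lemma sigma_finite_leb_tuples: "sigma_finite_measure (leb_tuples k)"
  unfolding leb_tuples_def by (rule leb_Rstar_product.sigma_finite) simp

lemma borel_subset_leb_Rstar: "B \<in> sets borel \<Longrightarrow> B \<subseteq> Rstar \<Longrightarrow> B \<in> sets leb_Rstar"
  by (auto simp: leb_Rstar_def sets_restrict_space image_iff)

lemma rel_compact_subset: "rel_compact_borel B \<Longrightarrow> B \<subseteq> Rstar"
  by (auto simp: rel_compact_borel_def)

lemma rel_compact_sets: "rel_compact_borel B \<Longrightarrow> B \<in> sets leb_Rstar"
  by (intro borel_subset_leb_Rstar) (auto simp: rel_compact_borel_def)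

lemma PiE_rel_compact_sets:
  "(\<And>i. i < k \<Longrightarrow> rel_compact_borel (D i)) \<Longrightarrow> Pi\<^sub>E {..<k} D \<in> sets (leb_tuples k)"
  unfolding leb_tuples_def by (intro sets_PiM_I_finite rel_compact_sets) auto

lemma tuple_component_measurable [measurable]: "i < k \<Longrightarrow> (\<lambda>q. q i) \<in> leb_tuples k \<rightarrow>\<^sub>M leb_Rstar"
  unfolding leb_tuples_def by measurable

lemma id_leb_Rstar_borel: "(\<lambda>x. x) \<in> borel_measurable leb_Rstar"
  by (rule borel_measurable_leb_Rstar) simp

lemma tuple_component_borel: "i < k \<Longrightarrow> (\<lambda>q. q i) \<in> borel_measurable (leb_tuples k)"
  using measurable_compose[OF tuple_component_measurable id_leb_Rstar_borel] by simp

lemma distinct_tuples_sets: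
  assumes F: "closed F"
  shows "{q \<in> space (leb_tuples k). inj_on q {..<k} \<and> (\<forall>i<k. q i \<notin> F)} \<in> sets (leb_tuples k)"
proof -
  have 1: "{q \<in> space (leb_tuples k). q i \<noteq> q j} \<in> sets (leb_tuples k)" if "i < k" "j < k" for i j
    using borel_measurable_neq[OF tuple_component_borel[OF that(1)] tuple_component_borel[OF that(2)]] .
  have 2: "{q \<in> space (leb_tuples k). q i \<notin> F} \<in> sets (leb_tuples k)" if "i < k" for i
  proof -
    have "(\<lambda>q. q i) -` (- F) \<inter> space (leb_tuples k) \<in> sets (leb_tuples k)"
      using F by (intro measurable_sets[OF tuple_component_borel[OF that]]) auto
    then show ?thesis by (auto simp: vimage_def Int_def conj_commute)
  qed
  have "{q \<in> space (leb_tuples k). inj_on q {..<k} \<and> (\<forall>i<k. q i \<notin> F)} =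
     {q \<in> space (leb_tuples k). (\<forall>i\<in>{..<k}. \<forall>j\<in>{..<k}. q i \<noteq> q j \<or> i = j) \<and> (\<forall>i\<in>{..<k}. q i \<notin> F)}"
    by (auto simp: inj_on_def)
  also have "\<dots> \<in> sets (leb_tuples k)"
  proof (intro sets.sets_Collect_conj sets.sets_Collect_finite_All 2 finite_lessThan)
    show "{q \<in> space (leb_tuples k). q i \<noteq> q j \<or> i = j} \<in> sets (leb_tuples k)" if "i \<in> {..<k}" "j \<in> {..<k}" for i j
      using 1[of i j] that by (cases "i = j") auto
  qed auto
  finally show ?thesis .
qed

text \<open>
  A tuple of distinct points lies in a product of disjoint intervals with rational end points. There are
  countably many such products, and they see a tuple measure only off the diagonals.
\<close>
definition rational_open_intervals :: "real set \<Rightarrow> real set set" where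
  "rational_open_intervals F = {{a<..<b} | a b. a \<in> \<rat> \<and> b \<in> \<rat> \<and> {a..b} \<subseteq> Rstar - F}"

definition separated_boxes :: "nat \<Rightarrow> real set \<Rightarrow> (nat \<Rightarrow> real set) set" where
  "separated_boxes k F = {D \<in> {..<k} \<rightarrow>\<^sub>E rational_open_intervals F. disjoint_family_on D {..<k}}"

lemma countable_separated_boxes: "countable (separated_boxes k F)"
proof -
  have "rational_open_intervals F \<subseteq> (\<lambda>(a, b). {a<..<b}) ` (\<rat> \<times> \<rat>)"
    by (auto simp: rational_open_intervals_def)
  then have "countable (rational_open_intervals F)"
    by (rule countable_subset) (auto intro!: countable_rat)
  then have "countable ({..<k} \<rightarrow>\<^sub>E rational_open_intervals F)"
    by (intro countable_PiE) auto
  then show ?thesis by (rule countable_subset[rotated]) (auto simp: separated_boxes_def)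
qed

lemma rational_open_interval_rel_compact: "D \<in> rational_open_intervals F \<Longrightarrow> rel_compact_borel D"
  by (fastforce simp: rational_open_intervals_def rel_compact_borel_def)

lemma rational_open_interval_closure:
  assumes "D \<in> rational_open_intervals F" shows "closure D \<inter> F = {}"
proof -
  obtain a b where D: "D = {a<..<b}" "{a..b} \<subseteq> Rstar - F"
    using assms by (auto simp: rational_open_intervals_def)
  have "closure D \<subseteq> {a..b}" unfolding D(1) by (rule closure_minimal) auto
  then show ?thesis using D(2) by auto
qed

lemma rational_open_intervals_Int:
  assumes "D \<in> rational_open_intervals F" "a \<in> \<rat>" "b \<in> \<rat>"
  shows "D \<inter> {a<..<b} \<in> rational_open_intervals F"
proof -
  obtain c d where D: "D = {c<..<d}" "c \<in> \<rat>" "d \<in> \<rat>" "{c..d} \<subseteq> Rstar - F"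
    using assms(1) by (auto simp: rational_open_intervals_def)
  have "D \<inter> {a<..<b} = {max c a<..<min d b}" "max c a \<in> \<rat>" "min d b \<in> \<rat>" "{max c a..min d b} \<subseteq> {c..d}"
    using D assms by (auto simp: max_def min_def)
  then show ?thesis using D(4) unfolding rational_open_intervals_def by blast
qed

lemma empty_rational_open_interval: "{} \<in> rational_open_intervals F"
proof -
  have "{} = {1<..<(0::real)}" "{1..(0::real)} \<subseteq> Rstar - F" by auto
  then show ?thesis unfolding rational_open_intervals_def by (metis (mono_tags, lifting) Rats_0 Rats_1 mem_Collect_eq)
qed

lemma separated_boxes_nonempty: "separated_boxes k F \<noteq> {}"
proof -
  have "(\<lambda>i\<in>{..<k}. {}) \<in> separated_boxes k F"
    by (auto simp: separated_boxes_def empty_rational_open_interval disjoint_family_on_def)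
  then show ?thesis by blast
qed

lemma separated_boxesD:
  assumes "D \<in> separated_boxes k F"
  shows "i < k \<Longrightarrow> D i \<in> rational_open_intervals F" "i < k \<Longrightarrow> rel_compact_borel (D i)"
    "disjoint_family_on D {..<k}" "Pi\<^sub>E {..<k} D \<in> sets (leb_tuples k)"
  using assms rational_open_interval_rel_compact
  by (auto simp: separated_boxes_def intro!: PiE_rel_compact_sets)

text \<open>Intervals around the entries, shorter than the smallest distance between two entries, are disjoint.\<close>
lemma separated_boxes_cover:
  assumes q: "q \<in> space (leb_tuples k)" "inj_on q {..<k}" "\<forall>i<k. q i \<notin> F" and F: "closed F"
  shows "\<exists>D\<in>separated_boxes k F. q \<in> Pi\<^sub>E {..<k} D"
proof -
  have qR: "q i \<in> Rstar - F" if "i < k" for i using q that by (auto simp: space_leb_tuples)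
  have "open (Rstar - F)" using F by (auto simp: Rstar_def)
  then have "\<exists>e>0. ball (q i) e \<subseteq> Rstar - F" if "i < k" for i
    using qR[OF that] open_contains_ball by blast
  then obtain e where e: "e i > 0" "ball (q i) (e i) \<subseteq> Rstar - F" if "i < k" for i
    by metis
  define U where "U = insert 1 (e ` {..<k} \<union> (\<lambda>(i, j). \<bar>q i - q j\<bar>) ` {(i, j) \<in> {..<k} \<times> {..<k}. i \<noteq> j})"
  have "finite {(i, j) \<in> {..<k} \<times> {..<k}. i \<noteq> j}"
    by (rule finite_subset[of _ "{..<k} \<times> {..<k}"]) auto
  then have U: "finite U" "U \<noteq> {}" "\<forall>u\<in>U. u > 0"
    using e q(2) by (auto simp: U_def inj_on_def)
  define d where "d = Min U"
  have d: "d > 0" "\<And>i. i < k \<Longrightarrow> d \<le> e i" "\<And>i j. i < k \<Longrightarrow> j < k \<Longrightarrow> i \<noteq> j \<Longrightarrow> d \<le> \<bar>q i - q j\<bar>"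
    using U by (auto simp: d_def Min_gr_iff intro!: Min_le) (auto simp: U_def)
  have "\<forall>i. \<exists>a b. a \<in> \<rat> \<and> b \<in> \<rat> \<and> q i - d / 2 < a \<and> a < q i \<and> q i < b \<and> b < q i + d / 2"
    using Rats_dense_in_real[of "q _ - d / 2" "q _"] Rats_dense_in_real[of "q _" "q _ + d / 2"] d(1)
    by (metis diff_less_eq half_gt_zero less_add_same_cancel1)
  then obtain a b where ab: "\<And>i. a i \<in> \<rat> \<and> b i \<in> \<rat> \<and> q i - d / 2 < a i \<and> a i < q i \<and> q i < b i \<and> b i < q i + d / 2"
    by metis
  have "{a i<..<b i} \<in> rational_open_intervals F" if "i < k" for i
  proof -
    have "{a i..b i} \<subseteq> ball (q i) (e i)"
    proof
      fix x assume "x \<in> {a i..b i}"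
      then show "x \<in> ball (q i) (e i)" using ab[of i] d(1) d(2)[OF that] by (simp add: dist_real_def abs_if)
    qed
    then have "{a i..b i} \<subseteq> Rstar - F" using e(2)[OF that] by (rule subset_trans)
    then show ?thesis using ab[of i] unfolding rational_open_intervals_def by blast
  qed
  moreover have "{a i<..<b i} \<inter> {a j<..<b j} = {}" if "i < k" "j < k" "i \<noteq> j" for i j
  proof -
    have False if "x \<in> {a i<..<b i}" "x \<in> {a j<..<b j}" for x
      using that ab[of i] ab[of j] d(3)[OF \<open>i < k\<close> \<open>j < k\<close> \<open>i \<noteq> j\<close>] by (auto simp: abs_if split: if_splits)
    then show ?thesis by blast
  qed
  ultimately have "(\<lambda>i\<in>{..<k}. {a i<..<b i}) \<in> separated_boxes k F"
    by (auto simp: separated_boxes_def disjoint_family_on_def)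
  moreover have "q \<in> Pi\<^sub>E {..<k} (\<lambda>i\<in>{..<k}. {a i<..<b i})"
    using q(1) ab by (auto simp: space_leb_tuples PiE_iff)
  ultimately show ?thesis by blast
qed

lemma sets_leb_Rstar_rational:
  "sets leb_Rstar = sigma_sets Rstar {Rstar \<inter> {a<..<b} | a b. a \<in> \<rat> \<and> b \<in> \<rat>}"
proof -
  define G where "G = (\<lambda>(a, b). {a<..<b :: real}) ` (\<rat> \<times> \<rat>)"
  have gen: "X \<in> sets (sigma UNIV G)" if "X \<in> range lessThan" for X
  proof -
    from that obtain x where X: "X = {..<x}" by auto
    \<comment> \<open>exhaust the half-line by bounded rational intervals\<close>
    have "{..<x} = (\<Union>(a, b)\<in>{(a, b) \<in> \<rat> \<times> \<rat>. b \<le> x}. {a<..<b})"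
    proof (intro equalityI subsetI)
      fix y assume "y \<in> {..<x}"
      then obtain b where b: "b \<in> \<rat>" "y < b" "b < x" using Rats_dense_in_real[of y x] by auto
      obtain a where a: "a \<in> \<rat>" "a < y" using Rats_dense_in_real[of "y - 1" y] by auto
      show "y \<in> (\<Union>(a, b)\<in>{(a, b) \<in> \<rat> \<times> \<rat>. b \<le> x}. {a<..<b})"
        using a b by (auto intro!: bexI[of _ "(a, b)"])
    qed auto
    also have "\<dots> \<in> sets (sigma UNIV G)"
    proof (rule sets.countable_UN')
      show "countable {(a, b) \<in> \<rat> \<times> \<rat>. b \<le> x}"
        by (rule countable_subset[of _ "\<rat> \<times> \<rat>"]) (auto intro!: countable_rat)
    qed (auto simp: G_def)
    finally show ?thesis unfolding X .
  qed
  have "(borel :: real measure) = sigma UNIV G"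
    unfolding G_def by (rule borel_eq_sigmaI1[OF borel_Iio]) (use gen in \<open>auto simp: G_def\<close>)
  then have b: "sets (borel :: real measure) = sigma_sets UNIV G"
    by (metis Pow_UNIV sets_measure_of top_greatest)
  have "sets leb_Rstar = (\<inter>) Rstar ` sigma_sets UNIV G"
    unfolding sets_leb_Rstar sets_restrict_space b ..
  also have "\<dots> = sigma_sets Rstar ((\<inter>) Rstar ` G)"
    by (rule sigma_sets_Int) (auto simp: b[symmetric])
  also have "(\<inter>) Rstar ` G = {Rstar \<inter> {a<..<b} | a b. a \<in> \<rat> \<and> b \<in> \<rat>}"
    by (auto simp: G_def)
  finally show ?thesis .
qed

definition rational_products :: "nat \<Rightarrow> (nat \<Rightarrow> real) set set" where
  "rational_products k = {Pi\<^sub>E {..<k} J | J. \<forall>i<k. \<exists>a\<in>\<rat>. \<exists>b\<in>\<rat>. J i = Rstar \<inter> {a<..<b}}"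

lemma sets_leb_tuples_rational:
  "sets (leb_tuples k) = sigma_sets ({..<k} \<rightarrow>\<^sub>E Rstar) (rational_products k)"
proof -
  define E where "E = {Rstar \<inter> {a<..<b} | a b. a \<in> \<rat> \<and> b \<in> \<rat>}"
  have E: "E \<subseteq> Pow Rstar" by (auto simp: E_def)
  have "sets (leb_tuples k) = sets (PiM {..<k} (\<lambda>_. sigma Rstar E))"
    unfolding leb_tuples_def by (intro sets_PiM_cong) (simp_all add: sets_leb_Rstar_rational sets_measure_of[OF E], simp add: E_def)
  also have "\<dots> = sets (sigma ({..<k} \<rightarrow>\<^sub>E Rstar) {{f \<in> {..<k} \<rightarrow>\<^sub>E Rstar. \<forall>i\<in>j. f i \<in> A i} | A j. j \<in> {{..<k}} \<and> A \<in> Pi j (\<lambda>_. E)})"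
  proof (rule sets_PiM_sigma)
    have "x \<in> \<Union>E" if x: "x \<in> Rstar" for x
    proof -
      obtain a where "a \<in> \<rat>" "a < x" using Rats_dense_in_real[of "x - 1" x] by auto
      moreover obtain b where "b \<in> \<rat>" "x < b" using Rats_dense_in_real[of x "x + 1"] by auto
      ultimately have "Rstar \<inter> {a<..<b} \<in> E" "x \<in> Rstar \<inter> {a<..<b}" using x unfolding E_def by auto
      then show ?thesis by (rule UnionI)
    qed
    then have "Rstar = \<Union>E" using E by blast
    moreover have "countable E"
    proof -
      have "E \<subseteq> (\<lambda>(a, b). Rstar \<inter> {a<..<b}) ` (\<rat> \<times> \<rat>)" by (auto simp: E_def)
      then show ?thesis by (rule countable_subset) (auto intro!: countable_rat)
    qed
    ultimately show "\<exists>S\<subseteq>E. countable S \<and> Rstar = \<Union>S" by blast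
  qed (use E in auto)
  also have "{{f \<in> {..<k} \<rightarrow>\<^sub>E Rstar. \<forall>i\<in>j. f i \<in> A i} | A j. j \<in> {{..<k}} \<and> A \<in> Pi j (\<lambda>_. E)} = rational_products k"
  proof -
    have 1: "{f \<in> {..<k} \<rightarrow>\<^sub>E Rstar. \<forall>i\<in>{..<k}. f i \<in> A i} = Pi\<^sub>E {..<k} A" if A: "A \<in> Pi {..<k} (\<lambda>_. E)" for A
    proof -
      have "A i \<subseteq> Rstar" if "i < k" for i using A E that by auto
      then show ?thesis unfolding set_eq_iff mem_Collect_eq PiE_iff by blast
    qed
    have 2: "A \<in> Pi {..<k} (\<lambda>_. E) \<longleftrightarrow> (\<forall>i<k. \<exists>a\<in>\<rat>. \<exists>b\<in>\<rat>. A i = Rstar \<inter> {a<..<b})" for A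
      unfolding E_def Pi_iff lessThan_iff mem_Collect_eq Bex_def Ball_def by blast
    have "{{f \<in> {..<k} \<rightarrow>\<^sub>E Rstar. \<forall>i\<in>j. f i \<in> A i} | A j. j \<in> {{..<k}} \<and> A \<in> Pi j (\<lambda>_. E)}
      = (\<lambda>A. {f \<in> {..<k} \<rightarrow>\<^sub>E Rstar. \<forall>i\<in>{..<k}. f i \<in> A i}) ` Pi {..<k} (\<lambda>_. E)"
      by auto
    also have "\<dots> = Pi\<^sub>E {..<k} ` Pi {..<k} (\<lambda>_. E)" by (rule image_cong[OF refl 1])
    also have "\<dots> = {Pi\<^sub>E {..<k} J | J. J \<in> Pi {..<k} (\<lambda>_. E)}" by auto
    finally show ?thesis unfolding rational_products_def 2 .
  qed
  finally show ?thesis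
    by (subst (asm) sets_measure_of) (auto simp: rational_products_def PiE_iff)
qed

lemma Int_stable_rational_products: "Int_stable (rational_products k)"
proof (rule Int_stableI)
  fix X Y assume "X \<in> rational_products k" "Y \<in> rational_products k"
  then obtain J H where J: "X = Pi\<^sub>E {..<k} J" "\<forall>i<k. \<exists>a\<in>\<rat>. \<exists>b\<in>\<rat>. J i = Rstar \<inter> {a<..<b}"
    and H: "Y = Pi\<^sub>E {..<k} H" "\<forall>i<k. \<exists>a\<in>\<rat>. \<exists>b\<in>\<rat>. H i = Rstar \<inter> {a<..<b}"
    unfolding rational_products_def by blast
  have "\<exists>a\<in>\<rat>. \<exists>b\<in>\<rat>. J i \<inter> H i = Rstar \<inter> {a<..<b}" if i: "i < k" for i
  proof -
    obtain a b where a: "a \<in> \<rat>" "b \<in> \<rat>" "J i = Rstar \<inter> {a<..<b}" using J i by blast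
    obtain c d where c: "c \<in> \<rat>" "d \<in> \<rat>" "H i = Rstar \<inter> {c<..<d}" using H i by blast
    have "max a c \<in> \<rat>" "min b d \<in> \<rat>" "J i \<inter> H i = Rstar \<inter> {max a c<..<min b d}"
      using a c by (auto simp: max_def min_def)
    then show ?thesis by blast
  qed
  then show "X \<inter> Y \<in> rational_products k"
    unfolding J(1) H(1) PiE_Int rational_products_def by blast
qed

text \<open>
  A measure on tuples of distinct points is determined by its values on products of disjoint
  rational intervals. The statement is about a family of measures integrated against \<open>Q\<close>,
  so that the number of distinct tuples of a random configuration in a Borel set can be averaged
  without forming the average as a measure first; measurability in \<open>x\<close> is carried through the
  induction. A single measure is the case of a one-point space.

  Inside one product of disjoint intervals the products of smaller intervals are closed under
  intersection, and Dynkin's theorem applies. Countably many such products, made disjoint, cover the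
  tuples of distinct points which avoid \<open>F\<close>.
\<close>
lemma tuple_measure_determined:
  fixes c :: "'x \<Rightarrow> (nat \<Rightarrow> real) measure"
  assumes F: "closed F"
    and sets_c: "\<And>x. x \<in> space Q \<Longrightarrow> sets (c x) = sets (leb_tuples k)"
    and sets_N: "sets N = sets (leb_tuples k)"
    and meas: "\<And>D. D \<in> separated_boxes k F \<Longrightarrow> (\<lambda>x. emeasure (c x) (Pi\<^sub>E {..<k} D)) \<in> borel_measurable Q"
    and eq: "\<And>D. D \<in> separated_boxes k F \<Longrightarrow> (\<integral>\<^sup>+x. emeasure (c x) (Pi\<^sub>E {..<k} D) \<partial>Q) = emeasure N (Pi\<^sub>E {..<k} D)"
    and fin: "\<And>D. D \<in> separated_boxes k F \<Longrightarrow> emeasure N (Pi\<^sub>E {..<k} D) < \<infinity>"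
    and fin_c: "\<And>D x. D \<in> separated_boxes k F \<Longrightarrow> x \<in> space Q \<Longrightarrow> emeasure (c x) (Pi\<^sub>E {..<k} D) < \<infinity>"
    and B: "B \<in> sets (leb_tuples k)" "\<And>q. q \<in> B \<Longrightarrow> inj_on q {..<k} \<and> (\<forall>i<k. q i \<notin> F)"
  shows "(\<integral>\<^sup>+x. emeasure (c x) B \<partial>Q) = emeasure N B"
proof -
  define good where "good B \<longleftrightarrow> (\<lambda>x. emeasure (c x) B) \<in> borel_measurable Q \<and> (\<integral>\<^sup>+x. emeasure (c x) B \<partial>Q) = emeasure N B" for B
  have good_UN: "good (\<Union>i. A i)" if A: "disjoint_family A" "range A \<subseteq> sets (leb_tuples k)" "\<And>i::nat. good (A i)" for A
  proof -
    have s: "emeasure (c x) (\<Union>i. A i) = (\<Sum>i. emeasure (c x) (A i))" if "x \<in> space Q" for x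
      by (rule suminf_emeasure[symmetric]) (use A sets_c[OF that] in auto)
    have sN: "emeasure N (\<Union>i. A i) = (\<Sum>i. emeasure N (A i))"
      by (rule suminf_emeasure[symmetric]) (use A sets_N in auto)
    have [measurable]: "(\<lambda>x. emeasure (c x) (A i)) \<in> borel_measurable Q" for i
      using A(3) by (simp add: good_def)
    have "(\<lambda>x. \<Sum>i. emeasure (c x) (A i)) \<in> borel_measurable Q" by measurable
    then have m: "(\<lambda>x. emeasure (c x) (\<Union>i. A i)) \<in> borel_measurable Q"
      by (subst measurable_cong[OF s]) auto
    have "(\<integral>\<^sup>+x. emeasure (c x) (\<Union>i. A i) \<partial>Q) = (\<integral>\<^sup>+x. (\<Sum>i. emeasure (c x) (A i)) \<partial>Q)"
      by (rule nn_integral_cong) (rule s)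
    also have "\<dots> = (\<Sum>i. \<integral>\<^sup>+x. emeasure (c x) (A i) \<partial>Q)"
      by (rule nn_integral_suminf) measurable
    also have "\<dots> = emeasure N (\<Union>i. A i)" using A(3) by (simp add: good_def sN)
    finally show ?thesis using m by (simp add: good_def)
  qed
  have inbox: "good (C \<inter> Pi\<^sub>E {..<k} D)" if D: "D \<in> separated_boxes k F" and C: "C \<in> sets (leb_tuples k)" for C D
  proof -
    let ?\<Omega> = "{..<k} \<rightarrow>\<^sub>E Rstar"
    have sub: "rational_products k \<subseteq> Pow ?\<Omega>"
    proof
      fix X assume "X \<in> rational_products k"
      then obtain J where J: "X = Pi\<^sub>E {..<k} J" "\<forall>i<k. \<exists>a\<in>\<rat>. \<exists>b\<in>\<rat>. J i = Rstar \<inter> {a<..<b}"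
        unfolding rational_products_def by blast
      then have "J i \<subseteq> Rstar" if "i < k" for i using that by blast
      then show "X \<in> Pow ?\<Omega>" unfolding J(1) by (auto simp: PiE_iff)
    qed
    note Dset = separated_boxesD[OF D]
    have goodD: "good (Pi\<^sub>E {..<k} D)" using meas[OF D] eq[OF D] by (simp add: good_def)
    have "C \<in> sigma_sets ?\<Omega> (rational_products k)" using C by (simp add: sets_leb_tuples_rational)
    with Int_stable_rational_products sub show ?thesis
    proof (induction rule: sigma_sets_induct_disjoint)
      case (basic X)
      then obtain J where J: "X = Pi\<^sub>E {..<k} J" "\<forall>i<k. \<exists>a\<in>\<rat>. \<exists>b\<in>\<rat>. J i = Rstar \<inter> {a<..<b}"
        unfolding rational_products_def by blast
      define D' where "D' = (\<lambda>i\<in>{..<k}. J i \<inter> D i)"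
      have "D' i \<in> rational_open_intervals F" if i: "i < k" for i
      proof -
        obtain a b where a: "a \<in> \<rat>" "b \<in> \<rat>" "J i = Rstar \<inter> {a<..<b}" using J i by blast
        then have "D' i = D i \<inter> {a<..<b}" using i rel_compact_subset[OF Dset(2)[OF i]] by (auto simp: D'_def)
        then show ?thesis using rational_open_intervals_Int[OF Dset(1)[OF i] a(1,2)] by simp
      qed
      moreover have "disjoint_family_on D' {..<k}"
        using Dset(3) by (auto simp: disjoint_family_on_def D'_def)
      ultimately have D': "D' \<in> separated_boxes k F" by (auto simp: separated_boxes_def D'_def)
      have "X \<inter> Pi\<^sub>E {..<k} D = Pi\<^sub>E {..<k} D'"
        unfolding J(1) PiE_Int D'_def by (intro PiE_cong) auto
      then show ?case using meas[OF D'] eq[OF D'] by (simp add: good_def)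
    next
      case empty
      then show ?case by (simp add: good_def)
    next
      case (compl X)
      have X: "X \<in> sets (leb_tuples k)" using compl by (simp add: sets_leb_tuples_rational)
      define Y where "Y = X \<inter> Pi\<^sub>E {..<k} D"
      have Y: "Y \<subseteq> Pi\<^sub>E {..<k} D" "Y \<in> sets (leb_tuples k)" "good Y" using X Dset(4) compl by (auto simp: Y_def)
      have sub': "Pi\<^sub>E {..<k} D \<subseteq> ?\<Omega>" using rel_compact_subset[OF Dset(2)] by (auto simp: PiE_iff)
      have eqY: "(?\<Omega> - X) \<inter> Pi\<^sub>E {..<k} D = Pi\<^sub>E {..<k} D - Y" using sub' by (auto simp: Y_def)
      have le: "emeasure (c x) Y \<le> emeasure (c x) (Pi\<^sub>E {..<k} D)" if "x \<in> space Q" for x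
        by (rule emeasure_mono) (use Y(1) Dset(4) sets_c[OF that] in auto)
      have d: "emeasure (c x) (Pi\<^sub>E {..<k} D - Y) = emeasure (c x) (Pi\<^sub>E {..<k} D) - emeasure (c x) Y" if "x \<in> space Q" for x
        by (rule emeasure_Diff) (use le[OF that] fin_c[OF D that] Y Dset(4) sets_c[OF that] in \<open>auto simp: top.not_eq_extremum\<close>)
      have leN: "emeasure N Y \<le> emeasure N (Pi\<^sub>E {..<k} D)"
        by (rule emeasure_mono) (use Y(1) Dset(4) sets_N in auto)
      then have finN: "emeasure N Y < \<infinity>" using fin[OF D] by simp
      have dN: "emeasure N (Pi\<^sub>E {..<k} D - Y) = emeasure N (Pi\<^sub>E {..<k} D) - emeasure N Y"
        by (rule emeasure_Diff) (use finN Y Dset(4) sets_N in auto)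
      have m1: "(\<lambda>x. emeasure (c x) (Pi\<^sub>E {..<k} D)) \<in> borel_measurable Q" "(\<lambda>x. emeasure (c x) Y) \<in> borel_measurable Q"
        using goodD Y(3) by (auto simp: good_def)
      have "(\<lambda>x. emeasure (c x) (Pi\<^sub>E {..<k} D) - emeasure (c x) Y) \<in> borel_measurable Q"
        using m1 by measurable
      then have m: "(\<lambda>x. emeasure (c x) (Pi\<^sub>E {..<k} D - Y)) \<in> borel_measurable Q"
        by (subst measurable_cong[OF d]) auto
      have "(\<integral>\<^sup>+x. emeasure (c x) (Pi\<^sub>E {..<k} D - Y) \<partial>Q) = (\<integral>\<^sup>+x. emeasure (c x) (Pi\<^sub>E {..<k} D) - emeasure (c x) Y \<partial>Q)"
        by (rule nn_integral_cong) (rule d)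
      also have "\<dots> = (\<integral>\<^sup>+x. emeasure (c x) (Pi\<^sub>E {..<k} D) \<partial>Q) - (\<integral>\<^sup>+x. emeasure (c x) Y \<partial>Q)"
        by (rule nn_integral_diff[OF m1]) (use Y(3) finN le in \<open>auto simp: good_def intro: AE_I2\<close>)
      also have "\<dots> = emeasure N (Pi\<^sub>E {..<k} D - Y)" using goodD Y(3) by (simp add: good_def dN)
      finally show ?case unfolding eqY using m by (simp add: good_def)
    next
      case (union A)
      have "good (\<Union>i. A i \<inter> Pi\<^sub>E {..<k} D)"
      proof (rule good_UN)
        show "disjoint_family (\<lambda>i. A i \<inter> Pi\<^sub>E {..<k} D)" using union(1) by (auto simp: disjoint_family_on_def)
        show "range (\<lambda>i. A i \<inter> Pi\<^sub>E {..<k} D) \<subseteq> sets (leb_tuples k)"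
          using union(2) Dset(4) by (auto simp: sets_leb_tuples_rational[symmetric])
        show "good (A i \<inter> Pi\<^sub>E {..<k} D)" for i by (rule union)
      qed
      then show ?case by simp
    qed
  qed
  define E where "E n = Pi\<^sub>E {..<k} (from_nat_into (separated_boxes k F) n)" for n
  have E: "from_nat_into (separated_boxes k F) n \<in> separated_boxes k F" for n
    by (rule from_nat_into[OF separated_boxes_nonempty])
  have Es: "E n \<in> sets (leb_tuples k)" for n unfolding E_def by (rule separated_boxesD(4)[OF E])
  have dis: "disjointed E n \<in> sets (leb_tuples k)" for n
    using sets.range_disjointed_sets[of E "leb_tuples k"] Es by auto
  have "B \<subseteq> (\<Union>n. E n)"
  proof
    fix q assume q: "q \<in> B"
    then have "q \<in> space (leb_tuples k)" using B(1) sets.sets_into_space by blast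
    then obtain D where D: "D \<in> separated_boxes k F" "q \<in> Pi\<^sub>E {..<k} D"
      using separated_boxes_cover[of q k F] B(2)[OF q] F by blast
    obtain n where "from_nat_into (separated_boxes k F) n = D"
      using from_nat_into_surj[OF countable_separated_boxes D(1)] by blast
    then show "q \<in> (\<Union>n. E n)" using D(2) by (auto simp: E_def)
  qed
  then have "B = (\<Union>n. B \<inter> disjointed E n)" using UN_disjointed_eq[of E] by auto
  moreover have "good (\<Union>n. B \<inter> disjointed E n)"
  proof (rule good_UN)
    show "disjoint_family (\<lambda>n. B \<inter> disjointed E n)"
      using disjoint_family_disjointed[of E] by (auto simp: disjoint_family_on_def)
    show "range (\<lambda>n. B \<inter> disjointed E n) \<subseteq> sets (leb_tuples k)" using B(1) dis by auto
    show "good (B \<inter> disjointed E n)" for n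
    proof -
      have "good ((B \<inter> disjointed E n) \<inter> E n)"
        unfolding E_def[of n] by (rule inbox[OF E]) (use B(1) dis in auto)
      then show ?thesis using disjointed_subset[of E n] by (simp add: Int_absorb2 Int_assoc)
    qed
  qed
  ultimately show ?thesis by (simp add: good_def)
qed

section \<open>Counting distinct tuples of a configuration\<close>

definition distinct_tuples :: "nat \<Rightarrow> real set \<Rightarrow> (nat \<Rightarrow> real) set" where
  "distinct_tuples k X = {q \<in> {..<k} \<rightarrow>\<^sub>E X. inj_on q {..<k}}"

text \<open>Pushing the counting measure forward by the identity restricts it to the Borel structure on tuples.\<close>
definition tuple_count :: "nat \<Rightarrow> real set \<Rightarrow> (nat \<Rightarrow> real) measure" where
  "tuple_count k X = distr (count_space (distinct_tuples k X)) (leb_tuples k) (\<lambda>q. q)"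

lemma space_conf_space: "space conf_space = Conf"
  unfolding conf_space_def by (rule space_measure_of) auto

lemma sets_tuple_count: "sets (tuple_count k X) = sets (leb_tuples k)"
  by (simp add: tuple_count_def)

lemma emeasure_tuple_count:
  assumes "X \<in> Conf" "B \<in> sets (leb_tuples k)"
  shows "emeasure (tuple_count k X) B = emeasure (count_space (distinct_tuples k X)) (B \<inter> distinct_tuples k X)"
proof -
  have "X \<subseteq> Rstar" using assms(1) by (simp add: Conf_def)
  then have "({..<k} \<rightarrow>\<^sub>E X) \<subseteq> ({..<k} \<rightarrow>\<^sub>E Rstar)" by (intro PiE_mono)
  then have "distinct_tuples k X \<subseteq> space (leb_tuples k)"
    unfolding distinct_tuples_def space_leb_tuples by blast
  then show ?thesis
    unfolding tuple_count_def using assms(2) by (subst emeasure_distr) auto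
qed

lemma card_conf_measurable:
  assumes "rel_compact_borel D"
  shows "(\<lambda>X. of_nat (card (X \<inter> D)) :: ennreal) \<in> borel_measurable conf_space"
proof -
  have "(\<lambda>X. card (X \<inter> D)) \<in> conf_space \<rightarrow>\<^sub>M count_space UNIV"
  proof (subst measurable_count_space_eq2_countable, intro conjI ballI)
    fix m :: nat
    have "{X \<in> Conf. card (X \<inter> D) = m} \<in> sets conf_space"
      unfolding conf_space_def using assms by (subst sets_measure_of) auto
    then show "(\<lambda>X. card (X \<inter> D)) -` {m} \<inter> space conf_space \<in> sets conf_space"
      by (simp add: space_conf_space vimage_def Int_def conj_commute)
  qed auto
  then show ?thesis by measurable
qed

lemma finite_conf_rel_compact:
  assumes "X \<in> Conf" "rel_compact_borel D" shows "finite (X \<inter> D)"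
proof -
  obtain C where C: "compact C" "C \<subseteq> Rstar" "D \<subseteq> C" using assms(2) by (auto simp: rel_compact_borel_def)
  then have "finite (X \<inter> C)" using assms(1) by (auto simp: Conf_def)
  then show ?thesis by (rule finite_subset[rotated]) (use C in auto)
qed

text \<open>For disjoint sets the injectivity of a tuple is automatic.\<close>
lemma tuple_count_box:
  assumes X: "X \<in> Conf" and D: "\<And>i. i < k \<Longrightarrow> rel_compact_borel (D i)" "disjoint_family_on D {..<k}"
  shows "emeasure (tuple_count k X) (Pi\<^sub>E {..<k} D) = (\<Prod>i<k. of_nat (card (X \<inter> D i)))"
proof -
  have eq: "Pi\<^sub>E {..<k} D \<inter> distinct_tuples k X = Pi\<^sub>E {..<k} (\<lambda>i. X \<inter> D i)"
  proof -
    have "inj_on q {..<k}" if q: "\<forall>i\<in>{..<k}. q i \<in> D i" for q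
    proof (rule inj_onI, rule ccontr)
      fix i j assume ij: "i \<in> {..<k}" "j \<in> {..<k}" "q i = q j" "i \<noteq> j"
      then have "D i \<inter> D j = {}" using D(2) unfolding disjoint_family_on_def by blast
      then show False using q ij by (metis disjoint_iff)
    qed
    then show ?thesis unfolding distinct_tuples_def set_eq_iff Int_iff mem_Collect_eq PiE_iff by blast
  qed
  have fin: "finite (Pi\<^sub>E {..<k} (\<lambda>i. X \<inter> D i))"
    using finite_conf_rel_compact[OF X D(1)] by (intro finite_PiE) auto
  have "emeasure (tuple_count k X) (Pi\<^sub>E {..<k} D) = emeasure (count_space (distinct_tuples k X)) (Pi\<^sub>E {..<k} (\<lambda>i. X \<inter> D i))"
    using emeasure_tuple_count[OF X PiE_rel_compact_sets[OF D(1)]] by (simp add: eq)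
  also have "\<dots> = of_nat (card (Pi\<^sub>E {..<k} (\<lambda>i. X \<inter> D i)))"
    by (rule emeasure_count_space_finite) (use eq fin in auto)
  finally show ?thesis by (simp add: card_PiE)
qed

section \<open>Correlation measures\<close>

abbreviation kernel_measurable :: "(real \<Rightarrow> real \<Rightarrow> complex) \<Rightarrow> bool" where
  "kernel_measurable K \<equiv> (\<lambda>(x, y). K x y) \<in> borel_measurable (leb_Rstar \<Otimes>\<^sub>M leb_Rstar)"

abbreviation kernel_continuous :: "(real \<Rightarrow> real \<Rightarrow> complex) \<Rightarrow> bool" where
  "kernel_continuous K \<equiv> continuous_on (Rstar \<times> Rstar) (\<lambda>(x, y). K x y)"

abbreviation det_density :: "(real \<Rightarrow> real \<Rightarrow> complex) \<Rightarrow> nat \<Rightarrow> (nat \<Rightarrow> real) \<Rightarrow> ennreal" where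
  "det_density K k q \<equiv> ennreal (Re (kernel_det K k q))"

lemma kernel_det_sum:
  "kernel_det K k q = (\<Sum>s \<in> {s. s permutes {0..<k}}. signof s * (\<Prod>i = 0..<k. K (q i) (q (s i))))"
  unfolding kernel_det_def
  by (subst det_def'[where n = k]) (auto intro!: sum.cong prod.cong simp: permutes_in_image)

lemma kernel_det_measurable:
  assumes K: "kernel_measurable K"
  shows "kernel_det K k \<in> borel_measurable (leb_tuples k)"
proof -
  have 1: "(\<lambda>q. K (q i) (q j)) \<in> borel_measurable (leb_tuples k)" if "i < k" "j < k" for i j
    using measurable_compose[OF measurable_Pair[OF tuple_component_measurable[OF that(1)] tuple_component_measurable[OF that(2)]] K] by simp
  show ?thesis
    unfolding kernel_det_sum[abs_def]
    by (intro borel_measurable_sum borel_measurable_times borel_measurable_const borel_measurable_prod 1)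
      (auto dest: permutes_in_image)
qed

lemma det_density_measurable:
  assumes "kernel_measurable K"
  shows "det_density K k \<in> borel_measurable (leb_tuples k)"
  using kernel_det_measurable[OF assms] by measurable

definition det_measure :: "(real \<Rightarrow> real \<Rightarrow> complex) \<Rightarrow> nat \<Rightarrow> (nat \<Rightarrow> real) measure" where
  "det_measure K k = density (leb_tuples k) (det_density K k)"

lemma sets_det_measure: "sets (det_measure K k) = sets (leb_tuples k)"
  by (simp add: det_measure_def)

text \<open>The determinant is bounded on products of sets in a compact set, where the continuous kernel is bounded.\<close>
lemma det_measure_finite:
  assumes K: "kernel_continuous K"
    and m: "kernel_measurable K"
    and D: "\<And>i. i < k \<Longrightarrow> rel_compact_borel (D i)"
  shows "emeasure (det_measure K k) (Pi\<^sub>E {..<k} D) < \<infinity>"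
proof -
  have "\<forall>i. \<exists>C. i < k \<longrightarrow> compact C \<and> C \<subseteq> Rstar \<and> D i \<subseteq> C"
    using D unfolding rel_compact_borel_def by blast
  then obtain C where C: "\<And>i. i < k \<Longrightarrow> compact (C i) \<and> C i \<subseteq> Rstar \<and> D i \<subseteq> C i" by metis
  define U where "U = (\<Union>i\<in>{..<k}. C i)"
  have U: "compact U" "U \<subseteq> Rstar" "\<And>i. i < k \<Longrightarrow> D i \<subseteq> U"
    using C by (auto simp: U_def)
  have "compact ((\<lambda>(x, y). K x y) ` (U \<times> U))"
    by (intro compact_continuous_image continuous_on_subset[OF K] compact_Times U) (use U(2) in auto)
  then obtain b where "\<forall>z\<in>(\<lambda>(x, y). K x y) ` (U \<times> U). cmod z \<le> b"
    using compact_imp_bounded bounded_iff by metis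
  then have b: "cmod (K x y) \<le> b" if "x \<in> U" "y \<in> U" for x y using that by auto
  define M where "M = (\<Sum>s \<in> {s. s permutes {0..<k}}. (\<Prod>i = 0..<k. max b 0))"
  have M: "Re (kernel_det K k q) \<le> M" if q: "q \<in> Pi\<^sub>E {..<k} D" for q
  proof -
    have qU: "q i \<in> U" if "i < k" for i using q U(3)[OF that] that by (auto simp: PiE_iff)
    have "Re (kernel_det K k q) \<le> cmod (kernel_det K k q)" by (rule complex_Re_le_cmod)
    also have "\<dots> \<le> (\<Sum>s \<in> {s. s permutes {0..<k}}. cmod (signof s * (\<Prod>i = 0..<k. K (q i) (q (s i)))))"
      unfolding kernel_det_sum by (rule norm_sum)
    also have "\<dots> \<le> M"
      unfolding M_def
    proof (rule sum_mono)
      fix s assume "s \<in> {s. s permutes {0..<k}}"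
      then have s: "s permutes {0..<k}" by simp
      have "cmod (signof s * (\<Prod>i = 0..<k. K (q i) (q (s i)))) = (\<Prod>i = 0..<k. cmod (K (q i) (q (s i))))"
        by (simp add: norm_mult prod_norm sign_def)
      also have "\<dots> \<le> (\<Prod>i = 0..<k. max b 0)"
        using b qU permutes_in_image[OF s] by (intro prod_mono) (auto simp: le_max_iff_disj)
      finally show "cmod (signof s * (\<Prod>i = 0..<k. K (q i) (q (s i)))) \<le> (\<Prod>i = 0..<k. max b 0)" .
    qed
    finally show ?thesis .
  qed
  have Dsets: "Pi\<^sub>E {..<k} D \<in> sets (leb_tuples k)" by (rule PiE_rel_compact_sets[OF D])
  have "emeasure (det_measure K k) (Pi\<^sub>E {..<k} D) = (\<integral>\<^sup>+q. det_density K k q * indicator (Pi\<^sub>E {..<k} D) q \<partial>leb_tuples k)"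
    unfolding det_measure_def by (rule emeasure_density[OF det_density_measurable[OF m] Dsets])
  also have "\<dots> \<le> (\<integral>\<^sup>+q. ennreal M * indicator (Pi\<^sub>E {..<k} D) q \<partial>leb_tuples k)"
    using M by (intro nn_integral_mono) (auto simp: indicator_def intro: ennreal_leI)
  also have "\<dots> = ennreal M * emeasure (leb_tuples k) (Pi\<^sub>E {..<k} D)"
    using Dsets by (simp add: nn_integral_cmult_indicator)
  also have "emeasure (leb_tuples k) (Pi\<^sub>E {..<k} D) = (\<Prod>i<k. emeasure leb_Rstar (D i))"
    unfolding leb_tuples_def
    by (rule leb_Rstar_product.emeasure_PiM) (auto intro: rel_compact_sets D)
  also have "ennreal M * \<dots> < \<infinity>"
  proof -
    have fin: "emeasure leb_Rstar (D i) < \<infinity>" if "i < k" for i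
    proof -
      have "emeasure leb_Rstar (D i) \<le> emeasure leb_Rstar (C i)"
        using C[OF that] by (intro emeasure_mono borel_subset_leb_Rstar) (auto intro: borel_compact)
      also have "\<dots> = emeasure lborel (C i)"
        unfolding leb_Rstar_def using C[OF that] by (subst emeasure_restrict_space) auto
      also have "\<dots> < \<infinity>" using C[OF that] by (intro emeasure_compact_finite) auto
      finally show ?thesis .
    qed
    have "(\<Prod>i\<in>I. emeasure leb_Rstar (D i)) < \<top>" if "finite I" "I \<subseteq> {..<k}" for I
      using that by (induction I rule: finite_induct) (use fin in \<open>auto simp: ennreal_mult_less_top\<close>)
    then have "(\<Prod>i<k. emeasure leb_Rstar (D i)) < \<top>" by simp
    then show ?thesis by (simp add: ennreal_mult_less_top less_top)
  qed
  finally show ?thesis .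
qed

lemma det_measure_not_inj:
  assumes m: "kernel_measurable K"
  shows "emeasure (det_measure K k) {q \<in> space (leb_tuples k). \<not> inj_on q {..<k}} = 0"
proof -
  let ?N = "{q \<in> space (leb_tuples k). \<not> inj_on q {..<k}}"
  have "?N = space (leb_tuples k) - {q \<in> space (leb_tuples k). inj_on q {..<k} \<and> (\<forall>i<k. q i \<notin> {})}" by auto
  then have N: "?N \<in> sets (leb_tuples k)" using distinct_tuples_sets[of "{}" k] by auto
  have "emeasure (det_measure K k) ?N = (\<integral>\<^sup>+q. det_density K k q * indicator ?N q \<partial>leb_tuples k)"
    unfolding det_measure_def by (rule emeasure_density[OF det_density_measurable[OF m] N])
  also have "\<dots> = (\<integral>\<^sup>+q. 0 \<partial>leb_tuples k)"
    by (rule nn_integral_cong) (auto simp: indicator_def kernel_det_not_inj)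
  finally show ?thesis by simp
qed

lemma correlation_measureD:
  assumes "correlation_measure P k \<rho>" "\<And>i. i < k \<Longrightarrow> rel_compact_borel (D i)" "disjoint_family_on D {..<k}"
  shows "(\<integral>\<^sup>+X. (\<Prod>i<k. of_nat (card (X \<inter> D i))) \<partial>P) = emeasure \<rho> (Pi\<^sub>E {..<k} D)"
  using assms unfolding correlation_measure_def by blast

text \<open>Products of disjoint sets determine the correlation measure, since the diagonals are not charged.\<close>
lemma correlation_measure_unique:
  assumes r: "correlation_measure P k \<rho>" and r': "correlation_measure P k \<rho>'"
    and fin: "\<And>D. D \<in> separated_boxes k {} \<Longrightarrow> emeasure \<rho>' (Pi\<^sub>E {..<k} D) < \<infinity>"
  shows "\<rho> = \<rho>'"
proof (rule measure_eqI)
  have s: "sets \<rho> = sets (leb_tuples k)" "sets \<rho>' = sets (leb_tuples k)"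
    using r r' by (auto simp: correlation_measure_def)
  note sp = sets_eq_imp_space_eq[OF s(1)] sets_eq_imp_space_eq[OF s(2)]
  show "sets \<rho> = sets \<rho>'" using s by simp
  have eq: "emeasure \<rho> (Pi\<^sub>E {..<k} D) = emeasure \<rho>' (Pi\<^sub>E {..<k} D)" if "D \<in> separated_boxes k {}" for D
    using correlation_measureD[OF r separated_boxesD(2,3)[OF that]]
      correlation_measureD[OF r' separated_boxesD(2,3)[OF that]] by simp
  fix B assume "B \<in> sets \<rho>"
  then have B: "B \<in> sets (leb_tuples k)" by (simp add: s)
  define N where "N = {q \<in> space (leb_tuples k). \<not> inj_on q {..<k}}"
  have "N = space (leb_tuples k) - {q \<in> space (leb_tuples k). inj_on q {..<k} \<and> (\<forall>i<k. q i \<notin> {})}" by (auto simp: N_def)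
  then have N: "N \<in> sets (leb_tuples k)" using distinct_tuples_sets[of "{}" k] by auto
  have null: "emeasure \<rho> N = 0" "emeasure \<rho>' N = 0"
    using r r' unfolding correlation_measure_def sp N_def by auto
  have inj: "inj_on q {..<k}" if "q \<in> B - N" for q
    using that B sets.sets_into_space by (auto simp: N_def)
  have "(\<integral>\<^sup>+x. emeasure \<rho> (B - N) \<partial>count_space {()}) = emeasure \<rho>' (B - N)"
    by (rule tuple_measure_determined[where F = "{}" and c = "\<lambda>_. \<rho>"])
       (use s eq fin B N inj in \<open>auto simp: nn_integral_count_space_finite\<close>)
  then have "emeasure \<rho> (B - N) = emeasure \<rho>' (B - N)" by (simp add: nn_integral_count_space_finite)
  moreover have "emeasure \<rho> (B - N) = emeasure \<rho> B" "emeasure \<rho>' (B - N) = emeasure \<rho>' B"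
    using null N B s by (auto intro!: emeasure_Diff_null_set simp: null_sets_def)
  ultimately show "emeasure \<rho> B = emeasure \<rho>' B" by simp
qed

lemma prod_lessThan_add:
  fixes f :: "nat \<Rightarrow> 'a :: comm_monoid_mult"
  shows "(\<Prod>i<m + k. f i) = (\<Prod>i<m. f i) * (\<Prod>j<k. f (m + j))"
  by (induction k) (auto simp: mult.assoc[symmetric])

lemma join_tuples_measurable:
  "(\<lambda>(p, q). join_tuples m k p q) \<in> leb_tuples m \<Otimes>\<^sub>M leb_tuples k \<rightarrow>\<^sub>M leb_tuples (m + k)"
  unfolding join_tuples_def leb_tuples_def split_beta'
proof (rule measurable_restrict)
  fix i assume i: "i \<in> {..<m + k}"
  show "(\<lambda>x. if i < m then fst x i else snd x (i - m)) \<in> PiM {..<m} (\<lambda>_. leb_Rstar) \<Otimes>\<^sub>M PiM {..<k} (\<lambda>_. leb_Rstar) \<rightarrow>\<^sub>M leb_Rstar"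
    using i by (cases "i < m") (auto intro!: measurable_compose[OF measurable_fst] measurable_compose[OF measurable_snd] measurable_component_singleton)
qed

lemma join_tuples_box:
  "p \<in> extensional {..<m} \<Longrightarrow> q \<in> extensional {..<k} \<Longrightarrow>
    join_tuples m k p q \<in> Pi\<^sub>E {..<m + k} (\<lambda>i. if i < m then C i else D (i - m)) \<longleftrightarrow>
    p \<in> Pi\<^sub>E {..<m} C \<and> q \<in> Pi\<^sub>E {..<k} D"
proof -
  assume e: "p \<in> extensional {..<m}" "q \<in> extensional {..<k}"
  have "(\<forall>i<m + k. (if i < m then p i else q (i - m)) \<in> (if i < m then C i else D (i - m)))
     \<longleftrightarrow> (\<forall>i<m. p i \<in> C i) \<and> (\<forall>i<k. q i \<in> D i)" (is "?l \<longleftrightarrow> ?r")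
  proof
    assume l: ?l
    have "p i \<in> C i" if "i < m" for i using l[rule_format, of i] that by simp
    moreover have "q i \<in> D i" if "i < k" for i using l[rule_format, of "m + i"] that by simp
    ultimately show ?r by blast
  next
    assume r: ?r
    show ?l
    proof (intro allI impI)
      fix i assume "i < m + k"
      then show "(if i < m then p i else q (i - m)) \<in> (if i < m then C i else D (i - m))"
        using r[THEN conjunct1, rule_format, of i] r[THEN conjunct2, rule_format, of "i - m"] by auto
    qed
  qed
  moreover have "join_tuples m k p q \<in> Pi\<^sub>E {..<m + k} (\<lambda>i. if i < m then C i else D (i - m)) \<longleftrightarrow> ?l"
    unfolding join_tuples_def restrict_PiE_iff Ball_def lessThan_iff ..
  moreover have "p \<in> Pi\<^sub>E {..<m} C \<and> q \<in> Pi\<^sub>E {..<k} D \<longleftrightarrow> ?r"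
    using e by (simp add: PiE_iff Ball_def)
  ultimately show ?thesis by simp
qed

lemma leb_tuples_join:
  "distr (leb_tuples m \<Otimes>\<^sub>M leb_tuples k) (leb_tuples (m + k)) (\<lambda>(p, q). join_tuples m k p q) = leb_tuples (m + k)"
proof -
  interpret k: sigma_finite_measure "leb_tuples k" by (rule sigma_finite_leb_tuples)
  have "distr (leb_tuples m \<Otimes>\<^sub>M leb_tuples k) (leb_tuples (m + k)) (\<lambda>(p, q). join_tuples m k p q) = PiM {..<m + k} (\<lambda>_. leb_Rstar)"
  proof (rule leb_Rstar_product.PiM_eqI)
    fix A :: "nat \<Rightarrow> real set" assume A: "\<And>i. i \<in> {..<m + k} \<Longrightarrow> A i \<in> sets leb_Rstar"
    have AA: "Pi\<^sub>E {..<m + k} A \<in> sets (leb_tuples (m + k))"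
      unfolding leb_tuples_def using A by (intro sets_PiM_I_finite) auto
    have 1: "Pi\<^sub>E {..<m} A \<in> sets (leb_tuples m)" "Pi\<^sub>E {..<k} (\<lambda>i. A (m + i)) \<in> sets (leb_tuples k)"
      unfolding leb_tuples_def using A by (auto intro!: sets_PiM_I_finite)
    have "Pi\<^sub>E {..<m + k} A = Pi\<^sub>E {..<m + k} (\<lambda>i. if i < m then A i else (\<lambda>j. A (m + j)) (i - m))"
      by (intro PiE_cong) auto
    then have pre: "(\<lambda>(p, q). join_tuples m k p q) -` Pi\<^sub>E {..<m + k} A \<inter> space (leb_tuples m \<Otimes>\<^sub>M leb_tuples k)
      = Pi\<^sub>E {..<m} A \<times> Pi\<^sub>E {..<k} (\<lambda>i. A (m + i))"
      using join_tuples_box[of _ m _ k A "\<lambda>i. A (m + i)"] sets.sets_into_space[OF 1(1)] sets.sets_into_space[OF 1(2)]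
      by (auto simp: space_pair_measure space_leb_tuples PiE_iff)
    have "emeasure (distr (leb_tuples m \<Otimes>\<^sub>M leb_tuples k) (leb_tuples (m + k)) (\<lambda>(p, q). join_tuples m k p q)) (Pi\<^sub>E {..<m + k} A)
       = emeasure (leb_tuples m) (Pi\<^sub>E {..<m} A) * emeasure (leb_tuples k) (Pi\<^sub>E {..<k} (\<lambda>i. A (m + i)))"
      by (subst emeasure_distr[OF join_tuples_measurable AA], subst pre) (rule k.emeasure_pair_measure_Times[OF 1])
    also have "\<dots> = (\<Prod>i<m. emeasure leb_Rstar (A i)) * (\<Prod>i<k. emeasure leb_Rstar (A (m + i)))"
      unfolding leb_tuples_def using A
      by (subst (1 2) leb_Rstar_product.emeasure_PiM) auto
    also have "\<dots> = (\<Prod>i<m + k. emeasure leb_Rstar (A i))"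
      by (rule prod_lessThan_add[symmetric])
    finally show "emeasure (distr (leb_tuples m \<Otimes>\<^sub>M leb_tuples k) (leb_tuples (m + k)) (\<lambda>(p, q). join_tuples m k p q)) (Pi\<^sub>E {..<m + k} A)
       = (\<Prod>i\<in>{..<m + k}. emeasure leb_Rstar (A i))" .
  qed (auto simp: leb_tuples_def)
  then show ?thesis by (simp add: leb_tuples_def)
qed

section \<open>Disintegration along the Palm measures\<close>

text \<open>
  The expected number of tuples in a product under \<open>P\<close>, multiplied by the density at \<open>q\<close>, is the
  integral of the joint density over that product. This is the identity at the point \<open>q\<close> to which the
  formula of the Palm measures is to be localized.
\<close>
definition factorial_moment_identity ::
    "(real \<Rightarrow> real \<Rightarrow> complex) \<Rightarrow> nat \<Rightarrow> (nat \<Rightarrow> real) \<Rightarrow> real set measure \<Rightarrow> nat \<Rightarrow> (nat \<Rightarrow> real set) \<Rightarrow> bool" where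
  "factorial_moment_identity K m q P k D \<longleftrightarrow>
    det_density K m q * (\<integral>\<^sup>+X. (\<Prod>j<k. of_nat (card (X \<inter> D j))) \<partial>P) =
    (\<integral>\<^sup>+r. det_density K (m + k) (join_tuples m k q r) * indicator (Pi\<^sub>E {..<k} D) r \<partial>leb_tuples k)"

text \<open>
  Let \<open>q\<close> range over a product of sets \<open>C\<close> disjoint from the sets \<open>D\<close>. The formula of the Palm measures,
  applied to the number of tuples of the remaining points in the product of the \<open>D\<close>, evaluates the joint
  correlation measure of order \<open>m + k\<close> on the product of the \<open>C\<close> and \<open>D\<close>. So the integrals of both sides of
  the identity over all such products coincide, and therefore both sides agree almost everywhere.
  Disjointness is needed since otherwise points of \<open>q\<close> would be counted in the sets \<open>D\<close>; the closures
  make the tuples \<open>q\<close> in question avoid a closed set.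
\<close>
lemma Palm_disintegration:
  fixes D :: "nat \<Rightarrow> real set"
  assumes K: "kernel_continuous K"
    and Km: "kernel_measurable K"
    and P: "sets P = sets conf_space"
    and corr: "correlation_measure P (m + k) (det_measure K (m + k))"
    and Palm: "reduced_Palm P m (det_measure K m) Q"
    and D: "D \<in> separated_boxes k {}"
  shows "AE q in leb_tuples m. inj_on q {..<m} \<and> (\<forall>i<m. \<forall>j<k. q i \<notin> closure (D j)) \<longrightarrow>
    factorial_moment_identity K m q (Q q) k D"
proof -
  interpret k: sigma_finite_measure "leb_tuples k" by (rule sigma_finite_leb_tuples)
  interpret m: sigma_finite_measure "leb_tuples m" by (rule sigma_finite_leb_tuples)
  note Ds = separated_boxesD[OF D]
  define F where "F = (\<Union>j\<in>{..<k}. closure (D j))"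
  have F: "closed F" unfolding F_def by (intro closed_UN) auto
  define \<phi> :: "real set \<Rightarrow> ennreal" where "\<phi> X = (\<Prod>j<k. of_nat (card (X \<inter> D j)))" for X
  have \<phi>: "\<phi> \<in> borel_measurable conf_space"
    unfolding \<phi>_def by (intro borel_measurable_prod_ennreal card_conf_measurable Ds(2)) auto
  have Q: "Q \<in> leb_tuples m \<rightarrow>\<^sub>M prob_algebra conf_space"
    using Palm unfolding reduced_Palm_def
    by (simp add: measurable_cong_sets[OF sets_det_measure refl])
  define \<Phi> where "\<Phi> q = (\<integral>\<^sup>+X. \<phi> X \<partial>Q q)" for q
  have \<Phi>: "\<Phi> \<in> borel_measurable (leb_tuples m)"
    unfolding \<Phi>_def by (rule measurable_compose[OF measurable_prob_algebraD[OF Q] nn_integral_measurable_subprob_algebra[OF \<phi>]])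
  define f1 where "f1 q = det_density K m q * \<Phi> q" for q
  have f1: "f1 \<in> borel_measurable (leb_tuples m)"
    unfolding f1_def by (intro borel_measurable_times_ennreal det_density_measurable Km \<Phi>)
  define g where "g q r = det_density K (m + k) (join_tuples m k q r) * indicator (Pi\<^sub>E {..<k} D) r" for q r
  have g: "(\<lambda>(q, r). g q r) \<in> borel_measurable (leb_tuples m \<Otimes>\<^sub>M leb_tuples k)"
  proof -
    have "(\<lambda>z. det_density K (m + k) ((\<lambda>(p, q). join_tuples m k p q) z)) \<in> borel_measurable (leb_tuples m \<Otimes>\<^sub>M leb_tuples k)"
      by (rule measurable_compose[OF join_tuples_measurable det_density_measurable[OF Km]])
    moreover have "(\<lambda>z. indicator (Pi\<^sub>E {..<k} D) (snd z) :: ennreal) \<in> borel_measurable (leb_tuples m \<Otimes>\<^sub>M leb_tuples k)"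
      by (rule measurable_compose[OF measurable_snd borel_measurable_indicator[OF Ds(4)]])
    ultimately have "(\<lambda>z. det_density K (m + k) ((\<lambda>(p, q). join_tuples m k p q) z) * indicator (Pi\<^sub>E {..<k} D) (snd z)) \<in> borel_measurable (leb_tuples m \<Otimes>\<^sub>M leb_tuples k)"
      by (rule borel_measurable_times_ennreal)
    then show ?thesis by (simp add: g_def split_beta')
  qed
  define f2 where "f2 q = (\<integral>\<^sup>+r. g q r \<partial>leb_tuples k)" for q
  have f2: "f2 \<in> borel_measurable (leb_tuples m)"
    unfolding f2_def using g by (rule k.borel_measurable_nn_integral)
  have box: "emeasure (density (leb_tuples m) f1) (Pi\<^sub>E {..<m} C) = emeasure (density (leb_tuples m) f2) (Pi\<^sub>E {..<m} C)
      \<and> emeasure (density (leb_tuples m) f2) (Pi\<^sub>E {..<m} C) < \<infinity>" if C: "C \<in> separated_boxes m F" for C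
  proof -
    note Cs = separated_boxesD[OF C]
    have CD: "C i \<inter> D j = {}" if "i < m" "j < k" for i j
    proof -
      have "closure (C i) \<inter> F = {}" by (rule rational_open_interval_closure[OF Cs(1)[OF that(1)]])
      moreover have "C i \<subseteq> closure (C i)" "D j \<subseteq> F"
        using that closure_subset by (auto simp: F_def)
      ultimately show ?thesis by blast
    qed
    define E where "E i = (if i < m then C i else D (i - m))" for i
    have E: "rel_compact_borel (E i)" if "i < m + k" for i
      using that Cs(2)[of i] Ds(2)[of "i - m"] by (auto simp: E_def)
    have Ed: "disjoint_family_on E {..<m + k}"
      unfolding disjoint_family_on_def
    proof (intro ballI impI)
      fix i j assume ij: "i \<in> {..<m + k}" "j \<in> {..<m + k}" "i \<noteq> j"
      have 1: "C i \<inter> C j = {}" if "i < m" "j < m" using Cs(3) ij(3) that unfolding disjoint_family_on_def by blast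
      have 2: "D (i - m) \<inter> D (j - m) = {}" if "\<not> i < m" "\<not> j < m"
      proof -
        have "i - m \<in> {..<k}" "j - m \<in> {..<k}" "i - m \<noteq> j - m" using ij that by auto
        then show ?thesis using Ds(3) unfolding disjoint_family_on_def by blast
      qed
      have 3: "C i \<inter> D (j - m) = {}" if "i < m" "\<not> j < m" by (rule CD) (use ij that in auto)
      have 4: "C j \<inter> D (i - m) = {}" if "j < m" "\<not> i < m" by (rule CD) (use ij that in auto)
      show "E i \<inter> E j = {}"
        using 1 2 3 4 by (auto simp: E_def)
    qed
    \<comment> \<open>Tonelli's theorem for the first \<open>m\<close> and the last \<open>k\<close> entries\<close>
    have "emeasure (det_measure K (m + k)) (Pi\<^sub>E {..<m + k} E) =
      (\<integral>\<^sup>+s. det_density K (m + k) s * indicator (Pi\<^sub>E {..<m + k} E) s \<partial>leb_tuples (m + k))"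
      unfolding det_measure_def
      by (rule emeasure_density[OF det_density_measurable[OF Km] PiE_rel_compact_sets[OF E]])
    also have "\<dots> = (\<integral>\<^sup>+z. det_density K (m + k) (case z of (q, r) \<Rightarrow> join_tuples m k q r) * indicator (Pi\<^sub>E {..<m + k} E) (case z of (q, r) \<Rightarrow> join_tuples m k q r) \<partial>(leb_tuples m \<Otimes>\<^sub>M leb_tuples k))"
    proof -
      have "(\<lambda>s. det_density K (m + k) s * indicator (Pi\<^sub>E {..<m + k} E) s) \<in> borel_measurable (leb_tuples (m + k))"
        by (intro borel_measurable_times_ennreal det_density_measurable Km borel_measurable_indicator PiE_rel_compact_sets E)
      then show ?thesis
        by (subst leb_tuples_join[symmetric], intro nn_integral_distr[OF join_tuples_measurable])
          (simp only: measurable_distr_eq1)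
    qed
    also have "\<dots> = (\<integral>\<^sup>+z. indicator (Pi\<^sub>E {..<m} C) (fst z) * (case z of (q, r) \<Rightarrow> g q r) \<partial>(leb_tuples m \<Otimes>\<^sub>M leb_tuples k))"
    proof (rule nn_integral_cong)
      fix z assume z: "z \<in> space (leb_tuples m \<Otimes>\<^sub>M leb_tuples k)"
      obtain q r where qr: "z = (q, r)" "q \<in> extensional {..<m}" "r \<in> extensional {..<k}"
        using z by (cases z) (auto simp: space_pair_measure space_leb_tuples PiE_def)
      have "join_tuples m k q r \<in> Pi\<^sub>E {..<m + k} E \<longleftrightarrow> q \<in> Pi\<^sub>E {..<m} C \<and> r \<in> Pi\<^sub>E {..<k} D"
        unfolding E_def by (rule join_tuples_box[OF qr(2,3)])
      then show "det_density K (m + k) (case z of (q, r) \<Rightarrow> join_tuples m k q r) * indicator (Pi\<^sub>E {..<m + k} E) (case z of (q, r) \<Rightarrow> join_tuples m k q r) = indicator (Pi\<^sub>E {..<m} C) (fst z) * (case z of (q, r) \<Rightarrow> g q r)"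
        by (simp add: qr(1) g_def indicator_def)
    qed
    also have "\<dots> = (\<integral>\<^sup>+q. \<integral>\<^sup>+r. indicator (Pi\<^sub>E {..<m} C) q * g q r \<partial>leb_tuples k \<partial>leb_tuples m)"
    proof -
      have "(\<lambda>z. indicator (Pi\<^sub>E {..<m} C) (fst z) * (case z of (q, r) \<Rightarrow> g q r)) \<in> borel_measurable (leb_tuples m \<Otimes>\<^sub>M leb_tuples k)"
        by (intro borel_measurable_times_ennreal g measurable_compose[OF measurable_fst borel_measurable_indicator[OF Cs(4)]])
      from k.nn_integral_fst[OF this] show ?thesis by simp
    qed
    also have "\<dots> = (\<integral>\<^sup>+q. f2 q * indicator (Pi\<^sub>E {..<m} C) q \<partial>leb_tuples m)"
    proof (rule nn_integral_cong)
      fix q assume q: "q \<in> space (leb_tuples m)"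
      have "g q \<in> borel_measurable (leb_tuples k)"
        using measurable_Pair2[OF g q] by simp
      then show "(\<integral>\<^sup>+r. indicator (Pi\<^sub>E {..<m} C) q * g q r \<partial>leb_tuples k) = f2 q * indicator (Pi\<^sub>E {..<m} C) q"
        unfolding f2_def by (subst nn_integral_cmult) (auto simp: mult.commute)
    qed
    also have "\<dots> = emeasure (density (leb_tuples m) f2) (Pi\<^sub>E {..<m} C)"
      by (rule emeasure_density[OF f2 Cs(4), symmetric])
    finally have M2: "emeasure (det_measure K (m + k)) (Pi\<^sub>E {..<m + k} E) = emeasure (density (leb_tuples m) f2) (Pi\<^sub>E {..<m} C)" .
    \<comment> \<open>the sets \<open>D j\<close> contain no entry of \<open>q\<close>, so adding these points to \<open>X\<close> does not change \<open>\<phi>\<close>\<close>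
    define u :: "real set \<times> (nat \<Rightarrow> real) \<Rightarrow> ennreal" where "u z = indicator (Pi\<^sub>E {..<m} C) (snd z) * \<phi> (fst z)" for z
    have u: "u \<in> borel_measurable (conf_space \<Otimes>\<^sub>M leb_tuples m)"
      unfolding u_def
      by (intro borel_measurable_times_ennreal measurable_compose[OF measurable_snd borel_measurable_indicator[OF Cs(4)]] measurable_compose[OF measurable_fst \<phi>])
    have "(\<integral>\<^sup>+X. (\<Prod>i<m + k. of_nat (card (X \<inter> E i))) \<partial>P) = (\<integral>\<^sup>+X. (\<integral>\<^sup>+q. u (X, q) \<partial>count_space {q \<in> {..<m} \<rightarrow>\<^sub>E X. inj_on q {..<m}}) \<partial>P)"
    proof (rule nn_integral_cong)
      fix X assume "X \<in> space P"
      then have X: "X \<in> Conf" using sets_eq_imp_space_eq[OF P] by (simp add: space_conf_space)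
      have "(\<integral>\<^sup>+q. u (X, q) \<partial>count_space (distinct_tuples m X)) = (\<integral>\<^sup>+q. indicator (Pi\<^sub>E {..<m} C \<inter> distinct_tuples m X) q * \<phi> X \<partial>count_space (distinct_tuples m X))"
        by (rule nn_integral_cong) (auto simp: u_def indicator_def)
      also have "\<dots> = emeasure (count_space (distinct_tuples m X)) (Pi\<^sub>E {..<m} C \<inter> distinct_tuples m X) * \<phi> X"
        by (subst nn_integral_multc) auto
      also have "\<dots> = emeasure (tuple_count m X) (Pi\<^sub>E {..<m} C) * \<phi> X"
        using emeasure_tuple_count[OF X Cs(4)] by simp
      also have "\<dots> = (\<Prod>i<m. of_nat (card (X \<inter> C i))) * (\<Prod>j<k. of_nat (card (X \<inter> D j)))"
        using tuple_count_box[OF X Cs(2,3)] by (simp add: \<phi>_def)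
      also have "\<dots> = (\<Prod>i<m + k. of_nat (card (X \<inter> E i)))"
        unfolding prod_lessThan_add by (simp add: E_def)
      finally show "(\<Prod>i<m + k. of_nat (card (X \<inter> E i))) = (\<integral>\<^sup>+q. u (X, q) \<partial>count_space {q \<in> {..<m} \<rightarrow>\<^sub>E X. inj_on q {..<m}})"
        by (simp add: distinct_tuples_def)
    qed
    also have "\<dots> = (\<integral>\<^sup>+q. (\<integral>\<^sup>+X. u (X \<union> q ` {..<m}, q) \<partial>Q q) \<partial>det_measure K m)"
      using Palm u unfolding reduced_Palm_def by blast
    also have "\<dots> = (\<integral>\<^sup>+q. indicator (Pi\<^sub>E {..<m} C) q * \<Phi> q \<partial>det_measure K m)"
    proof (rule nn_integral_cong)
      fix q assume "q \<in> space (det_measure K m)"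
      then have q: "q \<in> space (leb_tuples m)" by (simp add: det_measure_def)
      have "u (X \<union> q ` {..<m}, q) = indicator (Pi\<^sub>E {..<m} C) q * \<phi> X" for X
      proof (cases "q \<in> Pi\<^sub>E {..<m} C")
        case True
        have "(X \<union> q ` {..<m}) \<inter> D j = X \<inter> D j" if "j < k" for j
          using True CD[OF _ that] by (auto simp: PiE_iff)
        then show ?thesis by (simp add: u_def \<phi>_def)
      qed (simp add: u_def)
      moreover have "\<phi> \<in> borel_measurable (Q q)"
      proof -
        have "sets (Q q) = sets conf_space"
          using measurable_space[OF Q q] by (simp add: space_prob_algebra)
        then show ?thesis using \<phi> measurable_cong_sets by blast
      qed
      ultimately show "(\<integral>\<^sup>+X. u (X \<union> q ` {..<m}, q) \<partial>Q q) = indicator (Pi\<^sub>E {..<m} C) q * \<Phi> q"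
        by (simp add: \<Phi>_def nn_integral_cmult)
    qed
    also have "\<dots> = (\<integral>\<^sup>+q. det_density K m q * (indicator (Pi\<^sub>E {..<m} C) q * \<Phi> q) \<partial>leb_tuples m)"
      unfolding det_measure_def
      by (intro nn_integral_density det_density_measurable Km borel_measurable_times_ennreal \<Phi> borel_measurable_indicator Cs(4))
    also have "\<dots> = (\<integral>\<^sup>+q. f1 q * indicator (Pi\<^sub>E {..<m} C) q \<partial>leb_tuples m)"
      by (rule nn_integral_cong) (simp add: f1_def mult_ac)
    also have "\<dots> = emeasure (density (leb_tuples m) f1) (Pi\<^sub>E {..<m} C)"
      by (rule emeasure_density[OF f1 Cs(4), symmetric])
    finally have "(\<integral>\<^sup>+X. (\<Prod>i<m + k. of_nat (card (X \<inter> E i))) \<partial>P) = emeasure (density (leb_tuples m) f1) (Pi\<^sub>E {..<m} C)" .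
    moreover have "(\<integral>\<^sup>+X. (\<Prod>i<m + k. of_nat (card (X \<inter> E i))) \<partial>P) = emeasure (det_measure K (m + k)) (Pi\<^sub>E {..<m + k} E)"
      by (rule correlation_measureD[OF corr E Ed])
    moreover have "emeasure (det_measure K (m + k)) (Pi\<^sub>E {..<m + k} E) < \<infinity>"
      by (rule det_measure_finite[OF K Km E])
    ultimately show ?thesis using M2 by simp
  qed
  define W where "W = {q \<in> space (leb_tuples m). inj_on q {..<m} \<and> (\<forall>i<m. q i \<notin> F)}"
  have W: "W \<in> sets (leb_tuples m)" unfolding W_def by (rule distinct_tuples_sets[OF F])
  have iW: "(\<lambda>q. f q * indicator W q) \<in> borel_measurable (leb_tuples m)" if "f \<in> borel_measurable (leb_tuples m)" for f :: "(nat \<Rightarrow> real) \<Rightarrow> ennreal"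
    using that W by (intro borel_measurable_times_ennreal) auto
  have "density (leb_tuples m) (\<lambda>q. f1 q * indicator W q) = density (leb_tuples m) (\<lambda>q. f2 q * indicator W q)"
  proof (rule measure_eqI)
    fix B assume "B \<in> sets (density (leb_tuples m) (\<lambda>q. f1 q * indicator W q))"
    then have B: "B \<in> sets (leb_tuples m)" by simp
    have red: "emeasure (density (leb_tuples m) (\<lambda>q. f q * indicator W q)) B = emeasure (density (leb_tuples m) f) (B \<inter> W)"
      if "f \<in> borel_measurable (leb_tuples m)" for f :: "(nat \<Rightarrow> real) \<Rightarrow> ennreal"
      using that W B iW[OF that]
      by (subst (1 2) emeasure_density) (auto intro!: nn_integral_cong simp: indicator_def)
    have "(\<integral>\<^sup>+x. emeasure (density (leb_tuples m) f1) (B \<inter> W) \<partial>count_space {()}) = emeasure (density (leb_tuples m) f2) (B \<inter> W)"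
      by (rule tuple_measure_determined[where F = F and c = "\<lambda>_. density (leb_tuples m) f1"])
         (use F box B W in \<open>auto simp: nn_integral_count_space_finite W_def\<close>)
    then show "emeasure (density (leb_tuples m) (\<lambda>q. f1 q * indicator W q)) B = emeasure (density (leb_tuples m) (\<lambda>q. f2 q * indicator W q)) B"
      unfolding red[OF f1] red[OF f2] by (simp add: nn_integral_count_space_finite)
  qed simp
  then have "AE q in leb_tuples m. f1 q * indicator W q = f2 q * indicator W q"
    using m.density_unique_iff[OF iW[OF f1] iW[OF f2]] by simp
  then have "AE q in leb_tuples m. f1 q * indicator W q = f2 q * indicator W q \<and> q \<in> space (leb_tuples m)"
    by (auto intro: AE_I2)
  then show ?thesis
  proof eventually_elim
    case (elim q)
    show ?case
    proof
      assume "inj_on q {..<m} \<and> (\<forall>i<m. \<forall>j<k. q i \<notin> closure (D j))"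
      then have "q \<in> W" using elim by (auto simp: W_def F_def)
      then show "factorial_moment_identity K m q (Q q) k D"
        using elim by (simp add: factorial_moment_identity_def f1_def f2_def \<Phi>_def \<phi>_def g_def)
    qed
  qed
qed

text \<open>A set of full measure is dense, because a product of intervals has positive measure.\<close>
lemma leb_tuples_AE_dense:
  assumes ae: "AE q in leb_tuples k. P q" and q: "q \<in> space (leb_tuples k)" and e: "e > 0"
  shows "\<exists>r\<in>space (leb_tuples k). P r \<and> (\<forall>i<k. \<bar>r i - q i\<bar> < e)"
proof (rule ccontr)
  assume none: "\<not> ?thesis"
  define I where "I i = {q i - e<..<q i + e} - {0}" for i
  have I: "I i \<in> sets leb_Rstar" for i
    by (rule borel_subset_leb_Rstar) (auto simp: I_def Rstar_def)
  have B: "Pi\<^sub>E {..<k} I \<in> sets (leb_tuples k)"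
    unfolding leb_tuples_def using I by (intro sets_PiM_I_finite) auto
  have "AE r in leb_tuples k. \<not> r \<in> Pi\<^sub>E {..<k} I"
    using ae
  proof (rule AE_mp, intro AE_I2 impI notI)
    fix r assume r: "r \<in> space (leb_tuples k)" "P r" "r \<in> Pi\<^sub>E {..<k} I"
    have "\<bar>r i - q i\<bar> < e" if "i < k" for i
    proof -
      have "r i \<in> I i" using r(3) that by auto
      then show ?thesis by (auto simp: I_def)
    qed
    then show False using none r by blast
  qed
  then have "emeasure (leb_tuples k) {r \<in> space (leb_tuples k). r \<in> Pi\<^sub>E {..<k} I} = 0"
    by (rule emeasure_eq_0_AE)
  moreover have "{r \<in> space (leb_tuples k). r \<in> Pi\<^sub>E {..<k} I} = Pi\<^sub>E {..<k} I"
    using sets.sets_into_space[OF B] by auto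
  moreover have "emeasure (leb_tuples k) (Pi\<^sub>E {..<k} I) = (\<Prod>i<k. emeasure leb_Rstar (I i))"
    unfolding leb_tuples_def by (rule leb_Rstar_product.emeasure_PiM) (auto intro: I)
  moreover have "emeasure leb_Rstar (I i) \<noteq> 0" for i
  proof -
    have "emeasure leb_Rstar (I i) = emeasure lborel (I i)"
      unfolding leb_Rstar_def by (rule emeasure_restrict_space) (auto simp: I_def Rstar_def)
    also have "\<dots> = emeasure lborel {q i - e<..<q i + e}"
      unfolding I_def by (rule emeasure_Diff_null_set) auto
    also have "\<dots> = ennreal (2 * e)" using e by simp
    finally show ?thesis using e by simp
  qed
  ultimately show False by simp
qed

text \<open>
  Continuity removes the null set on which the determinant might fail to be nonnegative. This is what
  allows the determinant to be evaluated at the tuples joined from a fixed \<open>q\<close>, which form a null set.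
\<close>
lemma kernel_det_nonneg_everywhere:
  assumes K: "kernel_continuous K"
    and ae: "AE q in leb_tuples k. kernel_det K k q \<in> \<real>\<^sub>\<ge>\<^sub>0" and q: "q \<in> space (leb_tuples k)"
  shows "kernel_det K k q \<in> \<real>\<^sub>\<ge>\<^sub>0"
proof -
  have "\<forall>n. \<exists>r. r \<in> space (leb_tuples k) \<and> kernel_det K k r \<in> \<real>\<^sub>\<ge>\<^sub>0 \<and> (\<forall>i<k. \<bar>r i - q i\<bar> < inverse (real (Suc n)))"
    using leb_tuples_AE_dense[OF ae q] by (metis inverse_positive_iff_positive of_nat_0_less_iff zero_less_Suc)
  then obtain r where r: "\<And>n. r n \<in> space (leb_tuples k)" "\<And>n. kernel_det K k (r n) \<in> \<real>\<^sub>\<ge>\<^sub>0"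
    "\<And>n i. i < k \<Longrightarrow> \<bar>r n i - q i\<bar> < inverse (real (Suc n))" by metis
  have lim: "(\<lambda>n. r n i) \<longlonglongrightarrow> q i" if "i < k" for i
  proof (rule LIM_zero_cancel, rule Lim_null_comparison)
    show "\<forall>\<^sub>F n in sequentially. norm (r n i - q i) \<le> inverse (real (Suc n))"
      using r(3)[OF that] by (intro always_eventually allI) (simp add: less_imp_le)
    show "(\<lambda>n. inverse (real (Suc n))) \<longlonglongrightarrow> 0" by (rule LIMSEQ_inverse_real_of_nat)
  qed
  have R: "q i \<in> Rstar" "r n i \<in> Rstar" if "i < k" for i n
    using q r(1)[of n] that by (auto simp: space_leb_tuples PiE_iff)
  have limK: "(\<lambda>n. K (r n i) (r n j)) \<longlonglongrightarrow> K (q i) (q j)" if "i < k" "j < k" for i j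
  proof -
    have "(\<lambda>n. (r n i, r n j)) \<longlonglongrightarrow> (q i, q j)" by (intro tendsto_Pair lim that)
    from continuous_on_tendsto_compose[OF K this] show ?thesis using R that by simp
  qed
  have "(\<lambda>n. kernel_det K k (r n)) \<longlonglongrightarrow> kernel_det K k q"
    unfolding kernel_det_sum
    by (intro tendsto_sum tendsto_mult tendsto_const tendsto_prod limK) (auto dest: permutes_in_image)
  then show ?thesis
    by (rule closed_sequentially[OF closed_nonneg_Reals_complex, rotated]) (rule r(2))
qed

text \<open>
  The point \<open>q\<close> is now fixed. Dividing the identities by the density at \<open>q\<close> and applying the Schur
  complement formula shows that the factorial moments of \<open>PP\<close> on products of disjoint rational intervals
  away from \<open>q\<close> are given by \<open>K'\<close>, which determines them on all tuples of distinct points different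
  from those of \<open>q\<close>. The remaining tuples contribute nothing: configurations avoid \<open>q\<close>, and the determinant
  vanishes because the joined tuple has a repeated entry.
\<close>
lemma Palm_determinantal:
  assumes K: "kernel_continuous K"
    and K'c: "kernel_continuous K'"
    and K'm: "kernel_measurable K'"
    and schur: "\<And>k r. r \<in> space (leb_tuples k) \<Longrightarrow> kernel_det K (m + k) (join_tuples m k q r) = kernel_det K m q * kernel_det K' k r"
    and nonneg: "\<And>k. k \<ge> 1 \<Longrightarrow> AE s in leb_tuples k. kernel_det K k s \<in> \<real>\<^sub>\<ge>\<^sub>0" and m: "m \<ge> 1"
    and pos: "Re (kernel_det K m q) > 0" and q: "q \<in> space (leb_tuples m)"
    and PP: "prob_space PP" "sets PP = sets conf_space"
    and avoid: "AE X in PP. q ` {..<m} \<inter> X = {}"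
    and eq: "\<And>k D. k \<ge> 1 \<Longrightarrow> D \<in> separated_boxes k {} \<Longrightarrow> (\<forall>i<m. \<forall>j<k. q i \<notin> closure (D j)) \<Longrightarrow>
      factorial_moment_identity K m q PP k D"
  shows "determinantal PP K'"
proof -
  define d where "d = Re (kernel_det K m q)"
  have d: "d > 0" "kernel_det K m q = complex_of_real d"
  proof -
    show "d > 0" using pos by (simp add: d_def)
    have "kernel_det K m q \<in> \<real>\<^sub>\<ge>\<^sub>0" by (rule kernel_det_nonneg_everywhere[OF K nonneg[OF m] q])
    then show "kernel_det K m q = complex_of_real d"
      by (simp add: d_def complex_nonneg_Reals_iff complex_eq_iff)
  qed
  have join_space: "join_tuples m k q r \<in> space (leb_tuples (m + k))" if "r \<in> space (leb_tuples k)" for k r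
    using measurable_space[OF join_tuples_measurable, of "(q, r)" m k] that q by (simp add: space_pair_measure)
  have det': "kernel_det K' k r \<in> \<real>\<^sub>\<ge>\<^sub>0" if "k \<ge> 1" "r \<in> space (leb_tuples k)" for k r
  proof -
    have "kernel_det K (m + k) (join_tuples m k q r) \<in> \<real>\<^sub>\<ge>\<^sub>0"
      using that m by (intro kernel_det_nonneg_everywhere[OF K nonneg] join_space) auto
    then have "complex_of_real d * kernel_det K' k r \<in> \<real>\<^sub>\<ge>\<^sub>0" using schur[OF that(2)] d(2) by simp
    then show ?thesis using d(1) by (auto simp: complex_nonneg_Reals_iff zero_le_mult_iff)
  qed
  have corr: "correlation_measure PP k (det_measure K' k)" if k: "k \<ge> 1" for k
    unfolding correlation_measure_def
  proof (intro conjI allI impI)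
    show "sets (det_measure K' k) = sets (leb_tuples k)" by (rule sets_det_measure)
    have sp: "space (det_measure K' k) = space (leb_tuples k)" by (simp add: det_measure_def)
    show "emeasure (det_measure K' k) {q \<in> space (det_measure K' k). \<not> inj_on q {..<k}} = 0"
      unfolding sp by (rule det_measure_not_inj[OF K'm])
    fix D :: "nat \<Rightarrow> real set" assume D': "(\<forall>i<k. rel_compact_borel (D i)) \<and> disjoint_family_on D {..<k}"
    then have D: "\<And>i. i < k \<Longrightarrow> rel_compact_borel (D i)" "disjoint_family_on D {..<k}" by auto
    define F where "F = q ` {..<m}"
    have F: "closed F" unfolding F_def by (intro finite_imp_closed) auto
    define W where "W = {r \<in> space (leb_tuples k). inj_on r {..<k} \<and> (\<forall>i<k. r i \<notin> F)}"
    have W: "W \<in> sets (leb_tuples k)" unfolding W_def by (rule distinct_tuples_sets[OF F])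
    have Ds: "Pi\<^sub>E {..<k} D \<in> sets (leb_tuples k)" by (rule PiE_rel_compact_sets[OF D(1)])
    have PPspace: "space PP = Conf" using sets_eq_imp_space_eq[OF PP(2)] by (simp add: space_conf_space)
    have cong: "(\<integral>\<^sup>+X. emeasure (tuple_count k X) (Pi\<^sub>E {..<k} G) \<partial>PP) = (\<integral>\<^sup>+X. (\<Prod>j<k. of_nat (card (X \<inter> G j))) \<partial>PP)"
      if "\<And>i. i < k \<Longrightarrow> rel_compact_borel (G i)" "disjoint_family_on G {..<k}" for G
      by (rule nn_integral_cong) (use PPspace that in \<open>auto intro: tuple_count_box\<close>)
    have "(\<integral>\<^sup>+X. emeasure (tuple_count k X) (Pi\<^sub>E {..<k} D \<inter> W) \<partial>PP) = emeasure (det_measure K' k) (Pi\<^sub>E {..<k} D \<inter> W)"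
    proof (rule tuple_measure_determined[OF F])
      fix G assume G: "G \<in> separated_boxes k F"
      note Gs = separated_boxesD[OF G]
      have "(\<lambda>X. \<Prod>j<k. of_nat (card (X \<inter> G j)) :: ennreal) \<in> borel_measurable PP"
        unfolding measurable_cong_sets[OF PP(2) refl]
        by (intro borel_measurable_prod_ennreal card_conf_measurable Gs(2)) auto
      then show "(\<lambda>X. emeasure (tuple_count k X) (Pi\<^sub>E {..<k} G)) \<in> borel_measurable PP"
        by (subst measurable_cong[OF tuple_count_box[OF _ Gs(2,3)]]) (auto simp: PPspace)
      show "emeasure (det_measure K' k) (Pi\<^sub>E {..<k} G) < \<infinity>"
        by (rule det_measure_finite[OF K'c K'm Gs(2)])
      show "emeasure (tuple_count k X) (Pi\<^sub>E {..<k} G) < \<infinity>" if "X \<in> space PP" for X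
      proof -
        have "(\<Prod>i<k. of_nat (card (X \<inter> G i)) :: ennreal) < \<infinity>"
          unfolding of_nat_prod[symmetric] infinity_ennreal_def by (rule of_nat_less_top)
        then show ?thesis using that tuple_count_box[OF _ Gs(2,3)] by (simp add: PPspace)
      qed
      have G0: "G \<in> separated_boxes k {}"
      proof -
        have "rational_open_intervals F \<subseteq> rational_open_intervals {}"
          unfolding rational_open_intervals_def by blast
        then show ?thesis using G unfolding separated_boxes_def PiE_iff by blast
      qed
      have "\<forall>i<m. \<forall>j<k. q i \<notin> closure (G j)"
        using rational_open_interval_closure[OF Gs(1)] by (auto simp: F_def)
      from eq[OF k G0 this, unfolded factorial_moment_identity_def]
      have "ennreal d * (\<integral>\<^sup>+X. (\<Prod>j<k. of_nat (card (X \<inter> G j))) \<partial>PP) =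
        (\<integral>\<^sup>+r. det_density K (m + k) (join_tuples m k q r) * indicator (Pi\<^sub>E {..<k} G) r \<partial>leb_tuples k)"
        by (simp add: d_def)
      also have "\<dots> = (\<integral>\<^sup>+r. ennreal d * (det_density K' k r * indicator (Pi\<^sub>E {..<k} G) r) \<partial>leb_tuples k)"
        using d(1) by (intro nn_integral_cong) (simp add: schur d(2) ennreal_mult' mult.assoc)
      also have "\<dots> = ennreal d * (\<integral>\<^sup>+r. det_density K' k r * indicator (Pi\<^sub>E {..<k} G) r \<partial>leb_tuples k)"
        by (intro nn_integral_cmult borel_measurable_times_ennreal det_density_measurable K'm borel_measurable_indicator Gs(4))
      also have "\<dots> = ennreal d * emeasure (det_measure K' k) (Pi\<^sub>E {..<k} G)"
        unfolding det_measure_def by (subst emeasure_density[OF det_density_measurable[OF K'm] Gs(4)]) simp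
      finally have "(\<integral>\<^sup>+X. (\<Prod>j<k. of_nat (card (X \<inter> G j))) \<partial>PP) = emeasure (det_measure K' k) (Pi\<^sub>E {..<k} G)"
        using d(1) by (simp add: ennreal_mult_cancel_left)
      then show "(\<integral>\<^sup>+X. emeasure (tuple_count k X) (Pi\<^sub>E {..<k} G) \<partial>PP) = emeasure (det_measure K' k) (Pi\<^sub>E {..<k} G)"
        using cong[OF Gs(2,3)] by simp
    qed (use Ds W in \<open>auto simp: sets_tuple_count sets_det_measure W_def\<close>)
    moreover have "(\<integral>\<^sup>+X. emeasure (tuple_count k X) (Pi\<^sub>E {..<k} D \<inter> W) \<partial>PP) = (\<integral>\<^sup>+X. emeasure (tuple_count k X) (Pi\<^sub>E {..<k} D) \<partial>PP)"
    proof (rule nn_integral_cong_AE)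
      show "AE X in PP. emeasure (tuple_count k X) (Pi\<^sub>E {..<k} D \<inter> W) = emeasure (tuple_count k X) (Pi\<^sub>E {..<k} D)"
        using avoid
      proof (rule AE_mp, intro AE_I2 impI)
        fix X assume "X \<in> space PP" and X: "q ` {..<m} \<inter> X = {}"
        then have XC: "X \<in> Conf" by (simp add: PPspace)
        have "distinct_tuples k X \<inter> Pi\<^sub>E {..<k} D \<subseteq> W"
        proof
          fix r assume r: "r \<in> distinct_tuples k X \<inter> Pi\<^sub>E {..<k} D"
          then have "r \<in> space (leb_tuples k)" using sets.sets_into_space[OF Ds] by auto
          then show "r \<in> W" using r X by (auto simp: W_def F_def distinct_tuples_def PiE_iff)
        qed
        then have "Pi\<^sub>E {..<k} D \<inter> W \<inter> distinct_tuples k X = Pi\<^sub>E {..<k} D \<inter> distinct_tuples k X" by auto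
        then show "emeasure (tuple_count k X) (Pi\<^sub>E {..<k} D \<inter> W) = emeasure (tuple_count k X) (Pi\<^sub>E {..<k} D)"
          using emeasure_tuple_count[OF XC] Ds W by simp
      qed
    qed
    moreover have "emeasure (det_measure K' k) (Pi\<^sub>E {..<k} D \<inter> W) = emeasure (det_measure K' k) (Pi\<^sub>E {..<k} D)"
    proof -
      have zero: "kernel_det K' k r = 0" if r: "r \<in> space (leb_tuples k)" "r \<notin> W" for r
      proof (cases "inj_on r {..<k}")
        case True
        then obtain i where "i < k" "r i \<in> F" using r by (auto simp: W_def)
        then obtain j where ij: "i < k" "j < m" "r i = q j" by (auto simp: F_def)
        have "\<not> inj_on (join_tuples m k q r) {..<m + k}"
        proof
          assume "inj_on (join_tuples m k q r) {..<m + k}"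
          moreover have "join_tuples m k q r (m + i) = join_tuples m k q r j" using ij by (simp add: join_tuples_def)
          ultimately have "m + i = j" using ij by (auto dest: inj_onD)
          then show False using ij by simp
        qed
        then have "kernel_det K (m + k) (join_tuples m k q r) = 0" by (rule kernel_det_not_inj)
        then show ?thesis using schur[OF r(1)] d by simp
      qed (rule kernel_det_not_inj)
      have "Pi\<^sub>E {..<k} D \<inter> W \<in> sets (leb_tuples k)" using Ds W by auto
      then show ?thesis
        unfolding det_measure_def using Ds
        by (subst (1 2) emeasure_density[OF det_density_measurable[OF K'm]])
           (auto intro!: nn_integral_cong simp: indicator_def zero)
    qed
    ultimately show "(\<integral>\<^sup>+X. (\<Prod>i<k. of_nat (card (X \<inter> D i))) \<partial>PP) = emeasure (det_measure K' k) (Pi\<^sub>E {..<k} D)"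
      using cong[OF D] by simp
  qed
  show ?thesis
    unfolding determinantal_def point_process_def
    using PP det' corr by (auto intro!: AE_I2 simp: det_measure_def)
qed

theorem proposition1p7:
  fixes A :: "real \<Rightarrow> real"
    and \<mu> :: "real set measure"
    and n :: nat
    and \<rho> :: "(nat \<Rightarrow> real) measure"
    and Palm :: "(nat \<Rightarrow> real) \<Rightarrow> real set measure"
  assumes A_C1: "A C1_differentiable_on Rstar"
    and A_L2: "(\<lambda>x. complex_of_real (A x)) \<in> L2"
    and A_supp: "Rstar \<subseteq> closure {x \<in> Rstar. A x \<noteq> 0}"
    and L_bdd: "defines_bounded_oper (L_kernel A)"
    and mu: "L_process (integral_oper (L_kernel A)) \<mu>"
    and n: "n \<ge> 1"
    and rho: "correlation_measure \<mu> (2 * n) \<rho>"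
    and Palm: "reduced_Palm \<mu> (2 * n) \<rho> Palm"
  shows "AE p in \<rho>.
           inj_on p {..<2 * n} \<and> (\<forall>i<n. p i > 0 \<and> p (n + i) < 0) \<longrightarrow>
           L_process
             (\<lambda>g. mult_oper (f_Palm n p) (integral_oper (L_kernel A) (mult_oper (f_Palm n p) g)))
             (Palm p)"
proof -
  define m where "m = 2 * n"
  have m: "m \<ge> 1" using n by (simp add: m_def)
  obtain K where K: "L_correlation_kernel (integral_oper (L_kernel A)) K" "determinantal \<mu> K"
    using mu by (auto simp: L_process_def)
  obtain S where S: "inverse_of_one_plus (integral_oper (L_kernel A)) S" "\<forall>f\<in>L2. eq_ae (integral_oper K f) (integral_oper (L_kernel A) (S f))"
    using K(1) by (auto simp: L_correlation_kernel_def)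
  have Kc: "kernel_continuous K" and Kb: "defines_bounded_oper K"
    using K(1) by (auto simp: L_correlation_kernel_def)
  have Km: "kernel_measurable K"
    using Kb by (simp add: defines_bounded_oper_def)
  interpret L_correlation A S K
    using A_L2 mu S Kc Kb C1_differentiable_imp_continuous_on[OF A_C1]
    by unfold_locales (auto simp: L_process_def)
  have \<mu>: "sets \<mu> = sets conf_space" using K(2) by (simp add: determinantal_def point_process_def)
  have nonneg: "AE q in leb_tuples k. kernel_det K k q \<in> \<real>\<^sub>\<ge>\<^sub>0" if "k \<ge> 1" for k
    using K(2) that by (simp add: determinantal_def)
  have corr: "correlation_measure \<mu> k (det_measure K k)" if "k \<ge> 1" for k
    using K(2) that by (simp add: determinantal_def det_measure_def)
  have \<rho>: "\<rho> = det_measure K m"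
    using rho corr[OF m] unfolding m_def
    by (rule correlation_measure_unique) (rule det_measure_finite[OF Kc Km separated_boxesD(2)])
  have Palm': "reduced_Palm \<mu> m (det_measure K m) Palm" using Palm by (simp add: \<rho> m_def)
  \<comment> \<open>only countably many orders and boxes, hence a single null set of tuples\<close>
  have dis: "AE q in leb_tuples m. \<forall>k\<in>{1..}. \<forall>D\<in>separated_boxes k {}. inj_on q {..<m} \<and> (\<forall>i<m. \<forall>j<k. q i \<notin> closure (D j)) \<longrightarrow>
    factorial_moment_identity K m q (Palm q) k D"
    by (intro AE_ball_countable' countable_separated_boxes Palm_disintegration[OF Kc Km \<mu> corr Palm']) auto
  have "AE q in det_measure K m. Palm q \<in> space (prob_algebra conf_space) \<and> (AE X in Palm q. q ` {..<m} \<inter> X = {})"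
  proof -
    have "AE q in det_measure K m. AE X in Palm q. q ` {..<m} \<inter> X = {}"
      using Palm' by (simp add: reduced_Palm_def)
    moreover have "AE q in det_measure K m. Palm q \<in> space (prob_algebra conf_space)"
      using Palm' by (intro AE_I2) (auto simp: reduced_Palm_def intro: measurable_space)
    ultimately show ?thesis by eventually_elim simp
  qed
  then have carried: "AE q in leb_tuples m. 0 < det_density K m q \<longrightarrow> Palm q \<in> space (prob_algebra conf_space) \<and> (AE X in Palm q. q ` {..<m} \<inter> X = {})"
    unfolding det_measure_def by (subst (asm) AE_density[OF det_density_measurable[OF Km]])
  have main: "L_process (\<lambda>g. mult_oper (f_Palm n q) (integral_oper (L_kernel A) (mult_oper (f_Palm n q) g))) (Palm q)"
    if q: "q \<in> space (leb_tuples m)" and pos: "0 < det_density K m q" and inj: "inj_on q {..<m}" and sgn: "\<forall>i<n. q i > 0 \<and> q (n + i) < 0"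
      and prob: "Palm q \<in> space (prob_algebra conf_space)" and avoid: "AE X in Palm q. q ` {..<m} \<inter> X = {}"
      and eq: "\<forall>k\<in>{1..}. \<forall>D\<in>separated_boxes k {}. inj_on q {..<m} \<and> (\<forall>i<m. \<forall>j<k. q i \<notin> closure (D j)) \<longrightarrow>
        factorial_moment_identity K m q (Palm q) k D"
    for q
  proof -
    have qR: "q i \<in> Rstar" if "i < m" for i using q that by (auto simp: space_leb_tuples PiE_iff)
    have pos': "Re (kernel_det K m q) > 0" using pos by simp
    then have det: "kernel_det K m q \<noteq> 0" by auto
    have Aq: "A (q i) \<noteq> 0" if "i < m" for i
    proof
      assume "A (q i) = 0"
      then have "kernel_det K m q = 0"
        using K_zero[OF _ qR qR] that by (intro kernel_det_zero_row[OF that]) auto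
      then show False using det by simp
    qed
    obtain N where N: "\<forall>i<m. \<forall>j<m. (\<Sum>a<m. N i a * K (q a) (q j)) = (if i = j then 1 else 0)"
      using kernel_det_left_inverse[OF det] by blast
    obtain C where C: "\<forall>x\<in>Rstar. \<bar>f_Palm n q x\<bar> \<le> C" using f_Palm_bounded[of n q] sgn by blast
    interpret Palm_kernel A S K m q N "f_Palm n q" C
    proof
      show "q i \<in> Rstar" if "i < m" for i by (rule qR[OF that])
      show "f_Palm n q (q i) = 0" if "i < m" for i
        using sgn that by (intro f_Palm_zero) (auto simp: m_def)
      show "\<exists>c. \<forall>y\<in>Rstar. complex_of_real (f_Palm n q x) * L_kernel A x y * complex_of_real (f_Palm n q y) =
          L_kernel A x y - (\<Sum>j<m. c j * L_kernel A (q j) y)" if "x \<in> Rstar" for x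
        unfolding m_def by (rule f_Palm_partial_fractions) (use sgn inj Aq that in \<open>auto simp: m_def\<close>)
    qed (use N C f_Palm_measurable in auto)
    have "determinantal (Palm q) K'"
    proof (rule Palm_determinantal[OF Kc K'_cont K'_measurable _ nonneg m pos' q _ _ avoid])
      show "kernel_det K (m + k) (join_tuples m k q r) = kernel_det K m q * kernel_det K' k r"
        if "r \<in> space (leb_tuples k)" for k r
      proof (rule kernel_det_join)
        show "K' x y = K x y - (\<Sum>a<m. e a x * K (q a) y)" for x y by (rule K'_def)
        show "K (r i) (q j) = (\<Sum>a<m. e a (r i) * K (q a) (q j))" if "j < m" for i j
          using K'_zero[OF that, of "r i"] by (simp add: K'_def)
      qed
      show "prob_space (Palm q)" "sets (Palm q) = sets conf_space"
        using prob by (auto simp: space_prob_algebra)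
    qed (use eq inj in auto)
    then show ?thesis
      using L'_bounded L'_block K'_correlation unfolding L'_def[abs_def] L_process_def by blast
  qed
  have "AE q in leb_tuples m. 0 < det_density K m q \<longrightarrow> inj_on q {..<2 * n} \<and> (\<forall>i<n. q i > 0 \<and> q (n + i) < 0) \<longrightarrow>
    L_process (\<lambda>g. mult_oper (f_Palm n q) (integral_oper (L_kernel A) (mult_oper (f_Palm n q) g))) (Palm q)"
    using dis carried AE_space by eventually_elim (use main in \<open>auto simp: m_def\<close>)
  then show ?thesis
    unfolding \<rho> det_measure_def AE_density[OF det_density_measurable[OF Km]] .
qed

end
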